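(* Let $\mathscr K\subset\{1,\dots,n\}$ and let $\Delta:\mathscr K\to\mathbb R^+$ satisfy $\sum_{K\in\mathscr K}e^{-\Delta(K)}\le1$. Let $\delta(1)=1$ and $\delta(K)=\frac Vn\wedge\frac1K$ for $K\ge2$, and consider the penalty function $$\mathrm{pen}(q)=\kappa\inf_{K\in\mathscr K:\,Q\in\mathscr Q(K)}\left[174.1\,KV\left[5.82+\log\left(\frac{(K+1)^2}{\delta(K)}\right)+\log_+\left(\frac n{KV}\right)\right]+\Delta(K)\right],\qquad q\in\mathcal Q_\delta,\ Q=q\cdot\mu.$$ Assume that there exists $P^*\in\mathscr P$ such that $\mathbf P^*=(P^* )^{\otimes n}$. There is a positive numerical constant $C$ such that any $\rho$-estimator $\hat P=\hat P_\delta$ on $\mathscr Q_\delta$ with penalty $\mathrm{pen}$ satisfies: for all $\xi>0$, with probability at least $1-e^{-\xi}$, $$C\,h^2(P^*,\hat P)\le\inf_{K\in\mathscr K}\left\{h^2(P^*,\mathscr Q(K))+\frac{KV\log(n)+\xi+\Delta(K)}{n}\right\}.$$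
   Context: Data. $\mathbf X=(X_1,\dots,X_n)$ takes values in $\mathscr X^n$ and has distribution $\mathbf P^*$; $\mathscr P$ is the set of probabilities on $(\mathscr X,\mathcal X)$. $h^2(Q,Q')=\frac12\int(\sqrt{dQ/d\nu}-\sqrt{dQ'/d\nu})^2d\nu$ is the squared Hellinger distance; $h^2(P,\mathscr A)=\inf_{Q\in\mathscr A}h^2(P,Q)$. $\log_+(x)=\max(\log x,0)$, $a\wedge b=\min(a,b)$. The VC-index of a class of functions is the smallest integer $m\ge1$ such that no $m$-point set is shattered by the subgraphs $\{(x,t):t<f(x)\}$; the class is VC-subgraph if this is finite. Models. $\overline{\mathscr F}\subset\mathscr P$ contains an at most countable Hellinger-dense subset $\mathscr F$; $\mu$ is a $\sigma$-finite measure and $\overline{\mathscr F}=\{f\cdot\mu:f\in\overline{\mathcal F}\}$, where the density class $\overline{\mathcal F}$ is VC-subgraph with VC-index $V\geq 1$. With $\mathcal W_K=\{w\in[0,1]^K:\sum_kw_k=1\}$, for $K\in\mathscr K$, $\mathscr Q(K)$ is a given subset of $\{\sum_{k=1}^Kw_kF_k:w\in\mathcal W_K,F_k\in\overline{\mathscr F}\}$; $\mathscr Q_\delta(K)=\{\sum_{k=1}^Kw_kF_k\in\mathscr Q(K):w\in\mathcal W_K,w_k\ge\delta(K),w_k\in\mathbb Q,F_k\in\mathscr F\}$; $\mathscr Q_\delta=\bigcup_{K\in\mathscr K}\mathscr Q_\delta(K)$, with corresponding family of $\mu$-densities $\mathcal Q_\delta$. Penalized $\rho$-estimator. Let $\psi(x)=\frac{x-1}{x+1}$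 on $[0,+\infty]$ ($\psi(+\infty)=1$), $\mathbf T(\mathbf X,q,q')=\sum_{i=1}^n\psi\big(\sqrt{q'(X_i)/q(X_i)}\big)$ (with $0/0=1$, $a/0=+\infty$ for $a>0$) and $\mathbf\Upsilon(\mathbf X,q)=\sup_{q'\in\mathcal Q_\delta}[\mathbf T(\mathbf X,q,q')-\mathrm{pen}(q')]+\mathrm{pen}(q)$. A $\rho$-estimator on $\mathscr Q_\delta$ with penalty $\mathrm{pen}$ is any measurable element of the Hellinger closure of $\{q\cdot\mu:q\in\mathcal Q_\delta,\ \mathbf\Upsilon(\mathbf X,q)<\inf_{q'\in\mathcal Q_\delta}\mathbf\Upsilon(\mathbf X,q')+8.24\}$. The numerical constant $\kappa$ is $\kappa=\frac{35a_2^2}{a_1}+74=280\sqrt2+74$ with $a_1=3/8$, $a_2^2=3\sqrt2$.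
   Formalization: Two hypotheses are added because the claim fails without them: n ≥ 2, and h²(Q, Q_δ(K)) ≤ (K−1)δ(K) for every Q in Q(K), K in 𝒦 (automatic for all K-component mixtures). Formally C is fixed per underlying set of observations; a disjoint union makes it universal. *)

theory Defs
  imports "HOL-Probability.Probability"
begin

section \<open>Hellinger distance\<close>

definition sum_measure :: "'a measure \<Rightarrow> 'a measure \<Rightarrow> 'a measure" where
  "sum_measure P Q = measure_of (space P) (sets P) (\<lambda>A. emeasure P A + emeasure Q A)"

text \<open>The squared Hellinger distance is computed with the dominating measure \<open>\<nu> = P + Q\<close>;
  lemma \<open>hellinger2_density\<close> shows that every \<open>\<sigma>\<close>-finite dominating measure gives the same value.\<close>

definition hellinger2 :: "'a measure \<Rightarrow> 'a measure \<Rightarrow> real" where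
  "hellinger2 P Q = (let \<nu> = sum_measure P Q in
     1 / 2 * (\<integral>x. (sqrt (enn2real (RN_deriv \<nu> P x)) - sqrt (enn2real (RN_deriv \<nu> Q x)))\<^sup>2 \<partial>\<nu>))"

text \<open>The infimum is taken in the extended reals, so that it is \<open>\<infinity>\<close> for the empty set.\<close>

definition hellinger2_set :: "'a measure \<Rightarrow> 'a measure set \<Rightarrow> ereal" where
  "hellinger2_set P A = (INF Q\<in>A. ereal (hellinger2 P Q))"

definition hellinger_dense :: "'a measure set \<Rightarrow> 'a measure set \<Rightarrow> bool" where
  "hellinger_dense D A \<longleftrightarrow> D \<subseteq> A \<and> (\<forall>P\<in>A. \<forall>\<epsilon>>0. \<exists>Q\<in>D. hellinger2 P Q < \<epsilon>)"

text \<open>Closure in the set of all probability measures on the measurable space of \<open>\<mu>\<close>.\<close>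

definition hellinger_closure :: "'a measure \<Rightarrow> 'a measure set \<Rightarrow> 'a measure set" where
  "hellinger_closure \<mu> A = {P \<in> space (prob_algebra \<mu>). \<forall>\<epsilon>>0. \<exists>Q\<in>A. hellinger2 P Q < \<epsilon>}"


section \<open>VC-subgraph classes\<close>

definition shatters :: "'b set set \<Rightarrow> 'b set \<Rightarrow> bool" where
  "shatters \<S> A \<longleftrightarrow> (\<forall>B\<subseteq>A. \<exists>S\<in>\<S>. S \<inter> A = B)"

definition subgraphs :: "'a set \<Rightarrow> ('a \<Rightarrow> real) set \<Rightarrow> ('a \<times> real) set set" where
  "subgraphs \<Omega> \<F> = (\<lambda>f. {(x, t). x \<in> \<Omega> \<and> t < f x}) ` \<F>"

definition no_shattered :: "'a set \<Rightarrow> ('a \<Rightarrow> real) set \<Rightarrow> nat \<Rightarrow> bool" where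
  "no_shattered \<Omega> \<F> m \<longleftrightarrow> (\<forall>A \<subseteq> \<Omega> \<times> UNIV. finite A \<and> card A = m \<longrightarrow> \<not> shatters (subgraphs \<Omega> \<F>) A)"

definition vc_subgraph :: "'a set \<Rightarrow> ('a \<Rightarrow> real) set \<Rightarrow> bool" where
  "vc_subgraph \<Omega> \<F> \<longleftrightarrow> (\<exists>m\<ge>1. no_shattered \<Omega> \<F> m)"

definition vc_index :: "'a set \<Rightarrow> ('a \<Rightarrow> real) set \<Rightarrow> nat" where
  "vc_index \<Omega> \<F> = (LEAST m. 1 \<le> m \<and> no_shattered \<Omega> \<F> m)"


section \<open>Mixture models\<close>

abbreviation dens_measure :: "'a measure \<Rightarrow> ('a \<Rightarrow> real) \<Rightarrow> 'a measure" where
  "dens_measure \<mu> f \<equiv> density \<mu> (\<lambda>x. ennreal (f x))"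

definition prob_densities :: "'a measure \<Rightarrow> ('a \<Rightarrow> real) set" where
  "prob_densities \<mu> =
     {f \<in> borel_measurable \<mu>. (\<forall>x\<in>space \<mu>. 0 \<le> f x) \<and> prob_space (dens_measure \<mu> f)}"

definition weights :: "nat \<Rightarrow> (nat \<Rightarrow> real) set" where
  "weights K = {w. (\<forall>k\<in>{1..K}. 0 \<le> w k \<and> w k \<le> 1) \<and> (\<Sum>k=1..K. w k) = 1}"

definition mixture :: "'a measure \<Rightarrow> nat \<Rightarrow> (nat \<Rightarrow> real) \<Rightarrow> (nat \<Rightarrow> 'a measure) \<Rightarrow> 'a measure" where
  "mixture \<mu> K w F =
     measure_of (space \<mu>) (sets \<mu>) (\<lambda>A. \<Sum>k=1..K. ennreal (w k) * emeasure (F k) A)"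

definition mixture_density :: "nat \<Rightarrow> (nat \<Rightarrow> real) \<Rightarrow> (nat \<Rightarrow> 'a \<Rightarrow> real) \<Rightarrow> 'a \<Rightarrow> real" where
  "mixture_density K w f x = (\<Sum>k=1..K. w k * f k x)"

definition mixtures :: "'a measure \<Rightarrow> nat \<Rightarrow> 'a measure set \<Rightarrow> 'a measure set" where
  "mixtures \<mu> K \<A> = {mixture \<mu> K w F | w F. w \<in> weights K \<and> (\<forall>k\<in>{1..K}. F k \<in> \<A>)}"

text \<open>Densities of the elements of \<open>\<S>\<close> that are mixtures with rational weights at least \<open>d\<close> of
  probabilities with densities in the countable family \<open>\<F>\<close>, and the probabilities themselves.
  In the statement \<open>\<S>\<close> is the model with \<open>K\<close> components.\<close>

definition densities_delta ::
    "'a measure \<Rightarrow> ('a \<Rightarrow> real) set \<Rightarrow> real \<Rightarrow> 'a measure set \<Rightarrow> nat \<Rightarrow> ('a \<Rightarrow> real) set" where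
  "densities_delta \<mu> \<F> d \<S> K = {mixture_density K w f | w f.
     w \<in> weights K \<and> (\<forall>k\<in>{1..K}. d \<le> w k \<and> w k \<in> \<rat> \<and> f k \<in> \<F>) \<and>
     mixture \<mu> K w (\<lambda>k. dens_measure \<mu> (f k)) \<in> \<S>}"

definition model_delta ::
    "'a measure \<Rightarrow> ('a \<Rightarrow> real) set \<Rightarrow> real \<Rightarrow> 'a measure set \<Rightarrow> nat \<Rightarrow> 'a measure set" where
  "model_delta \<mu> \<F> d \<S> K = {mixture \<mu> K w (\<lambda>k. dens_measure \<mu> (f k)) | w f.
     w \<in> weights K \<and> (\<forall>k\<in>{1..K}. d \<le> w k \<and> w k \<in> \<rat> \<and> f k \<in> \<F>) \<and>
     mixture \<mu> K w (\<lambda>k. dens_measure \<mu> (f k)) \<in> \<S>}"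


section \<open>Penalized \<open>\<rho>\<close>-estimators\<close>

definition psi :: "ereal \<Rightarrow> real" where
  "psi x = (if x = \<infinity> then 1 else (real_of_ereal x - 1) / (real_of_ereal x + 1))"

definition sqrt_ratio :: "real \<Rightarrow> real \<Rightarrow> ereal" where
  "sqrt_ratio a b = (if b = 0 then (if a = 0 then 1 else \<infinity>) else ereal (sqrt (a / b)))"

definition T_stat :: "nat \<Rightarrow> (nat \<Rightarrow> 'a) \<Rightarrow> ('a \<Rightarrow> real) \<Rightarrow> ('a \<Rightarrow> real) \<Rightarrow> real" where
  "T_stat n x q q' = (\<Sum>i=1..n. psi (sqrt_ratio (q' (x i)) (q (x i))))"

text \<open>The suprema and infima over \<open>\<Q>\<close> below are real-valued: for nonempty \<open>\<Q>\<close> and nonnegative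
  \<open>pen\<close> the statistic \<open>T_stat\<close> lies between \<open>-n\<close> and \<open>n\<close>, so all of them are finite.\<close>

definition Upsilon ::
    "nat \<Rightarrow> ('a \<Rightarrow> real) set \<Rightarrow> (('a \<Rightarrow> real) \<Rightarrow> real) \<Rightarrow> (nat \<Rightarrow> 'a) \<Rightarrow> ('a \<Rightarrow> real) \<Rightarrow> real" where
  "Upsilon n \<Q> pen x q = (SUP q'\<in>\<Q>. T_stat n x q q' - pen q') + pen q"

text \<open>Measurability refers to the \<open>\<sigma>\<close>-algebra on probability measures generated by the
  evaluations \<open>P \<mapsto> P A\<close>. On Hellinger-separable sets of probabilities, in particular on
  the closure of a countable model, this is the Borel \<open>\<sigma>\<close>-algebra of the Hellinger distance.\<close>

definition rho_estimator ::
    "nat \<Rightarrow> 'a measure \<Rightarrow> ('a \<Rightarrow> real) set \<Rightarrow> (('a \<Rightarrow> real) \<Rightarrow> real) \<Rightarrow> ((nat \<Rightarrow> 'a) \<Rightarrow> 'a measure) \<Rightarrow> bool" where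
  "rho_estimator n \<mu> \<Q> pen Phat \<longleftrightarrow>
     Phat \<in> measurable (Pi\<^sub>M {1..n} (\<lambda>_. \<mu>)) (prob_algebra \<mu>) \<and>
     (\<forall>x\<in>space (Pi\<^sub>M {1..n} (\<lambda>_. \<mu>)).
        Phat x \<in> hellinger_closure \<mu> (dens_measure \<mu> `
          {q \<in> \<Q>. Upsilon n \<Q> pen x q < (INF q'\<in>\<Q>. Upsilon n \<Q> pen x q') + 8.24}))"


section \<open>The penalty\<close>

definition log_plus :: "real \<Rightarrow> real" where
  "log_plus x = max (ln x) 0"

text \<open>\<open>35 a\<^sub>2\<^sup>2 / a\<^sub>1 + 74\<close> with \<open>a\<^sub>1 = 3/8\<close> and \<open>a\<^sub>2\<^sup>2 = 3 sqrt 2\<close>.\<close>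

definition kappa :: real where
  "kappa = 280 * sqrt 2 + 74"

definition delta :: "nat \<Rightarrow> nat \<Rightarrow> nat \<Rightarrow> real" where
  "delta n V K = (if K = 1 then 1 else min (real V / real n) (1 / real K))"

definition Q_delta ::
    "nat \<Rightarrow> nat \<Rightarrow> 'a measure \<Rightarrow> ('a \<Rightarrow> real) set \<Rightarrow> nat set \<Rightarrow> (nat \<Rightarrow> 'a measure set) \<Rightarrow> ('a \<Rightarrow> real) set" where
  "Q_delta n V \<mu> \<F> \<K> \<Q> = (\<Union>K\<in>\<K>. densities_delta \<mu> \<F> (delta n V K) (\<Q> K) K)"

definition penalty ::
    "nat \<Rightarrow> nat \<Rightarrow> 'a measure \<Rightarrow> nat set \<Rightarrow> (nat \<Rightarrow> 'a measure set) \<Rightarrow> (nat \<Rightarrow> real) \<Rightarrow> ('a \<Rightarrow> real) \<Rightarrow> real" where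
  "penalty n V \<mu> \<K> \<Q> \<Delta> q = kappa * (INF K \<in> {K\<in>\<K>. dens_measure \<mu> q \<in> \<Q> K}.
     174.1 * real K * real V *
       (5.82 + ln ((real K + 1)\<^sup>2 / delta n V K) + log_plus (real n / (real K * real V))) + \<Delta> K)"


section \<open>Consistency of the definitions\<close>

lemma emeasure_sum_measure:
  assumes "sets Q = sets P" "A \<in> sets P"
  shows "emeasure (sum_measure P Q) A = emeasure P A + emeasure Q A"
proof (rule emeasure_measure_of[OF sum_measure_def])
  show "sets P \<subseteq> Pow (space P)" by (rule sets.space_closed)
  show "A \<in> sets (sum_measure P Q)" using assms by (simp add: sum_measure_def)
  show "positive (sets (sum_measure P Q)) (\<lambda>A. emeasure P A + emeasure Q A)"
    by (simp add: positive_def)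
  show "countably_additive (sets (sum_measure P Q)) (\<lambda>A. emeasure P A + emeasure Q A)"
    using assms(1)
    by (auto simp: countably_additive_def sum_measure_def suminf_add[symmetric] suminf_emeasure)
qed

lemma sum_measure_density:
  assumes [measurable]: "p \<in> borel_measurable \<nu>" "q \<in> borel_measurable \<nu>"
  shows "sum_measure (density \<nu> p) (density \<nu> q) = density \<nu> (\<lambda>x. p x + q x)"
proof (rule measure_eqI)
  show "sets (sum_measure (density \<nu> p) (density \<nu> q)) = sets (density \<nu> (\<lambda>x. p x + q x))"
    by (simp add: sum_measure_def sets.sigma_sets_eq[of \<nu>, unfolded] )
next
  fix A assume "A \<in> sets (sum_measure (density \<nu> p) (density \<nu> q))"
  then have A[measurable]: "A \<in> sets \<nu>"
    by (simp add: sum_measure_def)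
  show "emeasure (sum_measure (density \<nu> p) (density \<nu> q)) A = emeasure (density \<nu> (\<lambda>x. p x + q x)) A"
    by (subst emeasure_sum_measure)
       (auto simp: emeasure_density nn_integral_add[symmetric] distrib_right)
qed

lemma hellinger2_density:
  assumes "sigma_finite_measure \<nu>"
    and p: "p \<in> prob_densities \<nu>" and q: "q \<in> prob_densities \<nu>"
  shows "hellinger2 (dens_measure \<nu> p) (dens_measure \<nu> q) =
    1 / 2 * (\<integral>x. (sqrt (p x) - sqrt (q x))\<^sup>2 \<partial>\<nu>)"
proof -
  have [measurable]: "p \<in> borel_measurable \<nu>" "q \<in> borel_measurable \<nu>"
    using p q by (auto simp: prob_densities_def)
  have nn: "\<And>x. x \<in> space \<nu> \<Longrightarrow> 0 \<le> p x" "\<And>x. x \<in> space \<nu> \<Longrightarrow> 0 \<le> q x"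
    using p q by (auto simp: prob_densities_def)
  interpret P: prob_space "dens_measure \<nu> p" using p by (simp add: prob_densities_def)
  interpret Q: prob_space "dens_measure \<nu> q" using q by (simp add: prob_densities_def)
  define s where "s x = p x + q x" for x
  have [measurable]: "s \<in> borel_measurable \<nu>" by (simp add: s_def[abs_def])
  define S where "S = dens_measure \<nu> s"
  have sum: "sum_measure (dens_measure \<nu> p) (dens_measure \<nu> q) = S"
    unfolding S_def by (subst sum_measure_density)
      (auto intro!: density_cong AE_I2 simp: s_def nn)
  have "emeasure S (space S) = emeasure (sum_measure (dens_measure \<nu> p) (dens_measure \<nu> q)) (space \<nu>)"
    by (simp add: sum) (simp add: S_def)
  also have "\<dots> = 2"
    using P.emeasure_space_1 Q.emeasure_space_1 by (subst emeasure_sum_measure) auto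
  finally interpret S: finite_measure S by (intro finite_measureI) simp
  have RN: "AE x in S. ennreal (f x / s x) = RN_deriv S (dens_measure \<nu> f) x"
    if f: "f \<in> borel_measurable \<nu>" "\<And>x. x \<in> space \<nu> \<Longrightarrow> 0 \<le> f x \<and> f x \<le> s x" for f
  proof (rule S.RN_deriv_unique)
    have [measurable]: "f \<in> borel_measurable \<nu>" by fact
    show "(\<lambda>x. ennreal (f x / s x)) \<in> borel_measurable S" by (simp add: S_def)
    have "density S (\<lambda>x. ennreal (f x / s x)) = density \<nu> (\<lambda>x. ennreal (s x) * ennreal (f x / s x))"
      unfolding S_def by (subst density_density_eq) auto
    also have "\<dots> = dens_measure \<nu> f"
    proof (intro density_cong AE_I2)
      fix x assume "x \<in> space \<nu>"
      from f(2)[OF this] show "ennreal (s x) * ennreal (f x / s x) = ennreal (f x)"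
        by (cases "s x = 0") (auto simp: ennreal_mult[symmetric])
    qed auto
    finally show "density S (\<lambda>x. ennreal (f x / s x)) = dens_measure \<nu> f" .
  qed
  have RNp: "AE x in S. ennreal (p x / s x) = RN_deriv S (dens_measure \<nu> p) x"
    by (rule RN) (auto simp: s_def nn)
  have RNq: "AE x in S. ennreal (q x / s x) = RN_deriv S (dens_measure \<nu> q) x"
    by (rule RN) (auto simp: s_def nn)
  have ae: "AE x in S.
     (sqrt (enn2real (RN_deriv S (dens_measure \<nu> p) x)) - sqrt (enn2real (RN_deriv S (dens_measure \<nu> q) x)))\<^sup>2
     = (sqrt (p x / s x) - sqrt (q x / s x))\<^sup>2"
    using RNp RNq AE_space[of S]
  proof eventually_elim
    case (elim x)
    then have "x \<in> space \<nu>" by (simp add: S_def)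
    from nn[OF this] show ?case
      unfolding elim(1,2)[symmetric] s_def by simp
  qed
  have "hellinger2 (dens_measure \<nu> p) (dens_measure \<nu> q) =
    1 / 2 * (\<integral>x. (sqrt (p x / s x) - sqrt (q x / s x))\<^sup>2 \<partial>S)"
    unfolding hellinger2_def Let_def sum
    by (subst integral_cong_AE[OF _ _ ae]) (auto simp: S_def)
  also have "(\<integral>x. (sqrt (p x / s x) - sqrt (q x / s x))\<^sup>2 \<partial>S) =
      (\<integral>x. s x * (sqrt (p x / s x) - sqrt (q x / s x))\<^sup>2 \<partial>\<nu>)"
    unfolding S_def by (subst integral_density) (auto intro!: AE_I2 simp: s_def nn)
  also have "\<dots> = (\<integral>x. (sqrt (p x) - sqrt (q x))\<^sup>2 \<partial>\<nu>)"
  proof (rule Bochner_Integration.integral_cong[OF refl])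
    fix x assume "x \<in> space \<nu>"
    note n = nn[OF this]
    show "s x * (sqrt (p x / s x) - sqrt (q x / s x))\<^sup>2 = (sqrt (p x) - sqrt (q x))\<^sup>2"
    proof (cases "s x = 0")
      case True
      then show ?thesis using n by (simp add: s_def add_nonneg_eq_0_iff)
    next
      case False
      then have "s x > 0" using n by (simp add: s_def)
      then have "s x * (sqrt (p x / s x) - sqrt (q x / s x))\<^sup>2
          = (sqrt (s x) * (sqrt (p x / s x) - sqrt (q x / s x)))\<^sup>2"
        by (simp add: power_mult_distrib)
      also have "sqrt (s x) * (sqrt (p x / s x) - sqrt (q x / s x)) = sqrt (p x) - sqrt (q x)"
        using \<open>s x > 0\<close> by (simp add: real_sqrt_divide right_diff_distrib)
      finally show ?thesis .
    qed
  qed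
  finally show ?thesis .
qed

lemma mixture_dens_measure:
  assumes w: "\<forall>k\<in>{1..K}. 0 \<le> w k" and f: "\<forall>k\<in>{1..K}. f k \<in> prob_densities \<mu>"
  shows "mixture \<mu> K w (\<lambda>k. dens_measure \<mu> (f k)) = dens_measure \<mu> (mixture_density K w f)"
proof -
  have m: "f k \<in> borel_measurable \<mu>" "x \<in> space \<mu> \<Longrightarrow> 0 \<le> f k x" if "k \<in> {1..K}" for k x
    using f that by (auto simp: prob_densities_def)
  have *: "(\<Sum>k=1..K. ennreal (w k) * emeasure (dens_measure \<mu> (f k)) A) =
      emeasure (dens_measure \<mu> (mixture_density K w f)) A" if A[measurable]: "A \<in> sets \<mu>" for A
  proof -
    have "(\<Sum>k=1..K. ennreal (w k) * emeasure (dens_measure \<mu> (f k)) A) =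
        (\<Sum>k=1..K. \<integral>\<^sup>+x. ennreal (w k) * (ennreal (f k x) * indicator A x) \<partial>\<mu>)"
      using m by (intro sum.cong refl, subst nn_integral_cmult) (auto simp: emeasure_density)
    also have "\<dots> = (\<integral>\<^sup>+x. (\<Sum>k=1..K. ennreal (w k) * (ennreal (f k x) * indicator A x)) \<partial>\<mu>)"
      using m by (subst nn_integral_sum) auto
    also have "\<dots> = (\<integral>\<^sup>+x. ennreal (mixture_density K w f x) * indicator A x \<partial>\<mu>)"
    proof (rule nn_integral_cong)
      fix x assume x: "x \<in> space \<mu>"
      have "(\<Sum>k=1..K. ennreal (w k) * ennreal (f k x)) = ennreal (mixture_density K w f x)"
        unfolding mixture_density_def using w m(2)[OF _ x]
        by (subst sum_ennreal[symmetric]) (auto simp: ennreal_mult intro!: sum.cong)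
      then show "(\<Sum>k=1..K. ennreal (w k) * (ennreal (f k x) * indicator A x)) =
          ennreal (mixture_density K w f x) * indicator A x"
        by (simp add: sum_distrib_right[symmetric] mult.assoc[symmetric])
    qed
    also have "\<dots> = emeasure (dens_measure \<mu> (mixture_density K w f)) A"
      using m by (subst emeasure_density) (auto simp: mixture_density_def[abs_def])
    finally show ?thesis .
  qed
  have "mixture \<mu> K w (\<lambda>k. dens_measure \<mu> (f k)) =
      measure_of (space \<mu>) (sets \<mu>) (emeasure (dens_measure \<mu> (mixture_density K w f)))"
    unfolding mixture_def
    by (rule measure_of_eq) (simp_all add: sets.space_closed sets.sigma_sets_eq * del: One_nat_def)
  also have "\<dots> = dens_measure \<mu> (mixture_density K w f)"
    using measure_of_of_measure[of "dens_measure \<mu> (mixture_density K w f)"] by simp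
  finally show ?thesis .
qed

lemma model_delta_eq:
  assumes "\<F> \<subseteq> prob_densities \<mu>"
  shows "model_delta \<mu> \<F> d \<S> K = dens_measure \<mu> ` densities_delta \<mu> \<F> d \<S> K"
proof -
  have "mixture \<mu> K w (\<lambda>k. dens_measure \<mu> (f k)) = dens_measure \<mu> (mixture_density K w f)"
    if "w \<in> weights K" "\<forall>k\<in>{1..K}. f k \<in> \<F>" for w f
    using that assms by (intro mixture_dens_measure) (auto simp: weights_def)
  then show ?thesis
    unfolding model_delta_def densities_delta_def by (auto simp: image_def) metis+
qed

context
  notes One_nat_def[simp del]
begin

lemma weight_truncation:
  assumes K: "1 \<le> K" and w: "w \<in> weights K" and d: "0 \<le> d" "d * real K \<le> 1" "d \<in> \<rat>" and e: "0 < e"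
  shows "\<exists>v\<in>weights K. (\<forall>k\<in>{1..K}. d \<le> v k \<and> v k \<in> \<rat>) \<and>
           (\<Sum>k=1..K. \<bar>w k - v k\<bar>) \<le> 2 * ((real K - 1) * d) + e"
proof -
  have w01: "0 \<le> w k" if "k \<in> {1..K}" for k using w that by (auto simp: weights_def)
  have wsum: "(\<Sum>k=1..K. w k) = 1" using w by (simp add: weights_def)
  define c where "c = 1 - d * real K"
  define a where "a k = max (w k - d) 0" for k
  define A where "A = (\<Sum>k=1..K. a k)"
  have c0: "0 \<le> c" using d by (simp add: c_def)
  have "c = (\<Sum>k=1..K. w k - d)" by (simp add: c_def sum_subtractf wsum)
  also have "\<dots> \<le> A" unfolding A_def by (rule sum_mono) (simp add: a_def)
  finally have cA: "c \<le> A" .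
  define b where "b k = a k * (if A = 0 then 0 else c / A)" for k
  have ratio: "0 \<le> (if A = 0 then 0 else c / A)" "(if A = 0 then 0 else c / A) \<le> 1"
    using c0 cA by (auto simp: divide_simps)
  have b0: "0 \<le> b k" for k unfolding b_def a_def using ratio(1) by (intro mult_nonneg_nonneg) auto
  have ba: "b k \<le> a k" for k unfolding b_def using ratio(2) mult_left_mono[OF ratio(2), of "a k"]
    by (simp add: a_def)
  have bsum: "(\<Sum>k=1..K. b k) = c"
    using c0 cA unfolding b_def sum_distrib_right[symmetric] A_def[symmetric] by auto
  define u where "u k = d + b k" for k
  have usum: "(\<Sum>k=1..K. u k) = 1" by (simp add: u_def sum.distrib bsum c_def mult.commute)
  have "\<exists>j\<in>{1..K}. d \<le> w j"
  proof (rule ccontr)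
    assume "\<not> ?thesis"
    then have "(\<Sum>k=1..K. w k) < (\<Sum>k=1..K. d)"
      using K by (intro sum_strict_mono) (auto simp: not_le)
    then show False using d by (simp add: wsum mult.commute)
  qed
  then obtain j where j: "j \<in> {1..K}" "d \<le> w j" by auto
  have pos: "max (u k - w k) 0 \<le> (if k = j then 0 else d)" if "k \<in> {1..K}" for k
    using ba[of k] b0[of k] w01[OF that] j d unfolding u_def a_def by (auto simp: max_def split: if_splits)
  have "(\<Sum>k=1..K. \<bar>w k - u k\<bar>) = (\<Sum>k=1..K. 2 * max (u k - w k) 0 - (u k - w k))"
    by (intro sum.cong) (auto simp: abs_if max_def)
  also have "\<dots> = 2 * (\<Sum>k=1..K. max (u k - w k) 0)"
    by (simp add: sum_subtractf sum_distrib_left usum wsum)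
  also have "(\<Sum>k=1..K. max (u k - w k) 0) \<le> (\<Sum>k=1..K. if k = j then 0 else d)"
    by (intro sum_mono pos)
  also have "(\<Sum>k=1..K. if k = j then 0 else d) = (\<Sum>k\<in>{1..K}-{j}. d)"
    using j by (intro sum.mono_neutral_cong_right) auto
  also have "\<dots> = (real K - 1) * d"
    using j K by (simp add: card_Diff_singleton of_nat_diff)
  finally have wu: "(\<Sum>k=1..K. \<bar>w k - u k\<bar>) \<le> 2 * ((real K - 1) * d)" by simp
  obtain N :: nat where N: "2 * real K / e < real N" using reals_Archimedean2 by blast
  moreover have "0 \<le> 2 * real K / e" using e by simp
  ultimately have N0: "0 < real N" by linarith
  define g where "g k = real_of_int \<lfloor>real N * b k\<rfloor> / real N" for k
  have g0: "0 \<le> g k" for k using b0[of k] by (simp add: g_def)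
  have gb: "g k \<le> b k" for k
  proof -
    have "real_of_int \<lfloor>real N * b k\<rfloor> \<le> real N * b k" by (rule of_int_floor_le)
    then show ?thesis using N0 by (simp add: g_def pos_divide_le_eq mult.commute)
  qed
  have bg: "b k - g k \<le> 1 / real N" for k
  proof -
    have "real N * b k \<le> real_of_int \<lfloor>real N * b k\<rfloor> + 1" by linarith
    then have "b k \<le> (real_of_int \<lfloor>real N * b k\<rfloor> + 1) / real N"
      using N0 by (simp add: pos_le_divide_eq mult.commute)
    then show ?thesis by (simp add: g_def add_divide_distrib)
  qed
  define r where "r = c - (\<Sum>k=1..K. g k)"
  have req: "r = (\<Sum>k=1..K. b k - g k)" by (simp add: r_def sum_subtractf bsum)
  have r0: "0 \<le> r" unfolding req by (rule sum_nonneg) (simp add: gb)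
  have "r \<le> (\<Sum>k=1..K. 1 / real N)" unfolding req by (rule sum_mono) (rule bg)
  then have "2 * r \<le> 2 * real K / real N" by simp
  also have "\<dots> \<le> e" using N N0 e by (simp add: field_simps)
  finally have re: "2 * r \<le> e" .
  define v where "v k = d + g k + (if k = 1 then r else 0)" for k
  have vd: "d \<le> v k" for k using g0[of k] r0 by (simp add: v_def)
  have "(\<Sum>k=1..K. v k) = d * real K + (\<Sum>k=1..K. g k) + r"
    using K by (simp add: v_def sum.distrib mult.commute)
  then have vsum: "(\<Sum>k=1..K. v k) = 1" by (simp add: r_def c_def)
  have v0: "0 \<le> v k" for k using order_trans[OF d(1) vd] .
  have v1: "v k \<le> 1" if "k \<in> {1..K}" for k
    using member_le_sum[OF that, of v] v0 vsum by simp
  have cQ: "c \<in> \<rat>" using d unfolding c_def by simp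
  have gQ: "g k \<in> \<rat>" for k by (simp add: g_def)
  have "(\<Sum>k=1..K. g k) \<in> \<rat>" by (intro Rats_sum gQ)
  with cQ have rQ: "r \<in> \<rat>" unfolding r_def by simp
  have vQ: "v k \<in> \<rat>" for k using d gQ rQ by (simp add: v_def)
  have "(\<Sum>k=1..K. \<bar>w k - v k\<bar>) \<le> (\<Sum>k=1..K. \<bar>w k - u k\<bar> + ((b k - g k) + (if k = 1 then r else 0)))"
  proof (rule sum_mono)
    fix k
    show "\<bar>w k - v k\<bar> \<le> \<bar>w k - u k\<bar> + ((b k - g k) + (if k = 1 then r else 0))"
      using gb[of k] r0 by (auto simp: u_def v_def)
  qed
  also have "\<dots> = (\<Sum>k=1..K. \<bar>w k - u k\<bar>) + 2 * r"
    using K req by (simp add: sum.distrib)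
  also have "\<dots> \<le> 2 * ((real K - 1) * d) + e" using wu re by simp
  finally have "(\<Sum>k=1..K. \<bar>w k - v k\<bar>) \<le> 2 * ((real K - 1) * d) + e" .
  moreover have "v \<in> weights K"
    using v0 v1 vsum by (simp add: weights_def)
  ultimately show ?thesis using vd vQ by blast
qed

lemma prob_densities_integral:
  assumes "f \<in> prob_densities \<mu>"
  shows "integrable \<mu> f" "(\<integral>x. f x \<partial>\<mu>) = 1"
proof -
  have m[measurable]: "f \<in> borel_measurable \<mu>" and nn: "\<And>x. x \<in> space \<mu> \<Longrightarrow> 0 \<le> f x"
    and ps: "prob_space (dens_measure \<mu> f)"
    using assms by (auto simp: prob_densities_def)
  have "(\<integral>\<^sup>+x. ennreal (f x) \<partial>\<mu>) = emeasure (dens_measure \<mu> f) (space \<mu>)"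
    by (auto simp: emeasure_density intro!: nn_integral_cong)
  also have "\<dots> = 1" using prob_space.emeasure_space_1[OF ps] by simp
  finally have *: "(\<integral>\<^sup>+x. ennreal (f x) \<partial>\<mu>) = ennreal 1" by simp
  show "integrable \<mu> f"
    using * nn by (intro integrableI_nonneg) (auto intro: AE_I2)
  show "(\<integral>x. f x \<partial>\<mu>) = 1"
    using * nn by (intro integral_eq_nn_integral[THEN trans]) (auto intro: AE_I2)
qed

lemma mixture_density_in_prob_densities:
  assumes w: "w \<in> weights K" and f: "\<forall>k\<in>{1..K}. f k \<in> prob_densities \<mu>"
  shows "mixture_density K w f \<in> prob_densities \<mu>"
proof -
  have m: "f k \<in> borel_measurable \<mu>" "x \<in> space \<mu> \<Longrightarrow> 0 \<le> f k x" if "k \<in> {1..K}" for k x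
    using f that by (auto simp: prob_densities_def)
  have w0: "0 \<le> w k" if "k \<in> {1..K}" for k using w that by (auto simp: weights_def)
  have fi: "integrable \<mu> (f k)" "(\<integral>x. f k x \<partial>\<mu>) = 1" if "k \<in> {1..K}" for k
    using prob_densities_integral[OF bspec[OF f that]] by blast+
  have meas[measurable]: "mixture_density K w f \<in> borel_measurable \<mu>"
    using m by (auto simp: mixture_density_def[abs_def])
  have nn: "0 \<le> mixture_density K w f x" if "x \<in> space \<mu>" for x
    unfolding mixture_density_def using m(2) w0 that by (intro sum_nonneg mult_nonneg_nonneg) auto
  have int: "integrable \<mu> (mixture_density K w f)"
    unfolding mixture_density_def[abs_def] using fi
    by (intro Bochner_Integration.integrable_sum integrable_mult_right) auto
  have "(\<integral>x. mixture_density K w f x \<partial>\<mu>) = (\<Sum>k=1..K. \<integral>x. w k * f k x \<partial>\<mu>)"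
    unfolding mixture_density_def using fi
    by (intro Bochner_Integration.integral_sum integrable_mult_right) auto
  also have "\<dots> = (\<Sum>k=1..K. w k)"
    using fi by (intro sum.cong) auto
  also have "\<dots> = 1" using w by (simp add: weights_def)
  finally have "(\<integral>\<^sup>+x. ennreal (mixture_density K w f x) \<partial>\<mu>) = 1"
    using int nn by (subst nn_integral_eq_integral) (auto intro: AE_I2)
  moreover have "emeasure (dens_measure \<mu> (mixture_density K w f)) (space \<mu>) =
      (\<integral>\<^sup>+x. ennreal (mixture_density K w f x) \<partial>\<mu>)"
    by (auto simp: emeasure_density intro!: nn_integral_cong)
  ultimately have "prob_space (dens_measure \<mu> (mixture_density K w f))"
    by (intro prob_spaceI) simp
  with meas nn show ?thesis by (simp add: prob_densities_def)
qed

lemma sqrt_diff_square_le: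
  fixes a b :: real
  assumes "0 \<le> a" "0 \<le> b"
  shows "(sqrt a - sqrt b)\<^sup>2 \<le> \<bar>a - b\<bar>"
proof -
  have "(sqrt a - sqrt b)\<^sup>2 = \<bar>sqrt a - sqrt b\<bar> * \<bar>sqrt a - sqrt b\<bar>"
    by (simp add: power2_eq_square)
  also have "\<dots> \<le> \<bar>sqrt a - sqrt b\<bar> * \<bar>sqrt a + sqrt b\<bar>"
    using assms real_sqrt_ge_zero[of a] real_sqrt_ge_zero[of b]
    by (intro mult_left_mono) (auto simp: abs_if simp del: real_sqrt_ge_0_iff)
  also have "\<dots> = \<bar>(sqrt a - sqrt b) * (sqrt a + sqrt b)\<bar>" by (simp add: abs_mult)
  also have "(sqrt a - sqrt b) * (sqrt a + sqrt b) = a - b"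
    using assms by (simp add: algebra_simps)
  finally show ?thesis .
qed

lemma hellinger2_le_L1:
  assumes "sigma_finite_measure \<nu>" "p \<in> prob_densities \<nu>" "q \<in> prob_densities \<nu>"
  shows "integrable \<nu> (\<lambda>x. (sqrt (p x) - sqrt (q x))\<^sup>2)"
    and "hellinger2 (dens_measure \<nu> p) (dens_measure \<nu> q) \<le> 1 / 2 * (\<integral>x. \<bar>p x - q x\<bar> \<partial>\<nu>)"
proof -
  have [measurable]: "p \<in> borel_measurable \<nu>" "q \<in> borel_measurable \<nu>"
    and nn: "\<And>x. x \<in> space \<nu> \<Longrightarrow> 0 \<le> p x" "\<And>x. x \<in> space \<nu> \<Longrightarrow> 0 \<le> q x"
    using assms by (auto simp: prob_densities_def)
  have i: "integrable \<nu> (\<lambda>x. \<bar>p x - q x\<bar>)"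
    using prob_densities_integral(1)[OF assms(2)] prob_densities_integral(1)[OF assms(3)] by auto
  show ii: "integrable \<nu> (\<lambda>x. (sqrt (p x) - sqrt (q x))\<^sup>2)"
    using i by (rule Bochner_Integration.integrable_bound)
      (auto intro!: AE_I2 sqrt_diff_square_le nn)
  show "hellinger2 (dens_measure \<nu> p) (dens_measure \<nu> q) \<le> 1 / 2 * (\<integral>x. \<bar>p x - q x\<bar> \<partial>\<nu>)"
    unfolding hellinger2_density[OF assms]
    using integral_mono[OF ii i] by (auto intro: sqrt_diff_square_le nn)
qed

lemma L1_le_hellinger2:
  assumes "sigma_finite_measure \<nu>" "p \<in> prob_densities \<nu>" "q \<in> prob_densities \<nu>" and t: "0 < t"
  shows "(\<integral>x. \<bar>p x - q x\<bar> \<partial>\<nu>) \<le> hellinger2 (dens_measure \<nu> p) (dens_measure \<nu> q) / t + 2 * t"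
proof -
  have nn: "\<And>x. x \<in> space \<nu> \<Longrightarrow> 0 \<le> p x" "\<And>x. x \<in> space \<nu> \<Longrightarrow> 0 \<le> q x"
    using assms by (auto simp: prob_densities_def)
  note i = prob_densities_integral[OF assms(2)] prob_densities_integral[OF assms(3)]
  note ii = hellinger2_le_L1(1)[OF assms(1-3)]
  have pt: "\<bar>a - b\<bar> \<le> (sqrt a - sqrt b)\<^sup>2 / (2 * t) + (t * a + t * b)"
    if ab: "0 \<le> a" "0 \<le> b" for a b :: real
  proof -
    define x y where "x = \<bar>sqrt a - sqrt b\<bar>" and "y = sqrt a + sqrt b"
    have "0 \<le> (x - t * y)\<^sup>2" by simp
    then have "2 * t * (x * y) \<le> x\<^sup>2 + t\<^sup>2 * y\<^sup>2"
      by (simp add: power2_eq_square algebra_simps)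
    also have "t\<^sup>2 * y\<^sup>2 \<le> t\<^sup>2 * (2 * (a + b))"
    proof (rule mult_left_mono)
      have "0 \<le> (sqrt a - sqrt b)\<^sup>2" by simp
      then show "y\<^sup>2 \<le> 2 * (a + b)" using ab by (simp add: y_def power2_diff power2_sum)
    qed simp
    finally have "x * y \<le> (x\<^sup>2 + t\<^sup>2 * (2 * (a + b))) / (2 * t)"
      using t by (simp add: field_simps)
    also have "\<dots> = x\<^sup>2 / (2 * t) + (t * a + t * b)"
      using t by (simp add: field_simps power2_eq_square)
    also have "x * y = \<bar>(sqrt a - sqrt b) * (sqrt a + sqrt b)\<bar>"
      using ab by (simp add: x_def y_def abs_mult)
    also have "(sqrt a - sqrt b) * (sqrt a + sqrt b) = a - b"
      using ab by (simp add: algebra_simps)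
    finally show ?thesis by (simp add: x_def)
  qed
  have "(\<integral>x. \<bar>p x - q x\<bar> \<partial>\<nu>) \<le> (\<integral>x. (sqrt (p x) - sqrt (q x))\<^sup>2 / (2 * t) + (t * p x + t * q x) \<partial>\<nu>)"
    using i ii by (intro integral_mono pt nn) auto
  also have "\<dots> = (\<integral>x. (sqrt (p x) - sqrt (q x))\<^sup>2 \<partial>\<nu>) / (2 * t) + 2 * t"
    using i ii by simp
  also have "\<dots> = hellinger2 (dens_measure \<nu> p) (dens_measure \<nu> q) / t + 2 * t"
    by (simp add: hellinger2_density[OF assms(1-3)])
  finally show ?thesis .
qed

text \<open>If a model consists of all mixtures of \<open>K\<close> elements of the base class, its discretized version
  approximates it up to the error \<open>(K - 1) * delta n V K\<close>.\<close>

lemma model_delta_approx: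
  assumes sf: "sigma_finite_measure \<mu>" and Fbar: "\<F>bar \<subseteq> prob_densities \<mu>"
    and F: "\<F> \<subseteq> \<F>bar" "hellinger_dense (dens_measure \<mu> ` \<F>) (dens_measure \<mu> ` \<F>bar)"
    and n: "1 \<le> n" "1 \<le> V" "1 \<le> K"
    and Q: "Q \<in> mixtures \<mu> K (dens_measure \<mu> ` \<F>bar)"
  shows "hellinger2_set Q
      (model_delta \<mu> \<F> (delta n V K) (mixtures \<mu> K (dens_measure \<mu> ` \<F>bar)) K)
    \<le> ereal ((real K - 1) * delta n V K)"
proof -
  define d where "d = delta n V K"
  have d: "0 \<le> d" "d * real K \<le> 1" "d \<in> \<rat>"
    using n by (auto simp: d_def delta_def min_def field_simps)
  from Q obtain w G where w: "w \<in> weights K" and G: "\<forall>k\<in>{1..K}. G k \<in> dens_measure \<mu> ` \<F>bar"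
    and Qeq: "Q = mixture \<mu> K w G" by (auto simp: mixtures_def)
  from G have "\<forall>k\<in>{1..K}. \<exists>f. f \<in> \<F>bar \<and> G k = dens_measure \<mu> f" by auto
  then obtain f where f: "\<forall>k\<in>{1..K}. f k \<in> \<F>bar \<and> G k = dens_measure \<mu> (f k)" by metis
  have fp: "\<forall>k\<in>{1..K}. f k \<in> prob_densities \<mu>" using f Fbar by auto
  have "Q = mixture \<mu> K w (\<lambda>k. dens_measure \<mu> (f k))"
    unfolding Qeq mixture_def using f by (intro arg_cong[where f="measure_of (space \<mu>) (sets \<mu>)"] ext sum.cong) auto
  also have "\<dots> = dens_measure \<mu> (mixture_density K w f)"
    using w fp by (intro mixture_dens_measure) (auto simp: weights_def)
  finally have Qd: "Q = dens_measure \<mu> (mixture_density K w f)" .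
  have "hellinger2_set Q (model_delta \<mu> \<F> d (mixtures \<mu> K (dens_measure \<mu> ` \<F>bar)) K)
    \<le> ereal ((real K - 1) * d) + ereal e" if e: "0 < e" for e
  proof -
    define t where "t = e / 3"
    have t: "0 < t" using e by (simp add: t_def)
    obtain v where v: "v \<in> weights K" "\<forall>k\<in>{1..K}. d \<le> v k \<and> v k \<in> \<rat>"
      "(\<Sum>k=1..K. \<bar>w k - v k\<bar>) \<le> 2 * ((real K - 1) * d) + e"
      using weight_truncation[OF n(3) w d e] by blast
    have "\<forall>k\<in>{1..K}. \<exists>g\<in>\<F>. hellinger2 (dens_measure \<mu> (f k)) (dens_measure \<mu> g) < t\<^sup>2"
      using f F(2) t by (auto simp: hellinger_dense_def)
    then obtain g where g: "\<forall>k\<in>{1..K}. g k \<in> \<F> \<and> hellinger2 (dens_measure \<mu> (f k)) (dens_measure \<mu> (g k)) < t\<^sup>2"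
      by metis
    have gp: "\<forall>k\<in>{1..K}. g k \<in> prob_densities \<mu>" using g F Fbar by auto
    have L1: "(\<integral>x. \<bar>f k x - g k x\<bar> \<partial>\<mu>) \<le> e" if k: "k \<in> {1..K}" for k
    proof -
      have "(\<integral>x. \<bar>f k x - g k x\<bar> \<partial>\<mu>) \<le> hellinger2 (dens_measure \<mu> (f k)) (dens_measure \<mu> (g k)) / t + 2 * t"
        using k fp gp by (intro L1_le_hellinger2[OF sf _ _ t]) auto
      also have "\<dots> \<le> t\<^sup>2 / t + 2 * t"
        using g k t by (intro add_right_mono divide_right_mono) (auto simp: less_imp_le)
      also have "\<dots> = e" using t by (simp add: power2_eq_square t_def)
      finally show ?thesis .
    qed
    have v0: "0 \<le> v k" if "k \<in> {1..K}" for k using v that by (auto simp: weights_def)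
    have ig: "integrable \<mu> (f k)" "integrable \<mu> (g k)" "(\<integral>x. f k x \<partial>\<mu>) = 1" if "k \<in> {1..K}" for k
      using prob_densities_integral[OF bspec[OF fp that]] prob_densities_integral[OF bspec[OF gp that]]
      by blast+
    have nnf: "0 \<le> f k x" if "k \<in> {1..K}" "x \<in> space \<mu>" for k x
      using fp that by (auto simp: prob_densities_def)
    note mw = mixture_density_in_prob_densities[OF w fp]
    note mv = mixture_density_in_prob_densities[OF v(1) gp]
    have "(\<integral>x. \<bar>mixture_density K w f x - mixture_density K v g x\<bar> \<partial>\<mu>)
      \<le> (\<integral>x. (\<Sum>k=1..K. \<bar>w k - v k\<bar> * f k x + v k * \<bar>f k x - g k x\<bar>) \<partial>\<mu>)"
    proof (rule integral_mono)
      show "integrable \<mu> (\<lambda>x. \<bar>mixture_density K w f x - mixture_density K v g x\<bar>)"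
        using prob_densities_integral(1)[OF mw] prob_densities_integral(1)[OF mv] by auto
      show "integrable \<mu> (\<lambda>x. \<Sum>k=1..K. \<bar>w k - v k\<bar> * f k x + v k * \<bar>f k x - g k x\<bar>)"
        using ig by (intro Bochner_Integration.integrable_sum) auto
      fix x assume x: "x \<in> space \<mu>"
      have "mixture_density K w f x - mixture_density K v g x =
          (\<Sum>k=1..K. (w k - v k) * f k x + v k * (f k x - g k x))"
        unfolding mixture_density_def sum_subtractf[symmetric]
        by (intro sum.cong) (auto simp: algebra_simps)
      also have "\<bar>\<dots>\<bar> \<le> (\<Sum>k=1..K. \<bar>(w k - v k) * f k x + v k * (f k x - g k x)\<bar>)"
        by (rule sum_abs)
      also have "\<dots> \<le> (\<Sum>k=1..K. \<bar>w k - v k\<bar> * f k x + v k * \<bar>f k x - g k x\<bar>)"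
      proof (rule sum_mono)
        fix k assume k: "k \<in> {1..K}"
        have "\<bar>(w k - v k) * f k x + v k * (f k x - g k x)\<bar>
            \<le> \<bar>(w k - v k) * f k x\<bar> + \<bar>v k * (f k x - g k x)\<bar>" by (rule abs_triangle_ineq)
        then show "\<bar>(w k - v k) * f k x + v k * (f k x - g k x)\<bar>
            \<le> \<bar>w k - v k\<bar> * f k x + v k * \<bar>f k x - g k x\<bar>"
          using v0[OF k] nnf[OF k x] by (simp add: abs_mult)
      qed
      finally show "\<bar>mixture_density K w f x - mixture_density K v g x\<bar>
          \<le> (\<Sum>k=1..K. \<bar>w k - v k\<bar> * f k x + v k * \<bar>f k x - g k x\<bar>)" .
    qed
    also have "\<dots> = (\<Sum>k=1..K. \<integral>x. \<bar>w k - v k\<bar> * f k x + v k * \<bar>f k x - g k x\<bar> \<partial>\<mu>)"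
      using ig by (intro Bochner_Integration.integral_sum) auto
    also have "\<dots> = (\<Sum>k=1..K. \<bar>w k - v k\<bar> + v k * (\<integral>x. \<bar>f k x - g k x\<bar> \<partial>\<mu>))"
    proof (rule sum.cong[OF refl])
      fix k assume k: "k \<in> {1..K}"
      have "(\<integral>x. \<bar>w k - v k\<bar> * f k x + v k * \<bar>f k x - g k x\<bar> \<partial>\<mu>) =
          (\<integral>x. \<bar>w k - v k\<bar> * f k x \<partial>\<mu>) + (\<integral>x. v k * \<bar>f k x - g k x\<bar> \<partial>\<mu>)"
        using ig[OF k] by (intro Bochner_Integration.integral_add) auto
      then show "(\<integral>x. \<bar>w k - v k\<bar> * f k x + v k * \<bar>f k x - g k x\<bar> \<partial>\<mu>) =
          \<bar>w k - v k\<bar> + v k * (\<integral>x. \<bar>f k x - g k x\<bar> \<partial>\<mu>)"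
        using ig[OF k] by simp
    qed
    also have "\<dots> \<le> (\<Sum>k=1..K. \<bar>w k - v k\<bar> + v k * e)"
      using v0 L1 by (intro sum_mono add_left_mono mult_left_mono) auto
    also have "\<dots> = (\<Sum>k=1..K. \<bar>w k - v k\<bar>) + e"
      using v(1) by (simp add: sum.distrib sum_distrib_right[symmetric] weights_def)
    also have "\<dots> \<le> 2 * ((real K - 1) * d) + 2 * e" using v(3) by simp
    finally have "hellinger2 Q (dens_measure \<mu> (mixture_density K v g)) \<le> (real K - 1) * d + e"
      using hellinger2_le_L1(2)[OF sf mw mv] by (simp add: Qd)
    moreover have "dens_measure \<mu> (mixture_density K v g) = mixture \<mu> K v (\<lambda>k. dens_measure \<mu> (g k))"
      using v(1) gp by (intro mixture_dens_measure[symmetric]) (auto simp: weights_def)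
    moreover have "mixture \<mu> K v (\<lambda>k. dens_measure \<mu> (g k)) \<in>
        model_delta \<mu> \<F> d (mixtures \<mu> K (dens_measure \<mu> ` \<F>bar)) K"
    proof -
      have "mixture \<mu> K v (\<lambda>k. dens_measure \<mu> (g k)) \<in> mixtures \<mu> K (dens_measure \<mu> ` \<F>bar)"
        unfolding mixtures_def using v(1) g F(1) by blast
      then show ?thesis unfolding model_delta_def using v g by blast
    qed
    ultimately show ?thesis
      unfolding hellinger2_set_def by (auto intro!: INF_lower2)
  qed
  then show ?thesis
    unfolding d_def[symmetric] by (blast intro: ereal_le_epsilon2)
qed

end

end

theory Submission
  imports Defs
begin

text \<open>The whole argument rests on one one-sided deviation bound (\<open>uniform_deviation\<close>). Fix a reference
  density \<open>r\<close> in the countable model. With probability at least \<open>1 - exp (-\<xi>)\<close>, all \<open>q\<close> in the model satisfy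
  \<open>T(r, q) \<le> 20 n h\<^sup>2(P, r) + 300 \<xi> - n h\<^sup>2(P, q) / 16 + pen q\<close>. Because \<open>T(q, r) = - T(r, q)\<close>, this bound
  can be used twice: over all \<open>q\<close> it bounds the criterion of \<open>r\<close> from above, and at a near-minimizer \<open>q\<close>
  it bounds the criterion of \<open>q\<close> from below. The penalty of \<open>q\<close> cancels, and
  \<open>n h\<^sup>2(P, q) / 16 \<le> 40 n h\<^sup>2(P, r) + 2 pen r + 600 \<xi> + 8.24\<close> remains (\<open>near_minimizer_bound\<close>).
  Choosing \<open>r\<close> close to the best model, and bounding its penalty by a multiple of
  \<open>K V ln n + \<Delta> K\<close>, gives the theorem.

  The deviation bound combines two facts. First, the function \<open>g = psi (sqrt (q / r))\<close> has a drift: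
  \<open>E (g + g\<^sup>2 / 32)\<close> is at most \<open>- h\<^sup>2(P, q) / 16 + 20 h\<^sup>2(P, r)\<close>, by a pointwise inequality between
  the square roots of the three densities (\<open>drift_inequality_good\<close>). The drift is
  strong enough to pay for the second moment, so that only the offset process
  \<open>\<Sum> g(X\<^sub>i) - n E (g + g\<^sup>2 / 32)\<close> has to be controlled. Second, this process needs neither chaining nor
  localization: after symmetrization with a ghost sample, exchanging the two samples coordinate by coordinate
  gives each fixed vector of values an exponential moment at most 1 (\<open>offset_swap_bound\<close>), so a union
  bound over the value vectors on the \<open>2 n\<close> points suffices (\<open>offset_symmetrization\<close>).

  To have few value vectors, \<open>g\<close> is replaced by a larger function with finitely many values
  (\<open>discretized_psi\<close>). The penalty of \<open>q\<close> may come from any representation of the measure with density \<open>q\<close> as a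
  mixture of \<open>K\<close> components; its weights can be arbitrarily small, its components need not belong to the
  countable family, and it agrees with \<open>q\<close> only almost everywhere for the dominating measure, to which \<open>P\<close>
  may be singular. Therefore the weights \<open>w\<^sub>k\<close> and the ratios \<open>f\<^sub>k / r\<close> are rounded up to grids,
  and the function is set to its maximal value 1 on the bad set where some ratio exceeds \<open>t\<close>, where \<open>r\<close> vanishes, or
  where the representation fails. The bad set has probability at most \<open>K / t\<close> under \<open>r\<close>, hence
  costs only \<open>K / t\<close> and a multiple of \<open>h\<^sup>2(P, r)\<close> under \<open>P\<close> (\<open>drift_inequality_bad\<close>). With \<open>t\<close> about \<open>n / V\<close> all
  errors sum to a multiple of \<open>K V\<close>. The value vectors depend on the components only through the traces of their
  subgraphs on polynomially many points, so by the lemma of Sauer and Shelah the logarithm of their number is a multiple of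
  \<open>K V (1 + ln K + ln t)\<close>, far below the penalty (\<open>pattern_count_penalized\<close>).

  The event in the theorem is measurable because the Hellinger distance is a supremum of countably many functionals
  that are evidently measurable, as long as its argument stays in the closure of a countable model
  (\<open>hellinger2_measurable_on_closure\<close>).\<close>

section \<open>Hellinger distance between arbitrary probability measures\<close>

lemma sets_sum_measure: "sets (sum_measure P Q) = sets P" "space (sum_measure P Q) = space P"
  by (simp_all add: sum_measure_def sets.sigma_sets_eq)

lemma sigma_finite_sum_measure:
  assumes "sigma_finite_measure \<mu>" "finite_measure P" "sets P = sets \<mu>"
  shows "sigma_finite_measure (sum_measure P \<mu>)"
proof -
  interpret sigma_finite_measure \<mu> by fact
  interpret P: finite_measure P by fact
  obtain A :: "nat \<Rightarrow> 'a set" where A: "range A \<subseteq> sets \<mu>" "(\<Union>i. A i) = space \<mu>"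
    "\<And>i. emeasure \<mu> (A i) \<noteq> \<infinity>" using sigma_finite by blast
  have sp: "space P = space \<mu>" using assms(3) by (rule sets_eq_imp_space_eq)
  show ?thesis
  proof
    show "\<exists>B. countable B \<and> B \<subseteq> sets (sum_measure P \<mu>) \<and> \<Union> B = space (sum_measure P \<mu>)
        \<and> (\<forall>a\<in>B. emeasure (sum_measure P \<mu>) a \<noteq> \<infinity>)"
    proof (intro exI[of _ "range A"] conjI ballI)
      show "range A \<subseteq> sets (sum_measure P \<mu>)" using A(1) assms(3) by (simp add: sets_sum_measure)
      show "\<Union> (range A) = space (sum_measure P \<mu>)" using A(2) sp by (simp add: sets_sum_measure)
      fix a assume "a \<in> range A"
      then obtain i where i: "a = A i" by auto
      have "emeasure (sum_measure P \<mu>) (A i) = emeasure P (A i) + emeasure \<mu> (A i)"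
        using A(1) assms(3) by (intro emeasure_sum_measure) auto
      then show "emeasure (sum_measure P \<mu>) a \<noteq> \<infinity>"
        using A(3)[of i] P.emeasure_finite[of "A i"] by (simp add: i)
    qed simp
  qed
qed

text \<open>A Radon-Nikodym derivative between \<open>\<sigma>\<close>-finite measures is finite almost everywhere, so that it can be
  chosen real-valued.\<close>

lemma real_density_of_absolutely_continuous:
  assumes "sigma_finite_measure \<nu>" "sigma_finite_measure N" "absolutely_continuous \<nu> N" "sets N = sets \<nu>"
  obtains s :: "'a \<Rightarrow> real" where "s \<in> borel_measurable \<nu>" "\<And>x. 0 \<le> s x" "N = dens_measure \<nu> s"
proof
  interpret sigma_finite_measure \<nu> by fact
  show "(\<lambda>x. enn2real (RN_deriv \<nu> N x)) \<in> borel_measurable \<nu>" by simp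
  have "dens_measure \<nu> (\<lambda>x. enn2real (RN_deriv \<nu> N x)) = density \<nu> (RN_deriv \<nu> N)"
    using RN_deriv_finite[OF assms(2-4)]
    by (intro density_cong) (auto simp: ennreal_enn2real_if)
  then show "N = dens_measure \<nu> (\<lambda>x. enn2real (RN_deriv \<nu> N x))"
    using density_RN_deriv[OF assms(3,4)] by simp
qed simp

text \<open>The measure \<open>P\<close> may have a part that is singular to \<open>\<mu>\<close>. Passing to \<open>\<nu> = P + \<mu>\<close> gives both of them real
  densities; a \<open>\<mu>\<close>-density \<open>q\<close> then becomes the \<open>\<nu>\<close>-density \<open>s q\<close>, and ratios of \<open>\<mu>\<close>-densities are unchanged
  wherever \<open>s\<close> is positive.\<close>

lemma common_dominating_measure:
  assumes "sigma_finite_measure \<mu>" "prob_space P" "sets P = sets \<mu>"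
  obtains \<nu> and s p :: "'a \<Rightarrow> real" where
    "sigma_finite_measure \<nu>" "sets \<nu> = sets \<mu>"
    "s \<in> borel_measurable \<nu>" "\<And>x. 0 \<le> s x" "\<mu> = dens_measure \<nu> s"
    "p \<in> prob_densities \<nu>" "\<And>x. 0 \<le> p x" "P = dens_measure \<nu> p"
proof -
  interpret P: prob_space P by fact
  define \<nu> where "\<nu> = sum_measure P \<mu>"
  have sf: "sigma_finite_measure \<nu>"
    unfolding \<nu>_def using assms P.finite_measure_axioms by (intro sigma_finite_sum_measure) auto
  have s: "sets \<nu> = sets \<mu>" using assms(3) by (simp add: \<nu>_def sets_sum_measure)
  have e: "emeasure \<nu> A = emeasure P A + emeasure \<mu> A" if "A \<in> sets \<nu>" for A
    unfolding \<nu>_def using that s assms(3) by (intro emeasure_sum_measure) auto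
  have ac: "absolutely_continuous \<nu> \<mu>" "absolutely_continuous \<nu> P"
    using e s assms(3) by (auto simp: absolutely_continuous_def null_sets_def)
  obtain t where t: "t \<in> borel_measurable \<nu>" "\<And>x. 0 \<le> t x" "\<mu> = dens_measure \<nu> t"
    using real_density_of_absolutely_continuous[OF sf assms(1) ac(1)] s by metis
  obtain p where p: "p \<in> borel_measurable \<nu>" "\<And>x. 0 \<le> p x" "P = dens_measure \<nu> p"
    using real_density_of_absolutely_continuous[OF sf P.sigma_finite_measure_axioms ac(2)] s assms(3)
    by metis
  have "p \<in> prob_densities \<nu>" using p assms(2) by (simp add: prob_densities_def)
  then show ?thesis using that[OF sf s t] p by blast
qed

lemma dens_measure_dens_measure:
  assumes [measurable]: "s \<in> borel_measurable \<nu>" "q \<in> borel_measurable \<nu>" and "\<And>x. 0 \<le> s x"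
  shows "dens_measure (dens_measure \<nu> s) q = dens_measure \<nu> (\<lambda>x. s x * q x)"
  using assms by (simp add: density_density_eq ennreal_mult' )

lemma prob_densities_change_measure:
  assumes [measurable]: "s \<in> borel_measurable \<nu>" and s: "\<And>x. 0 \<le> s x"
    and q: "q \<in> prob_densities (dens_measure \<nu> s)"
  shows "(\<lambda>x. s x * q x) \<in> prob_densities \<nu>"
    and "dens_measure (dens_measure \<nu> s) q = dens_measure \<nu> (\<lambda>x. s x * q x)"
proof -
  have [measurable]: "q \<in> borel_measurable \<nu>" using q by (simp add: prob_densities_def)
  show eq: "dens_measure (dens_measure \<nu> s) q = dens_measure \<nu> (\<lambda>x. s x * q x)"
    using s by (intro dens_measure_dens_measure) auto
  show "(\<lambda>x. s x * q x) \<in> prob_densities \<nu>"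
    using q s unfolding prob_densities_def by (auto simp: eq[symmetric])
qed

lemma three_common_densities:
  assumes "prob_space P" "prob_space Q" "prob_space R" "sets Q = sets P" "sets R = sets P"
  obtains \<nu> p q r where "sigma_finite_measure \<nu>" "p \<in> prob_densities \<nu>" "q \<in> prob_densities \<nu>"
    "r \<in> prob_densities \<nu>" "P = dens_measure \<nu> p" "Q = dens_measure \<nu> q" "R = dens_measure \<nu> r"
proof -
  interpret P: prob_space P by fact
  obtain \<nu>1 s q where 1: "sigma_finite_measure \<nu>1" "sets \<nu>1 = sets P"
    "s \<in> borel_measurable \<nu>1" "\<And>x. 0 \<le> s x" "P = dens_measure \<nu>1 s"
    "q \<in> prob_densities \<nu>1" "Q = dens_measure \<nu>1 q"
    using common_dominating_measure[OF P.sigma_finite_measure_axioms assms(2,4)] by metis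
  obtain \<nu> t r where 2: "sigma_finite_measure \<nu>" "sets \<nu> = sets \<nu>1"
    "t \<in> borel_measurable \<nu>" "\<And>x. 0 \<le> t x" "\<nu>1 = dens_measure \<nu> t"
    "r \<in> prob_densities \<nu>" "R = dens_measure \<nu> r"
    using common_dominating_measure[OF 1(1) assms(3)] 1(2) assms(5) by metis
  have s: "s \<in> prob_densities \<nu>1" using 1 assms(1) by (simp add: prob_densities_def)
  have s': "s \<in> prob_densities (dens_measure \<nu> t)" and q': "q \<in> prob_densities (dens_measure \<nu> t)"
    using s 1(6) 2(5) by simp_all
  note S = prob_densities_change_measure[OF 2(3,4) s'] and Q = prob_densities_change_measure[OF 2(3,4) q']
  have "P = dens_measure \<nu> (\<lambda>x. t x * s x)" using S(2) 1(5) 2(5) by metis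
  moreover have "Q = dens_measure \<nu> (\<lambda>x. t x * q x)" using Q(2) 1(7) 2(5) by metis
  ultimately show ?thesis using that[OF 2(1) S(1) Q(1) 2(6) _ _ 2(7)] by blast
qed

lemma hellinger2_commute:
  assumes "prob_space P" "prob_space Q" "sets Q = sets P"
  shows "hellinger2 P Q = hellinger2 Q P"
proof -
  obtain \<nu> p q r where *: "sigma_finite_measure \<nu>" "p \<in> prob_densities \<nu>" "q \<in> prob_densities \<nu>"
    "P = dens_measure \<nu> p" "Q = dens_measure \<nu> q"
    using three_common_densities[OF assms(1,2,2,3,3)] by metis
  show ?thesis
    unfolding *(4,5) hellinger2_density[OF *(1,2,3)] hellinger2_density[OF *(1,3,2)]
    by (simp add: power2_commute)
qed

lemma hellinger2_nonneg:
  assumes "prob_space P" "prob_space Q" "sets Q = sets P"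
  shows "0 \<le> hellinger2 P Q"
proof -
  obtain \<nu> p q r where *: "sigma_finite_measure \<nu>" "p \<in> prob_densities \<nu>" "q \<in> prob_densities \<nu>"
    "P = dens_measure \<nu> p" "Q = dens_measure \<nu> q"
    using three_common_densities[OF assms(1,2,2,3,3)] by metis
  show ?thesis unfolding *(4,5) hellinger2_density[OF *(1,2,3)] by simp
qed

lemma square_diff_le_double:
  fixes a b c :: real
  shows "(a - c)\<^sup>2 \<le> 2 * (a - b)\<^sup>2 + 2 * (b - c)\<^sup>2"
proof -
  have "0 \<le> ((a - b) - (b - c))\<^sup>2" by simp
  then show ?thesis by (simp add: power2_eq_square algebra_simps)
qed

text \<open>Convexity of the square, applied to the roots of the densities with respect to a measure that dominates all three.\<close>

lemma hellinger2_quasi_triangle: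
  assumes "prob_space P" "prob_space Q" "prob_space R" "sets Q = sets P" "sets R = sets P"
  shows "hellinger2 P R \<le> 2 * hellinger2 P Q + 2 * hellinger2 Q R"
proof -
  obtain \<nu> p q r where *: "sigma_finite_measure \<nu>" "p \<in> prob_densities \<nu>" "q \<in> prob_densities \<nu>"
    "r \<in> prob_densities \<nu>" "P = dens_measure \<nu> p" "Q = dens_measure \<nu> q" "R = dens_measure \<nu> r"
    using three_common_densities[OF assms] by metis
  note i = hellinger2_le_L1(1)[OF *(1)]
  have "(\<integral>x. (sqrt (p x) - sqrt (r x))\<^sup>2 \<partial>\<nu>)
      \<le> (\<integral>x. 2 * (sqrt (p x) - sqrt (q x))\<^sup>2 + 2 * (sqrt (q x) - sqrt (r x))\<^sup>2 \<partial>\<nu>)"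
    using i * by (intro integral_mono square_diff_le_double) auto
  also have "\<dots> = 2 * (\<integral>x. (sqrt (p x) - sqrt (q x))\<^sup>2 \<partial>\<nu>) + 2 * (\<integral>x. (sqrt (q x) - sqrt (r x))\<^sup>2 \<partial>\<nu>)"
    using i * by (subst Bochner_Integration.integral_add) auto
  finally show ?thesis
    unfolding *(5-7) using * by (simp add: hellinger2_density[OF *(1)])
qed

lemma prob_densities_bounded_product:
  assumes p: "p \<in> prob_densities \<nu>" and [measurable]: "h \<in> borel_measurable \<nu>"
    and h: "\<And>x. \<bar>h x\<bar> \<le> M"
  shows "integrable \<nu> (\<lambda>x. p x * h x)"
    and "(\<integral>x. h x \<partial>dens_measure \<nu> p) = (\<integral>x. p x * h x \<partial>\<nu>)"
proof -
  have [measurable]: "p \<in> borel_measurable \<nu>" and nn: "\<And>x. x \<in> space \<nu> \<Longrightarrow> 0 \<le> p x"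
    using p by (auto simp: prob_densities_def)
  have "integrable \<nu> (\<lambda>x. M * p x)" using prob_densities_integral(1)[OF p] by simp
  then show "integrable \<nu> (\<lambda>x. p x * h x)"
  proof (rule Bochner_Integration.integrable_bound)
    show "AE x in \<nu>. norm (p x * h x) \<le> norm (M * p x)"
      using nn h order_trans[OF abs_ge_zero h]
      by (auto intro!: AE_I2 simp: abs_mult mult.commute[of M] intro!: mult_left_mono)
  qed simp
  show "(\<integral>x. h x \<partial>dens_measure \<nu> p) = (\<integral>x. p x * h x \<partial>\<nu>)"
    using nn by (subst integral_density) (auto intro!: AE_I2)
qed

text \<open>For positive \<open>\<phi>\<close>, the inequality of arithmetic and geometric means bounds the affinity
  \<open>\<integral> sqrt (p r)\<close> by half of \<open>\<integral> p \<phi> + \<integral> r / \<phi>\<close>. The expression below is therefore a lower bound for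
  the squared Hellinger distance, and for fixed \<open>\<phi>\<close> it is affine in \<open>R\<close>: this is the source of measurability.\<close>

definition affinity_dual :: "'a measure \<Rightarrow> ('a \<Rightarrow> real) \<Rightarrow> 'a measure \<Rightarrow> real" where
  "affinity_dual P \<phi> R = 1 - ((\<integral>x. \<phi> x \<partial>P) + (\<integral>x. 1 / \<phi> x \<partial>R)) / 2"

text \<open>The optimal \<open>\<phi>\<close> is the ratio of the square roots of the two densities; it is cut off to keep both \<open>\<phi>\<close>
  and \<open>1 / \<phi>\<close> bounded.\<close>

definition clamped_ratio :: "real \<Rightarrow> real \<Rightarrow> real \<Rightarrow> real" where
  "clamped_ratio M a b = (if a = 0 then M else max (1 / M) (min M (b / a)))"

lemma clamped_ratio_bounds:
  assumes "1 \<le> M"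
  shows "1 / M \<le> clamped_ratio M a b" "clamped_ratio M a b \<le> M"
proof -
  have "1 / M \<le> M" using assms order_trans[of "1/M" 1 M] by simp
  then show "1 / M \<le> clamped_ratio M a b" "clamped_ratio M a b \<le> M"
    unfolding clamped_ratio_def by auto
qed

text \<open>The left-hand side vanishes where the ratio is not cut off. Where the ratio leaves the interval from \<open>1 / M\<close> to \<open>M\<close>, one
  of \<open>a\<close> and \<open>b\<close> is smaller than the other by the factor \<open>M\<close>, and the defect is of the order of the larger square
  divided by \<open>M\<close>.\<close>

lemma clamped_ratio_near_optimal:
  fixes a b M :: real
  assumes ab: "0 \<le> a" "0 \<le> b" and M: "1 \<le> M"
  defines "\<phi> \<equiv> clamped_ratio M a b"
  shows "a\<^sup>2 * \<phi> + b\<^sup>2 / \<phi> - 2 * a * b \<le> 2 * (a\<^sup>2 + b\<^sup>2) / M"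
proof (cases "a = 0")
  case True
  have "b\<^sup>2 / M \<le> 2 * b\<^sup>2 / M" using M by (intro divide_right_mono) auto
  then show ?thesis using True by (simp add: \<phi>_def clamped_ratio_def)
next
  case False
  then have a: "0 < a" using ab by simp
  have M0: "0 < M" using M by simp
  have MM: "1 / M \<le> M" using M order_trans[of "1/M" 1 M] by simp
  consider "M < b / a" | "b / a < 1 / M" | "1 / M \<le> b / a" "b / a \<le> M" by linarith
  then show ?thesis
  proof cases
    case 1
    then have \<phi>: "\<phi> = M" using False MM by (simp add: \<phi>_def clamped_ratio_def)
    have "M * a \<le> b" using 1 a by (simp add: field_simps)
    then have "(M * a) * (M * a) \<le> b * b" using a ab M0 by (intro mult_mono) auto
    then have "a\<^sup>2 * M \<le> b\<^sup>2 / M" using M0 by (simp add: field_simps power2_eq_square)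
    moreover have "0 \<le> 2 * a * b" "0 \<le> a\<^sup>2 / M" using a ab M0 by auto
    moreover have "2 * (a\<^sup>2 + b\<^sup>2) / M = 2 * (a\<^sup>2 / M) + 2 * (b\<^sup>2 / M)"
      by (simp add: add_divide_distrib distrib_left)
    ultimately show ?thesis unfolding \<phi> by linarith
  next
    case 2
    then have \<phi>: "\<phi> = 1 / M" using False MM by (simp add: \<phi>_def clamped_ratio_def)
    have "M * b \<le> a" using 2 a M0 by (simp add: field_simps)
    then have "(M * b) * (M * b) \<le> a * a" using ab M0 by (intro mult_mono) auto
    then have "b\<^sup>2 * M \<le> a\<^sup>2 / M" using M0 by (simp add: field_simps power2_eq_square)
    moreover have "0 \<le> 2 * a * b" "0 \<le> b\<^sup>2 / M" using a ab M0 by auto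
    moreover have "2 * (a\<^sup>2 + b\<^sup>2) / M = 2 * (a\<^sup>2 / M) + 2 * (b\<^sup>2 / M)"
      by (simp add: add_divide_distrib distrib_left)
    moreover have "a\<^sup>2 * (1/M) + b\<^sup>2 / (1/M) = a\<^sup>2 / M + b\<^sup>2 * M" by simp
    ultimately show ?thesis unfolding \<phi> by linarith
  next
    case 3
    then have \<phi>: "\<phi> = b / a" using False by (simp add: \<phi>_def clamped_ratio_def)
    have "0 < b / a" using 3(1) M0 by (smt (verit) divide_pos_pos)
    then have "b \<noteq> 0" by auto
    then have "a\<^sup>2 * \<phi> + b\<^sup>2 / \<phi> - 2 * a * b = 0"
      unfolding \<phi> using a by (simp add: power2_eq_square)
    then show ?thesis using M0 by simp
  qed
qed

lemma weighted_am_gm_defect: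
  fixes a e \<phi> :: real
  assumes "0 < \<phi>"
  shows "a\<^sup>2 * \<phi> + e\<^sup>2 / \<phi> - 2 * a * e = (a * sqrt \<phi> - e / sqrt \<phi>)\<^sup>2"
proof -
  have "sqrt \<phi> * sqrt \<phi> = \<phi>" "sqrt \<phi> \<noteq> 0" using assms by auto
  then show ?thesis by (simp add: power2_eq_square field_simps)
qed

lemma weighted_am_gm_defect_perturb:
  fixes a b e \<phi> M :: real
  assumes M: "1 \<le> M" and \<phi>: "1 / M \<le> \<phi>"
  shows "a\<^sup>2 * \<phi> + e\<^sup>2 / \<phi> - 2 * a * e \<le> 2 * (a\<^sup>2 * \<phi> + b\<^sup>2 / \<phi> - 2 * a * b) + 2 * M * (b - e)\<^sup>2"
proof -
  have \<phi>0: "0 < \<phi>" using assms by (smt (verit) divide_pos_pos)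
  have "(a * sqrt \<phi> - e / sqrt \<phi>)\<^sup>2
      \<le> 2 * (a * sqrt \<phi> - b / sqrt \<phi>)\<^sup>2 + 2 * (b / sqrt \<phi> - e / sqrt \<phi>)\<^sup>2"
    by (rule square_diff_le_double)
  also have "(b / sqrt \<phi> - e / sqrt \<phi>)\<^sup>2 = (b - e)\<^sup>2 * (1 / \<phi>)"
    using \<phi>0 by (simp add: diff_divide_distrib[symmetric] power_divide)
  also have "(b - e)\<^sup>2 * (1 / \<phi>) \<le> (b - e)\<^sup>2 * M"
    using assms \<phi>0 by (intro mult_left_mono) (auto simp: field_simps)
  finally show ?thesis
    unfolding weighted_am_gm_defect[OF \<phi>0] by (simp add: mult.commute mult.left_commute)
qed

lemma affinity_dual_le:
  assumes pr: "prob_space P" "prob_space R" "sets R = sets P"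
    and [measurable]: "\<phi> \<in> borel_measurable P" and M: "1 \<le> M" and \<phi>: "\<And>x. 1 / M \<le> \<phi> x" "\<And>x. \<phi> x \<le> M"
  shows "affinity_dual P \<phi> R \<le> hellinger2 P R"
proof -
  obtain \<nu> p r where *: "sigma_finite_measure \<nu>" "p \<in> prob_densities \<nu>" "r \<in> prob_densities \<nu>"
    "P = dens_measure \<nu> p" "R = dens_measure \<nu> r"
    using three_common_densities[OF pr(1,2,2,3,3)] by metis
  have m[measurable]: "\<phi> \<in> borel_measurable \<nu>" using assms(4) unfolding *(4) by simp
  have \<phi>0: "0 < \<phi> x" for x using \<phi>(1)[of x] M by (smt (verit) divide_pos_pos)
  have b: "\<bar>\<phi> x\<bar> \<le> M" "\<bar>1 / \<phi> x\<bar> \<le> M" for x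
    using \<phi>0[of x] \<phi>(1,2)[of x] M by (auto simp: field_simps)
  note i = prob_densities_bounded_product[OF *(2) m b(1)]
    prob_densities_bounded_product[OF *(3) _ b(2), simplified]
  note j = prob_densities_integral[OF *(2)] prob_densities_integral[OF *(3)]
  have "affinity_dual P \<phi> R = (\<integral>x. (p x + r x) / 2 - (p x * \<phi> x + r x / \<phi> x) / 2 \<partial>\<nu>)"
    unfolding affinity_dual_def *(4,5) using i j by simp
  also have "\<dots> \<le> (\<integral>x. (sqrt (p x) - sqrt (r x))\<^sup>2 / 2 \<partial>\<nu>)"
  proof (rule integral_mono)
    show "integrable \<nu> (\<lambda>x. (p x + r x) / 2 - (p x * \<phi> x + r x / \<phi> x) / 2)" using i j by simp
    show "integrable \<nu> (\<lambda>x. (sqrt (p x) - sqrt (r x))\<^sup>2 / 2)"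
      using hellinger2_le_L1(1)[OF *(1-3)] by simp
    fix x assume "x \<in> space \<nu>"
    then have nn: "0 \<le> p x" "0 \<le> r x" using *(2,3) by (auto simp: prob_densities_def)
    have "0 \<le> (sqrt (p x))\<^sup>2 * \<phi> x + (sqrt (r x))\<^sup>2 / \<phi> x - 2 * sqrt (p x) * sqrt (r x)"
      unfolding weighted_am_gm_defect[OF \<phi>0] by simp
    moreover have "(sqrt (p x) - sqrt (r x))\<^sup>2 = p x + r x - 2 * sqrt (p x) * sqrt (r x)"
      using nn by (simp add: power2_diff)
    ultimately show "(p x + r x) / 2 - (p x * \<phi> x + r x / \<phi> x) / 2 \<le> (sqrt (p x) - sqrt (r x))\<^sup>2 / 2"
      by (simp only: real_sqrt_pow2[OF nn(1)] real_sqrt_pow2[OF nn(2)]) argo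
  qed
  also have "\<dots> = hellinger2 P R" by (simp add: *(4,5) hellinger2_density[OF *(1-3)])
  finally show ?thesis .
qed

text \<open>A function \<open>\<phi>\<close> that is built from \<open>p\<close> and \<open>q\<close> is still nearly optimal for the pair \<open>P\<close>, \<open>R\<close> if \<open>R\<close> is
  close to the measure with density \<open>q\<close>. Since \<open>R\<close> may have a part that is
  singular to \<open>\<nu>0\<close>, the proof passes once more to a common dominating measure.\<close>

lemma affinity_dual_ge:
  assumes sf: "sigma_finite_measure \<nu>0" and p: "p \<in> prob_densities \<nu>0" and q: "q \<in> prob_densities \<nu>0"
    and R: "prob_space R" "sets R = sets \<nu>0" and M: "1 \<le> M"
  defines "\<phi> \<equiv> \<lambda>x. clamped_ratio M (sqrt (p x)) (sqrt (q x))"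
  shows "hellinger2 (dens_measure \<nu>0 p) R \<le> affinity_dual (dens_measure \<nu>0 p) \<phi> R + 4 / M
           + 2 * M * hellinger2 (dens_measure \<nu>0 q) R"
proof -
  obtain \<nu> s r where *: "sigma_finite_measure \<nu>" "sets \<nu> = sets \<nu>0" "s \<in> borel_measurable \<nu>"
    "\<And>x. 0 \<le> s x" "\<nu>0 = dens_measure \<nu> s" "r \<in> prob_densities \<nu>" "R = dens_measure \<nu> r"
    using common_dominating_measure[OF sf R] by metis
  define P where "P = dens_measure \<nu>0 p"
  define a where "a x = s x * p x" for x
  define b where "b x = s x * q x" for x
  have a: "a \<in> prob_densities \<nu>" "P = dens_measure \<nu> a"
    using prob_densities_change_measure[OF *(3,4)] p unfolding *(5) a_def P_def by auto
  have b: "b \<in> prob_densities \<nu>" "dens_measure \<nu>0 q = dens_measure \<nu> b"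
    using prob_densities_change_measure[OF *(3,4)] q unfolding *(5) b_def by auto
  have [measurable]: "p \<in> borel_measurable \<nu>0" "q \<in> borel_measurable \<nu>0"
    using p q by (auto simp: prob_densities_def)
  have "\<phi> \<in> borel_measurable \<nu>0" unfolding \<phi>_def clamped_ratio_def by measurable
  then have m[measurable]: "\<phi> \<in> borel_measurable \<nu>" unfolding *(5) by simp
  have \<phi>: "1 / M \<le> \<phi> x" "\<phi> x \<le> M" for x
    unfolding \<phi>_def using clamped_ratio_bounds[OF M] by auto
  have \<phi>0: "0 < \<phi> x" for x using \<phi>(1)[of x] M by (smt (verit) divide_pos_pos)
  have bd: "\<bar>\<phi> x\<bar> \<le> M" "\<bar>1 / \<phi> x\<bar> \<le> M" for x
    using \<phi>0[of x] \<phi>[of x] M by (auto simp: field_simps)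
  note i = prob_densities_bounded_product[OF a(1) m bd(1)]
    prob_densities_bounded_product[OF *(6) _ bd(2), simplified]
  note j = prob_densities_integral[OF a(1)] prob_densities_integral[OF *(6)] prob_densities_integral[OF b(1)]
  note k = hellinger2_le_L1(1)[OF *(1) b(1) *(6)]
  have "hellinger2 P R = (\<integral>x. (sqrt (a x) - sqrt (r x))\<^sup>2 / 2 \<partial>\<nu>)"
    by (simp add: a(2) *(7) hellinger2_density[OF *(1) a(1) *(6)])
  also have "\<dots> \<le> (\<integral>x. (a x + r x) / 2 - (a x * \<phi> x + r x / \<phi> x) / 2
       + 2 * (a x + b x) / M + M * (sqrt (b x) - sqrt (r x))\<^sup>2 \<partial>\<nu>)"
  proof (rule integral_mono)
    show "integrable \<nu> (\<lambda>x. (a x + r x) / 2 - (a x * \<phi> x + r x / \<phi> x) / 2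
       + 2 * (a x + b x) / M + M * (sqrt (b x) - sqrt (r x))\<^sup>2)" using i j k by simp
    show "integrable \<nu> (\<lambda>x. (sqrt (a x) - sqrt (r x))\<^sup>2 / 2)"
      using hellinger2_le_L1(1)[OF *(1) a(1) *(6)] by simp
    fix x assume x: "x \<in> space \<nu>"
    then have nn: "0 \<le> a x" "0 \<le> r x" "0 \<le> b x" using a b *(6) by (auto simp: prob_densities_def)
    from x have "x \<in> space \<nu>0" using *(2) sets_eq_imp_space_eq by blast
    then have pq: "0 \<le> p x" "0 \<le> q x" using p q by (auto simp: prob_densities_def)
    have "s x * ((sqrt (p x))\<^sup>2 * \<phi> x + (sqrt (q x))\<^sup>2 / \<phi> x - 2 * sqrt (p x) * sqrt (q x))
        \<le> s x * (2 * ((sqrt (p x))\<^sup>2 + (sqrt (q x))\<^sup>2) / M)"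
      unfolding \<phi>_def using pq M *(4) by (intro mult_left_mono clamped_ratio_near_optimal) auto
    also have "\<dots> = 2 * (a x + b x) / M" using pq by (simp add: a_def b_def algebra_simps)
    also have "s x * ((sqrt (p x))\<^sup>2 * \<phi> x + (sqrt (q x))\<^sup>2 / \<phi> x - 2 * sqrt (p x) * sqrt (q x))
        = (sqrt (a x))\<^sup>2 * \<phi> x + (sqrt (b x))\<^sup>2 / \<phi> x - 2 * sqrt (a x) * sqrt (b x)"
    proof -
      have "sqrt (a x) * sqrt (b x) = s x * (sqrt (p x) * sqrt (q x))"
        using *(4)[of x] by (simp add: a_def b_def real_sqrt_mult)
      then show ?thesis using pq nn by (simp add: algebra_simps) (simp add: a_def b_def algebra_simps)
    qed
    finally have opt: "a x * \<phi> x + b x / \<phi> x - 2 * sqrt (a x) * sqrt (b x) \<le> 2 * (a x + b x) / M"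
      by (simp only: real_sqrt_pow2[OF nn(1)] real_sqrt_pow2[OF nn(3)])
    have pert: "a x * \<phi> x + r x / \<phi> x - 2 * sqrt (a x) * sqrt (r x)
        \<le> 2 * (a x * \<phi> x + b x / \<phi> x - 2 * sqrt (a x) * sqrt (b x))
          + 2 * M * (sqrt (b x) - sqrt (r x))\<^sup>2"
      using weighted_am_gm_defect_perturb[OF M \<phi>(1)[of x], of "sqrt (a x)" "sqrt (r x)" "sqrt (b x)"]
      by (simp only: real_sqrt_pow2[OF nn(1)] real_sqrt_pow2[OF nn(2)] real_sqrt_pow2[OF nn(3)])
    have "(sqrt (a x) - sqrt (r x))\<^sup>2 = a x + r x - 2 * sqrt (a x) * sqrt (r x)"
      using nn by (simp add: power2_diff)
    then show "(sqrt (a x) - sqrt (r x))\<^sup>2 / 2 \<le> (a x + r x) / 2 - (a x * \<phi> x + r x / \<phi> x) / 2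
       + 2 * (a x + b x) / M + M * (sqrt (b x) - sqrt (r x))\<^sup>2"
      using opt pert by argo
  qed
  also have "\<dots> = affinity_dual P \<phi> R + 4 / M + 2 * M * hellinger2 (dens_measure \<nu>0 q) R"
    unfolding affinity_dual_def a(2) b(2) *(7) hellinger2_density[OF *(1) b(1) *(6)]
    using i j k by simp
  finally show ?thesis by (simp add: P_def)
qed

text \<open>On the closure of a countable family, countably many test functions \<open>\<phi>\<close> suffice in the dual
  representation: one for each member of the family and each integer cutoff. For a measure \<open>X x\<close> in
  the closure, first the cutoff is chosen large and then the member close enough to \<open>X x\<close>.\<close>

lemma hellinger2_measurable_on_closure:
  assumes sf: "sigma_finite_measure \<mu>" and P: "P \<in> space (prob_algebra \<mu>)"
    and cQ: "countable \<Q>" and Q: "\<Q> \<subseteq> prob_densities \<mu>"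
    and X[measurable]: "X \<in> measurable N (prob_algebra \<mu>)"
    and cl: "\<And>x. x \<in> space N \<Longrightarrow> X x \<in> hellinger_closure \<mu> (dens_measure \<mu> ` \<Q>)"
  shows "(\<lambda>x. hellinger2 P (X x)) \<in> borel_measurable N"
proof -
  have Pp: "prob_space P" "sets P = sets \<mu>" using P by (auto simp: space_prob_algebra)
  obtain \<nu> s p where *: "sigma_finite_measure \<nu>" "sets \<nu> = sets \<mu>" "s \<in> borel_measurable \<nu>"
    "\<And>x. 0 \<le> s x" "\<mu> = dens_measure \<nu> s" "p \<in> prob_densities \<nu>" "P = dens_measure \<nu> p"
    using common_dominating_measure[OF sf Pp] by metis
  define \<phi> where "\<phi> q M x = clamped_ratio (real (Suc M)) (sqrt (p x)) (sqrt (s x * q x))" for q M x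
  have pd: "(\<lambda>x. s x * q x) \<in> prob_densities \<nu>" "dens_measure \<mu> q = dens_measure \<nu> (\<lambda>x. s x * q x)"
    if "q \<in> \<Q>" for q
    using prob_densities_change_measure[OF *(3,4)] Q that unfolding *(5) by auto
  have \<phi>m: "\<phi> q M \<in> borel_measurable \<mu>" if "q \<in> \<Q>" for q M
  proof -
    have [measurable]: "p \<in> borel_measurable \<nu>" "(\<lambda>x. s x * q x) \<in> borel_measurable \<nu>"
      using * pd[OF that] by (auto simp: prob_densities_def)
    have "\<phi> q M \<in> borel_measurable \<nu>" unfolding \<phi>_def clamped_ratio_def by measurable
    then show ?thesis unfolding *(5) by simp
  qed
  have bd: "1 / real (Suc M) \<le> \<phi> q M x" "\<phi> q M x \<le> real (Suc M)" for q M x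
    unfolding \<phi>_def using clamped_ratio_bounds[of "real (Suc M)"] by auto
  have eq: "hellinger2 P (X x) \<le> c \<longleftrightarrow> (\<forall>q\<in>\<Q>. \<forall>M. affinity_dual P (\<phi> q M) (X x) \<le> c)"
    if x: "x \<in> space N" for x c
  proof (intro iffI ballI allI)
    have R: "prob_space (X x)" "sets (X x) = sets \<mu>"
      using measurable_space[OF X x] by (auto simp: space_prob_algebra)
    show "affinity_dual P (\<phi> q M) (X x) \<le> c" if "hellinger2 P (X x) \<le> c" "q \<in> \<Q>" for q M
    proof -
      have "\<phi> q M \<in> borel_measurable P"
        using \<phi>m[OF \<open>q \<in> \<Q>\<close>] Pp(2) by (simp cong: measurable_cong_sets)
      then have "affinity_dual P (\<phi> q M) (X x) \<le> hellinger2 P (X x)"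
        using Pp R bd by (intro affinity_dual_le[where M="real (Suc M)"]) auto
      then show ?thesis using that by simp
    qed
    assume le: "\<forall>q\<in>\<Q>. \<forall>M. affinity_dual P (\<phi> q M) (X x) \<le> c"
    \<comment> \<open>With cutoff \<open>Suc M\<close>, the two error terms of \<open>affinity_dual_ge\<close> are at most \<open>e / 2\<close> each.\<close>
    have "hellinger2 P (X x) \<le> c + e" if e: "0 < e" for e
    proof -
      obtain M :: nat where M: "8 / e < real M" using reals_Archimedean2 by blast
      then have M4: "4 / real (Suc M) \<le> e / 2" using e by (simp add: field_simps)
      define \<eta> where "\<eta> = e / (4 * real (Suc M))"
      have "0 < \<eta>" using e by (simp add: \<eta>_def)
      then obtain q where q: "q \<in> \<Q>" "hellinger2 (X x) (dens_measure \<mu> q) < \<eta>"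
        using cl[OF x] by (auto simp: hellinger_closure_def)
      have pq: "prob_space (dens_measure \<mu> q)" using q(1) Q by (auto simp: prob_densities_def)
      have "hellinger2 (dens_measure \<nu> p) (X x) \<le> affinity_dual (dens_measure \<nu> p)
          (\<lambda>x. clamped_ratio (real (Suc M)) (sqrt (p x)) (sqrt (s x * q x))) (X x)
          + 4 / real (Suc M) + 2 * real (Suc M) * hellinger2 (dens_measure \<nu> (\<lambda>x. s x * q x)) (X x)"
        using * R pd[OF q(1)] by (intro affinity_dual_ge) auto
      then have "hellinger2 P (X x) \<le> affinity_dual P (\<phi> q M) (X x)
          + 4 / real (Suc M) + 2 * real (Suc M) * hellinger2 (dens_measure \<mu> q) (X x)"
        using pd(2)[OF q(1)] *(7) unfolding \<phi>_def by simp
      moreover have "hellinger2 (dens_measure \<mu> q) (X x) = hellinger2 (X x) (dens_measure \<mu> q)"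
        using R pq by (intro hellinger2_commute) auto
      moreover have "2 * real (Suc M) * hellinger2 (X x) (dens_measure \<mu> q) \<le> 2 * real (Suc M) * \<eta>"
        using q(2) by (intro mult_left_mono) auto
      moreover have "2 * real (Suc M) * \<eta> = e / 2" by (simp add: \<eta>_def field_simps)
      ultimately have "hellinger2 P (X x) \<le> affinity_dual P (\<phi> q M) (X x) + 4 / real (Suc M) + e / 2"
        by (simp only:)
      then show ?thesis using M4 le q(1) by (smt (verit) field_sum_of_halves)
    qed
    then show "hellinger2 P (X x) \<le> c" by (rule field_le_epsilon)
  qed
  have am: "(\<lambda>x. affinity_dual P (\<phi> q M) (X x)) \<in> borel_measurable N" if q: "q \<in> \<Q>" for q M
  proof -
    have Xs: "X \<in> measurable N (subprob_algebra \<mu>)"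
      using X by (rule measurable_prob_algebraD)
    have inv: "(\<lambda>x. 1 / \<phi> q M x) \<in> borel_measurable \<mu>" using \<phi>m[OF q] by simp
    have "(\<lambda>x. \<integral>y. 1 / \<phi> q M y \<partial>X x) \<in> borel_measurable N"
    by (rule measurable_compose[OF Xs integral_measurable_subprob_algebra[OF inv]])
    then show ?thesis unfolding affinity_dual_def by simp
  qed
  show ?thesis
  proof (rule borel_measurableI_le)
    fix c
    have "{x \<in> space N. hellinger2 P (X x) \<le> c} =
        {x \<in> space N. \<forall>q\<in>\<Q>. \<forall>M. affinity_dual P (\<phi> q M) (X x) \<le> c}"
      using eq by auto
    also have "\<dots> \<in> sets N"
      using am cQ by measurable
    finally show "{x \<in> space N. hellinger2 P (X x) \<le> c} \<in> sets N" .
  qed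
qed

section \<open>Shattering and the size of traces\<close>

lemma shatters_mono: "shatters \<S> B \<Longrightarrow> A \<subseteq> B \<Longrightarrow> shatters \<S> A"
  unfolding shatters_def
proof (intro allI impI)
  fix C assume sh: "\<forall>Ba\<subseteq>B. \<exists>S\<in>\<S>. S \<inter> B = Ba" and "A \<subseteq> B" "C \<subseteq> A"
  then obtain S where "S \<in> \<S>" "S \<inter> B = C" by (meson order_trans)
  then show "\<exists>S\<in>\<S>. S \<inter> A = C" using \<open>A \<subseteq> B\<close> \<open>C \<subseteq> A\<close> by (intro bexI[of _ S]) auto
qed

text \<open>Pajor's form of the lemma of Sauer and Shelah. Remove a point \<open>x\<close>: the sets without \<open>x\<close>, and the sets
  with \<open>x\<close> after deleting it, are two families on a smaller ground set. A set that both of them shatter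
  accounts for two sets shattered by \<open>\<S>\<close>, namely itself and its union with \<open>x\<close>.\<close>

lemma pajor:
  assumes "finite X" "\<S> \<subseteq> Pow X"
  shows "card \<S> \<le> card {B. B \<subseteq> X \<and> shatters \<S> B}"
  using assms
proof (induction X arbitrary: \<S> rule: finite_induct)
  case empty
  then have "\<S> = {} \<or> \<S> = {{}}" by auto
  then show ?case
  proof
    assume "\<S> = {{}}"
    then have "{B. B \<subseteq> {} \<and> shatters \<S> B} = {{}}" by (auto simp: shatters_def)
    then show ?thesis using \<open>\<S> = {{}}\<close> by simp
  qed simp
next
  case (insert x X)
  define S0 where "S0 = {S\<in>\<S>. x \<notin> S}"
  define S1 where "S1 = (\<lambda>S. S - {x}) ` {S\<in>\<S>. x \<in> S}"
  define T where "T \<R> = {B. B \<subseteq> X \<and> shatters \<R> B}" for \<R>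
  have fin: "finite \<S>" using insert by (meson finite.insertI finite_Pow_iff finite_subset)
  have finT: "finite (T \<R>)" for \<R> unfolding T_def using insert(1) by simp
  have "card \<S> = card S0 + card {S\<in>\<S>. x \<in> S}"
    unfolding S0_def using fin
    by (subst card_Un_disjoint[symmetric]) (auto intro!: arg_cong[where f=card])
  also have "card {S\<in>\<S>. x \<in> S} = card S1"
    unfolding S1_def by (intro card_image[symmetric]) (auto simp: inj_on_def)
  also have "card S0 + card S1 \<le> card (T S0) + card (T S1)"
    unfolding T_def using insert.prems
    by (intro add_mono insert.IH) (auto simp: S0_def S1_def)
  also have "\<dots> = card (T S0 \<union> T S1) + card (T S0 \<inter> T S1)"
    using finT by (intro card_Un_Int)
  also have "card (T S0 \<inter> T S1) = card (insert x ` (T S0 \<inter> T S1))"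
    using insert(2) by (intro card_image[symmetric]) (auto simp: inj_on_def T_def)
  also have "card (T S0 \<union> T S1) + card (insert x ` (T S0 \<inter> T S1))
      = card ((T S0 \<union> T S1) \<union> insert x ` (T S0 \<inter> T S1))"
    using finT insert(2) by (intro card_Un_disjoint[symmetric]) (auto simp: T_def)
  also have "\<dots> \<le> card {B. B \<subseteq> insert x X \<and> shatters \<S> B}"
  proof (rule card_mono)
    show "finite {B. B \<subseteq> insert x X \<and> shatters \<S> B}" using insert(1) by simp
    have a: "shatters \<S> B" if "B \<in> T S0" for B
      using that unfolding T_def shatters_def S0_def by blast
    have b: "shatters \<S> B" if "B \<in> T S1" for B
      unfolding shatters_def
    proof (intro allI impI)
      fix C assume "C \<subseteq> B"
      then have "\<exists>S\<in>S1. S \<inter> B = C"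
        using that unfolding T_def shatters_def by blast
      then obtain S where "S \<in> \<S>" "(S - {x}) \<inter> B = C" unfolding S1_def by blast
      moreover have "x \<notin> B" using that insert(2) by (auto simp: T_def)
      ultimately show "\<exists>S\<in>\<S>. S \<inter> B = C" by blast
    qed
    have c: "shatters \<S> (insert x B)" if B: "B \<in> T S0" "B \<in> T S1" for B
      unfolding shatters_def
    proof (intro allI impI)
      fix C assume C: "C \<subseteq> insert x B"
      have xB: "x \<notin> B" using B insert(2) by (auto simp: T_def)
      have CB: "C - {x} \<subseteq> B" using C by auto
      show "\<exists>S\<in>\<S>. S \<inter> insert x B = C"
      proof (cases "x \<in> C")
        case True
        obtain S where S: "S \<in> \<S>" "x \<in> S" "(S - {x}) \<inter> B = C - {x}"
          using B(2) CB unfolding T_def shatters_def S1_def by blast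
        have "S \<inter> insert x B = C" using S True xB by blast
        then show ?thesis using S by blast
      next
        case False
        obtain S where S: "S \<in> \<S>" "x \<notin> S" "S \<inter> B = C - {x}"
          using B(1) CB unfolding T_def shatters_def S0_def by blast
        have "S \<inter> insert x B = C" using S False xB by blast
        then show ?thesis using S by blast
      qed
    qed
    show "T S0 \<union> T S1 \<union> insert x ` (T S0 \<inter> T S1) \<subseteq> {B. B \<subseteq> insert x X \<and> shatters \<S> B}"
      using a b c by (auto simp: T_def)
  qed
  finally show ?case .
qed

text \<open>Multiply by \<open>x ^ V\<close> with \<open>x = V / N \<le> 1\<close>: the sum becomes at most \<open>(1 + x) ^ N \<le> exp V\<close>.\<close>

lemma binomial_partial_sum_le:
  assumes V: "1 \<le> V" "V \<le> N"
  shows "(\<Sum>i<V. real (N choose i)) \<le> (exp 1 * real N / real V) ^ V"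
proof -
  define x where "x = real V / real N"
  have x: "0 < x" "x \<le> 1" using V by (auto simp: x_def)
  have "x ^ V * (\<Sum>i<V. real (N choose i)) = (\<Sum>i<V. real (N choose i) * x ^ V)"
    by (simp add: sum_distrib_left mult.commute)
  also have "\<dots> \<le> (\<Sum>i<V. real (N choose i) * x ^ i)"
    using x by (intro sum_mono mult_left_mono power_decreasing) auto
  also have "\<dots> \<le> (\<Sum>i\<le>N. real (N choose i) * x ^ i)"
    using x V by (intro sum_mono2) auto
  also have "\<dots> = (x + 1) ^ N" by (subst binomial_ring) simp
  also have "\<dots> \<le> exp x ^ N" using x exp_ge_add_one_self[of x] by (intro power_mono) (simp_all add: add.commute)
  also have "\<dots> = exp (real V)" using V by (simp add: exp_of_nat_mult[symmetric] x_def)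
  also have "\<dots> = exp 1 ^ V" by (simp add: exp_of_nat_mult[symmetric])
  finally have "(\<Sum>i<V. real (N choose i)) \<le> exp 1 ^ V / x ^ V"
    using x by (simp add: field_simps)
  also have "\<dots> = (exp 1 * real N / real V) ^ V" by (simp add: x_def power_divide power_mult_distrib)
  finally show ?thesis .
qed

lemma card_subgraph_traces_le:
  assumes ns: "no_shattered \<Omega> \<F> V" and V: "1 \<le> V" "V \<le> N"
    and P: "finite P" "P \<subseteq> \<Omega> \<times> UNIV" "card P \<le> N"
  shows "real (card ((\<lambda>S. S \<inter> P) ` subgraphs \<Omega> \<F>)) \<le> (exp 1 * real N / real V) ^ V"
proof -
  define \<S> where "\<S> = (\<lambda>S. S \<inter> P) ` subgraphs \<Omega> \<F>"
  have sh: "shatters (subgraphs \<Omega> \<F>) B" if "B \<subseteq> P" "shatters \<S> B" for B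
    unfolding shatters_def
  proof (intro allI impI)
    fix C assume "C \<subseteq> B"
    then have "\<exists>S\<in>\<S>. S \<inter> B = C" using that(2) unfolding shatters_def by blast
    then obtain S where "S \<in> subgraphs \<Omega> \<F>" "(S \<inter> P) \<inter> B = C" unfolding \<S>_def by blast
    then show "\<exists>S\<in>subgraphs \<Omega> \<F>. S \<inter> B = C" using that by (intro bexI[of _ S]) auto
  qed
  have small: "card B < V" if B: "B \<subseteq> P" "shatters \<S> B" for B
  proof (rule ccontr)
    assume "\<not> card B < V"
    then obtain A where A: "A \<subseteq> B" "card A = V" "finite A"
      by (metis obtain_subset_with_card_n not_less)
    have "shatters (subgraphs \<Omega> \<F>) A" using sh[OF B] A(1) by (rule shatters_mono)
    moreover have "A \<subseteq> \<Omega> \<times> UNIV" using A(1) B(1) P(2) by (meson order_trans)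
    ultimately show False using ns A(2,3) unfolding no_shattered_def by blast
  qed
  have "card \<S> \<le> card {B. B \<subseteq> P \<and> shatters \<S> B}"
    using P(1) by (intro pajor) (auto simp: \<S>_def)
  also have "\<dots> \<le> card (\<Union>i<V. {B. B \<subseteq> P \<and> card B = i})"
    using small P(1) by (intro card_mono) auto
  also have "\<dots> \<le> (\<Sum>i<V. card {B. B \<subseteq> P \<and> card B = i})" by (rule card_UN_le) simp
  also have "\<dots> = (\<Sum>i<V. card P choose i)" using P(1) by (simp add: n_subsets)
  also have "\<dots> \<le> (\<Sum>i<V. N choose i)" using P(3) by (intro sum_mono binomial_right_mono)
  finally have "real (card \<S>) \<le> (\<Sum>i<V. real (N choose i))"
    by (metis of_nat_le_iff of_nat_sum)
  also have "\<dots> \<le> (exp 1 * real N / real V) ^ V" using V by (rule binomial_partial_sum_le)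
  finally show ?thesis unfolding \<S>_def .
qed

section \<open>Symmetrization with a quadratic offset\<close>

lemma exp_le_quadratic:
  fixes y :: real
  assumes "\<bar>y\<bar> \<le> 1"
  shows "exp y \<le> 1 + y + y\<^sup>2"
proof (cases "0 \<le> y")
  case True
  then show ?thesis using exp_bound[of y] assms by simp
next
  case False
  define x where "x = - y"
  have x: "0 < x" using False by (simp add: x_def)
  have "1 \<le> 1 + (x\<^sup>2 + x ^ 3 + x ^ 4) / 2" using x by simp
  also have "\<dots> = (1 - x + x\<^sup>2) * (1 + x + x\<^sup>2 / 2)"
    by (simp add: field_simps power2_eq_square power3_eq_cube power4_eq_xxxx)
  also have "\<dots> \<le> (1 - x + x\<^sup>2) * exp x"
  proof (rule mult_left_mono)
    show "1 + x + x\<^sup>2 / 2 \<le> exp x" using exp_lower_Taylor_quadratic[of x] x by simp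
    have "0 \<le> (1 - x / 2)\<^sup>2 + 3 / 4 * x\<^sup>2" by simp
    then show "0 \<le> 1 - x + x\<^sup>2" by (simp add: power2_eq_square field_simps)
  qed
  finally have "exp (- x) \<le> 1 - x + x\<^sup>2" by (simp add: exp_minus field_simps)
  then show ?thesis by (simp add: x_def)
qed

text \<open>The sum of the two exponents is \<open>- (u\<^sup>2 + v\<^sup>2) / 9600\<close>, which outweighs their squares, of total size at most about
  \<open>8 (u\<^sup>2 + v\<^sup>2) / 90000\<close>. The temperature 300 is chosen for this: it must be large enough compared with the
  offset constant 32, and at most \<open>kappa\<close>, so that \<open>\<Delta>\<close> keeps its full weight in the union bound over the models.\<close>

lemma offset_swap_bound:
  fixes u v :: real
  assumes "\<bar>u\<bar> \<le> 1" "\<bar>v\<bar> \<le> 1"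
  shows "exp ((u - v - v\<^sup>2 / 32) / 300) + exp ((v - u - u\<^sup>2 / 32) / 300) \<le> 2"
proof -
  have sq: "u\<^sup>2 \<le> 1" "v\<^sup>2 \<le> 1" using assms by (simp_all add: abs_square_le_1)
  have q: "((a - b - b\<^sup>2 / 32) / 300)\<^sup>2 \<le> (4 * (a\<^sup>2 + b\<^sup>2) + b\<^sup>2 / 512) / 90000"
    if "b\<^sup>2 \<le> 1" for a b :: real
  proof -
    have "0 \<le> ((a - b) + b\<^sup>2 / 32)\<^sup>2" "0 \<le> (a + b)\<^sup>2" by simp_all
    then have "(a - b - b\<^sup>2 / 32)\<^sup>2 \<le> 4 * (a\<^sup>2 + b\<^sup>2) + 2 * (b\<^sup>2 / 32)\<^sup>2"
      by (simp add: power2_eq_square algebra_simps)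
    also have "(b\<^sup>2 / 32)\<^sup>2 = b\<^sup>2 * b\<^sup>2 / 1024" by (simp add: power2_eq_square)
    also have "b\<^sup>2 * b\<^sup>2 \<le> b\<^sup>2 * 1" using that by (intro mult_left_mono) auto
    finally show ?thesis by (simp add: power_divide)
  qed
  have b: "\<bar>(a - b - b\<^sup>2 / 32) / 300\<bar> \<le> 1" if "\<bar>a\<bar> \<le> 1" "\<bar>b\<bar> \<le> 1" "b\<^sup>2 \<le> 1" for a b :: real
    using that zero_le_power2[of b] by (simp add: abs_le_iff, linarith)
  define y1 y2 where "y1 = (u - v - v\<^sup>2 / 32) / 300" and "y2 = (v - u - u\<^sup>2 / 32) / 300"
  have "exp y1 \<le> 1 + y1 + y1\<^sup>2" "exp y2 \<le> 1 + y2 + y2\<^sup>2"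
    unfolding y1_def y2_def using b assms sq by (auto intro!: exp_le_quadratic simp del: abs_divide)
  moreover have "y1 + y2 = - (u\<^sup>2 + v\<^sup>2) / 9600" by (simp add: y1_def y2_def field_simps)
  moreover have "y1\<^sup>2 \<le> (4 * (u\<^sup>2 + v\<^sup>2) + v\<^sup>2 / 512) / 90000"
    using q[OF sq(2), of u] unfolding y1_def .
  moreover have "y2\<^sup>2 \<le> (4 * (v\<^sup>2 + u\<^sup>2) + u\<^sup>2 / 512) / 90000"
    using q[OF sq(1), of v] unfolding y2_def .
  moreover have "0 \<le> u\<^sup>2" "0 \<le> v\<^sup>2" by simp_all
  ultimately show ?thesis unfolding y1_def[symmetric] y2_def[symmetric] by argo
qed

lemma (in prob_space) exp_expectation_le:
  fixes Y :: "'a \<Rightarrow> real"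
  assumes [measurable]: "Y \<in> borel_measurable M" and "\<And>x. x \<in> space M \<Longrightarrow> \<bar>Y x\<bar> \<le> B"
  shows "ennreal (exp (expectation Y)) \<le> (\<integral>\<^sup>+x. ennreal (exp (Y x)) \<partial>M)"
proof -
  have "integrable M Y" using assms(2) by (intro integrable_const_bound[of _ B]) (auto intro: AE_I2)
  moreover have ie: "integrable M (\<lambda>x. exp (Y x))"
    using assms(2) by (intro integrable_const_bound[of _ "exp B"]) (auto intro!: AE_I2 simp: abs_le_iff)
  ultimately have "exp (expectation Y) \<le> expectation (\<lambda>x. exp (Y x))"
    by (intro jensens_inequality[where I=UNIV] exp_convex) auto
  then show ?thesis
    using ie by (subst nn_integral_eq_integral) auto
qed

text \<open>The involution of \<open>{1..2 n}\<close> that exchanges \<open>i\<close> and \<open>i + n\<close> for all \<open>i\<close> in \<open>A\<close>. The first \<open>n\<close>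
  coordinates hold the sample, the last \<open>n\<close> the ghost sample.\<close>

definition swap_index :: "nat \<Rightarrow> nat set \<Rightarrow> nat \<Rightarrow> nat" where
  "swap_index n A i = (if i \<in> A then i + n else if i \<in> {1+n..n+n} \<and> i - n \<in> A then i - n else i)"

lemma nn_integral_PiM_swap:
  assumes M: "prob_space M" and A: "A \<subseteq> {1..n}"
    and F: "F \<in> borel_measurable (Pi\<^sub>M {1..n+n} (\<lambda>_. M))"
  shows "(\<integral>\<^sup>+z. F (\<lambda>i\<in>{1..n+n}. z (swap_index n A i)) \<partial>Pi\<^sub>M {1..n+n} (\<lambda>_. M))
    = (\<integral>\<^sup>+z. F z \<partial>Pi\<^sub>M {1..n+n} (\<lambda>_. M))"
proof -
  let ?K = "{1..n+n}" and ?s = "swap_index n A"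
  have to: "?s \<in> ?K \<rightarrow> ?K" using A by (fastforce simp: swap_index_def)
  have inv: "?s (?s i) = i" if "i \<in> ?K" for i using A that by (fastforce simp: swap_index_def)
  have inj: "inj_on ?s ?K" by (metis inj_onI inv)
  have d: "distr (Pi\<^sub>M ?K (\<lambda>_. M)) (Pi\<^sub>M ?K (\<lambda>_. M)) (\<lambda>\<omega>. \<lambda>i\<in>?K. \<omega> (?s i)) = Pi\<^sub>M ?K (\<lambda>_. M)"
    using distr_PiM_reindex[OF M inj to] by simp
  have m: "(\<lambda>\<omega>. \<lambda>i\<in>?K. \<omega> (?s i)) \<in> measurable (Pi\<^sub>M ?K (\<lambda>_. M)) (Pi\<^sub>M ?K (\<lambda>_. M))"
    using to by (intro measurable_restrict measurable_component_singleton) auto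
  have "(\<integral>\<^sup>+z. F z \<partial>Pi\<^sub>M ?K (\<lambda>_. M))
      = (\<integral>\<^sup>+z. F z \<partial>distr (Pi\<^sub>M ?K (\<lambda>_. M)) (Pi\<^sub>M ?K (\<lambda>_. M)) (\<lambda>\<omega>. \<lambda>i\<in>?K. \<omega> (?s i)))"
    by (simp only: d)
  also have "\<dots> = (\<integral>\<^sup>+z. F (\<lambda>i\<in>?K. z (?s i)) \<partial>Pi\<^sub>M ?K (\<lambda>_. M))"
    using m F by (subst nn_integral_distr) (simp_all add: d)
  finally show ?thesis by simp
qed

definition offset_gap :: "nat \<Rightarrow> (nat \<Rightarrow> real) \<Rightarrow> real" where
  "offset_gap n g = (\<Sum>i=1..n. (g i - g (i + n) - (g (i + n))\<^sup>2 / 32) / 300)"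

text \<open>The sum over all sets of swapped indices factorizes into a product over the coordinates, in which each factor
  is bounded by \<open>offset_swap_bound\<close>.\<close>

lemma sum_exp_offset_gap_swaps_le:
  assumes g: "\<And>i. i \<in> {1..n+n} \<Longrightarrow> \<bar>g i\<bar> \<le> 1"
  shows "(\<Sum>A\<in>Pow {1..n}. exp (offset_gap n (\<lambda>i. g (swap_index n A i)))) \<le> 2 ^ n"
proof -
  define a where "a i = exp ((g i - g (i + n) - (g (i + n))\<^sup>2 / 32) / 300)" for i
  define b where "b i = exp ((g (i + n) - g i - (g i)\<^sup>2 / 32) / 300)" for i
  have e: "exp (offset_gap n (\<lambda>i. g (swap_index n A i))) = (\<Prod>i\<in>A. b i) * (\<Prod>i\<in>{1..n}-A. a i)"
    if A: "A \<subseteq> {1..n}" for A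
  proof -
    have "exp (offset_gap n (\<lambda>i. g (swap_index n A i))) = (\<Prod>i\<in>{1..n}. if i \<in> A then b i else a i)"
      unfolding offset_gap_def
    proof (subst exp_sum, simp, rule prod.cong[OF refl])
      fix i assume i: "i \<in> {1..n}"
      have "swap_index n A i = (if i \<in> A then i + n else i)"
        "swap_index n A (i + n) = (if i \<in> A then i else i + n)"
        using i A by (auto simp: swap_index_def)
      then show "exp ((g (swap_index n A i) - g (swap_index n A (i + n))
          - (g (swap_index n A (i + n)))\<^sup>2 / 32) / 300) = (if i \<in> A then b i else a i)"
        by (simp add: a_def b_def)
    qed
    also have "\<dots> = (\<Prod>i\<in>A \<union> ({1..n} - A). if i \<in> A then b i else a i)"
      using A by (intro prod.cong) auto
    also have "\<dots> = (\<Prod>i\<in>A. if i \<in> A then b i else a i) * (\<Prod>i\<in>{1..n}-A. if i \<in> A then b i else a i)"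
      using A finite_subset[OF A] by (intro prod.union_disjoint) auto
    also have "\<dots> = (\<Prod>i\<in>A. b i) * (\<Prod>i\<in>{1..n}-A. a i)"
      by (intro arg_cong2[where f="(*)"] prod.cong) auto
    finally show ?thesis .
  qed
  have "(\<Sum>A\<in>Pow {1..n}. exp (offset_gap n (\<lambda>i. g (swap_index n A i))))
      = (\<Sum>A\<in>Pow {1..n}. (\<Prod>i\<in>A. b i) * (\<Prod>i\<in>{1..n}-A. a i))"
    using e by (intro sum.cong) auto
  also have "\<dots> = (\<Prod>i\<in>{1..n}. b i + a i)" by (rule prod_add[symmetric]) simp
  also have "\<dots> \<le> (\<Prod>i\<in>{1..n}. 2)"
  proof (rule prod_mono, intro conjI)
    fix i assume i: "i \<in> {1..n}"
    show "0 \<le> b i + a i" by (simp add: a_def b_def)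
    show "b i + a i \<le> 2" unfolding a_def b_def
      using offset_swap_bound[of "g i" "g (i + n)"] g[of i] g[of "i+n"] i by simp
  qed
  finally show ?thesis by simp
qed

text \<open>The expectation in the offset is moved by Jensen's inequality outside the exponential, where it becomes an
  average over a ghost sample. The law of the two samples is invariant under swaps, hence the integrand may be replaced by its
  average over all swaps. For fixed points that average runs over finitely many value vectors, each
  of which contributes at most its weight. The label \<open>lab q\<close> stands for the model from which \<open>q\<close> is taken.\<close>

lemma offset_symmetrization:
  fixes G :: "'q \<Rightarrow> 'a \<Rightarrow> real" and lab :: "'q \<Rightarrow> nat" and W N :: "nat \<Rightarrow> real"
  assumes M: "prob_space M" and cQ: "countable \<Q>"
    and meas: "\<And>q. q \<in> \<Q> \<Longrightarrow> G q \<in> borel_measurable M"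
    and bd: "\<And>q x. q \<in> \<Q> \<Longrightarrow> x \<in> space M \<Longrightarrow> \<bar>G q x\<bar> \<le> 1"
    and lab: "finite \<K>" "\<And>q. q \<in> \<Q> \<Longrightarrow> lab q \<in> \<K>" and W: "\<And>k. 0 \<le> W k"
    and fin: "\<And>k z. k \<in> \<K> \<Longrightarrow> z \<in> {1..n+n} \<rightarrow> space M \<Longrightarrow>
       finite ((\<lambda>q. \<lambda>i\<in>{1..n+n}. G q (z i)) ` {q\<in>\<Q>. lab q = k})"
    and count: "\<And>k z. k \<in> \<K> \<Longrightarrow> z \<in> {1..n+n} \<rightarrow> space M \<Longrightarrow>
       real (card ((\<lambda>q. \<lambda>i\<in>{1..n+n}. G q (z i)) ` {q\<in>\<Q>. lab q = k})) \<le> N k"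
  shows "(\<integral>\<^sup>+x. (SUP q\<in>\<Q>. ennreal (W (lab q) *
        exp (((\<Sum>i=1..n. G q (x i)) - real n * (\<integral>y. G q y + (G q y)\<^sup>2 / 32 \<partial>M)) / 300)))
        \<partial>Pi\<^sub>M {1..n} (\<lambda>_. M)) \<le> ennreal (\<Sum>k\<in>\<K>. N k * W k)"
proof -
  interpret M: prob_space M by fact
  interpret product_sigma_finite "\<lambda>_::nat. M" ..
  let ?I = "{1..n}" and ?J = "{1+n..n+n}" and ?K = "{1..n+n}"
  have IJ: "?I \<union> ?J = ?K" "?I \<inter> ?J = {}" by auto
  define F where "F z = (SUP q\<in>\<Q>. ennreal (W (lab q) * exp (offset_gap n (\<lambda>i. G q (z i)))))"
    for z :: "nat \<Rightarrow> 'a"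
  have comp: "(\<lambda>z. G q (z i)) \<in> borel_measurable (Pi\<^sub>M ?K (\<lambda>_. M))" if "q \<in> \<Q>" "i \<in> ?K" for q i
    using measurable_compose[OF measurable_component_singleton[OF that(2)] meas[OF that(1)]] .
  have gapm: "(\<lambda>z. ennreal (W (lab q) * exp (offset_gap n (\<lambda>i. G q (z i)))))
      \<in> borel_measurable (Pi\<^sub>M ?K (\<lambda>_. M))" if q: "q \<in> \<Q>" for q
  proof -
    have "(\<lambda>z. offset_gap n (\<lambda>i. G q (z i))) \<in> borel_measurable (Pi\<^sub>M ?K (\<lambda>_. M))"
      unfolding offset_gap_def
      by (intro borel_measurable_sum borel_measurable_divide borel_measurable_diff
          borel_measurable_power borel_measurable_const comp[OF q]) auto
    then show ?thesis by simp
  qed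
  have Fm: "F \<in> borel_measurable (Pi\<^sub>M ?K (\<lambda>_. M))"
    unfolding F_def[abs_def] by (rule borel_measurable_SUP[OF cQ gapm])
  have ghost: "(SUP q\<in>\<Q>. ennreal (W (lab q) *
        exp (((\<Sum>i=1..n. G q (x i)) - real n * (\<integral>y. G q y + (G q y)\<^sup>2 / 32 \<partial>M)) / 300)))
      \<le> (\<integral>\<^sup>+y. F (merge ?I ?J (x, y)) \<partial>Pi\<^sub>M ?J (\<lambda>_. M))" if x: "x \<in> space (Pi\<^sub>M ?I (\<lambda>_. M))" for x
  proof (rule SUP_least)
    fix q assume q: "q \<in> \<Q>"
    have [measurable]: "G q \<in> borel_measurable M" by (rule meas[OF q])
    define S where "S = (\<Sum>i=1..n. G q (x i))"
    define Y where "Y y = - ((G q y + (G q y)\<^sup>2 / 32) / 300)" for y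
    have Ym[measurable]: "Y \<in> borel_measurable M" unfolding Y_def[abs_def] by measurable
    have Yb: "\<bar>Y y\<bar> \<le> 1" if "y \<in> space M" for y
    proof -
      have "\<bar>G q y\<bar> \<le> 1" "(G q y)\<^sup>2 \<le> 1" using bd[OF q that] by (simp_all add: abs_square_le_1)
      then show ?thesis unfolding Y_def using zero_le_power2[of "G q y"]
        by (simp add: abs_le_iff, linarith)
    qed
    have "ennreal (exp (real n * M.expectation Y)) = (\<Prod>j\<in>?J. ennreal (exp (M.expectation Y)))"
      by (simp add: exp_of_nat_mult ennreal_power)
    also have "\<dots> \<le> (\<Prod>j\<in>?J. \<integral>\<^sup>+y. ennreal (exp (Y y)) \<partial>M)"
      by (intro prod_mono_ennreal M.exp_expectation_le[of Y 1]) (use Yb in auto)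
    also have "\<dots> = (\<integral>\<^sup>+y. (\<Prod>j\<in>?J. ennreal (exp (Y (y j)))) \<partial>Pi\<^sub>M ?J (\<lambda>_. M))"
      by (rule product_nn_integral_prod[symmetric]) auto
    also have "\<dots> = (\<integral>\<^sup>+y. ennreal (exp (\<Sum>j\<in>?J. Y (y j))) \<partial>Pi\<^sub>M ?J (\<lambda>_. M))"
      by (simp add: prod_ennreal exp_sum)
    finally have g1: "ennreal (exp (real n * M.expectation Y))
        \<le> (\<integral>\<^sup>+y. ennreal (exp (\<Sum>j\<in>?J. Y (y j))) \<partial>Pi\<^sub>M ?J (\<lambda>_. M))" .
    have EY: "M.expectation Y = - ((\<integral>y. G q y + (G q y)\<^sup>2 / 32 \<partial>M) / 300)"
      unfolding Y_def by simp
    have e1: "W (lab q) * exp ((S - real n * (\<integral>y. G q y + (G q y)\<^sup>2 / 32 \<partial>M)) / 300)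
        = W (lab q) * exp (S / 300) * exp (real n * M.expectation Y)"
      unfolding EY mult.assoc exp_add[symmetric] by (simp add: diff_divide_distrib)
    have W': "0 \<le> W (lab q) * exp (S / 300)" using W by simp
    have "ennreal (W (lab q) * exp ((S - real n * (\<integral>y. G q y + (G q y)\<^sup>2 / 32 \<partial>M)) / 300))
        = ennreal (W (lab q) * exp (S / 300)) * ennreal (exp (real n * M.expectation Y))"
      by (simp only: e1 ennreal_mult[OF W' less_imp_le[OF exp_gt_zero]])
    also have "\<dots> \<le> ennreal (W (lab q) * exp (S / 300))
        * (\<integral>\<^sup>+y. ennreal (exp (\<Sum>j\<in>?J. Y (y j))) \<partial>Pi\<^sub>M ?J (\<lambda>_. M))"
      by (intro mult_left_mono g1) auto
    also have "\<dots> = (\<integral>\<^sup>+y. ennreal (W (lab q) * exp (S / 300)) * ennreal (exp (\<Sum>j\<in>?J. Y (y j)))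
        \<partial>Pi\<^sub>M ?J (\<lambda>_. M))"
      by (rule nn_integral_cmult[symmetric]) measurable
    also have "\<dots> \<le> (\<integral>\<^sup>+y. F (merge ?I ?J (x, y)) \<partial>Pi\<^sub>M ?J (\<lambda>_. M))"
    proof (rule nn_integral_mono)
      fix y assume y: "y \<in> space (Pi\<^sub>M ?J (\<lambda>_. M))"
      have "offset_gap n (\<lambda>i. G q (merge ?I ?J (x, y) i))
          = (\<Sum>i=1..n. G q (x i) / 300 + Y (y (i + n)))"
        unfolding offset_gap_def
        by (intro sum.cong) (auto simp: merge_def Y_def diff_divide_distrib add_divide_distrib)
      also have "\<dots> = S / 300 + (\<Sum>j\<in>?J. Y (y j))"
        using sum.shift_bounds_cl_nat_ivl[of "\<lambda>j. Y (y j)" 1 n n]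
        by (simp add: sum.distrib S_def sum_divide_distrib)
      finally have "ennreal (W (lab q) * exp (S / 300)) * ennreal (exp (\<Sum>j\<in>?J. Y (y j)))
          = ennreal (W (lab q) * exp (offset_gap n (\<lambda>i. G q (merge ?I ?J (x, y) i))))"
        using W by (simp add: ennreal_mult[symmetric] exp_add mult.assoc)
      also have "\<dots> \<le> F (merge ?I ?J (x, y))" unfolding F_def using q by (rule SUP_upper)
      finally show "ennreal (W (lab q) * exp (S / 300)) * ennreal (exp (\<Sum>j\<in>?J. Y (y j)))
          \<le> F (merge ?I ?J (x, y))" .
    qed
    finally show "ennreal (W (lab q) * exp (((\<Sum>i=1..n. G q (x i))
        - real n * (\<integral>y. G q y + (G q y)\<^sup>2 / 32 \<partial>M)) / 300))
      \<le> (\<integral>\<^sup>+y. F (merge ?I ?J (x, y)) \<partial>Pi\<^sub>M ?J (\<lambda>_. M))" by (simp only: S_def)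
  qed
  have N0: "0 \<le> N k" if "k \<in> \<K>" for k
  proof -
    obtain x0 where "x0 \<in> space M" using M.not_empty by blast
    then show ?thesis using count[OF that, of "\<lambda>_. x0"] by (auto intro: order_trans[OF of_nat_0_le_iff])
  qed
  have point: "(\<Sum>A\<in>Pow ?I. F (\<lambda>i\<in>?K. z (swap_index n A i))) \<le> 2 ^ n * ennreal (\<Sum>k\<in>\<K>. N k * W k)"
    if z: "z \<in> space (Pi\<^sub>M ?K (\<lambda>_. M))" for z
  proof -
    have zs: "z \<in> ?K \<rightarrow> space M" using z by (auto simp: space_PiM)
    define Pat where "Pat k = (\<lambda>q. \<lambda>i\<in>?K. G q (z i)) ` {q\<in>\<Q>. lab q = k}" for k
    define E where "E A g = exp (offset_gap n (\<lambda>i. g (swap_index n A i)))" for A and g :: "nat \<Rightarrow> real"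
    have Pf: "finite (Pat k)" "real (card (Pat k)) \<le> N k" if "k \<in> \<K>" for k
      unfolding Pat_def using fin[OF that zs] count[OF that zs] by auto
    have FE: "F (\<lambda>i\<in>?K. z (swap_index n A i)) \<le> ennreal (\<Sum>k\<in>\<K>. W k * (\<Sum>g\<in>Pat k. E A g))"
      if A: "A \<in> Pow ?I" for A
      unfolding F_def
    proof (rule SUP_least)
      fix q assume q: "q \<in> \<Q>"
      define g where "g = (\<lambda>i\<in>?K. G q (z i))"
      have g: "g \<in> Pat (lab q)" unfolding Pat_def g_def using q by auto
      have s: "swap_index n A i \<in> ?K" if "i \<in> ?K" for i
        using A that by (fastforce simp: swap_index_def)
      have "offset_gap n (\<lambda>i. G q ((\<lambda>i\<in>?K. z (swap_index n A i)) i)) = offset_gap n (\<lambda>i. g (swap_index n A i))"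
        unfolding offset_gap_def
      proof (rule sum.cong[OF refl])
        fix i assume i: "i \<in> ?I"
        then have "i \<in> ?K" "i + n \<in> ?K" by auto
        then show "(G q ((\<lambda>i\<in>?K. z (swap_index n A i)) i) - G q ((\<lambda>i\<in>?K. z (swap_index n A i)) (i + n))
            - (G q ((\<lambda>i\<in>?K. z (swap_index n A i)) (i + n)))\<^sup>2 / 32) / 300
          = (g (swap_index n A i) - g (swap_index n A (i + n)) - (g (swap_index n A (i + n)))\<^sup>2 / 32) / 300"
          using s by (simp add: g_def)
      qed
      then have "W (lab q) * exp (offset_gap n (\<lambda>i. G q ((\<lambda>i\<in>?K. z (swap_index n A i)) i)))
          = W (lab q) * E A g" by (simp add: E_def)
      also have "\<dots> \<le> W (lab q) * (\<Sum>g\<in>Pat (lab q). E A g)"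
        using W g Pf(1)[OF lab(2)[OF q]] by (intro mult_left_mono member_le_sum) (auto simp: E_def)
      also have "\<dots> \<le> (\<Sum>k\<in>\<K>. W k * (\<Sum>g\<in>Pat k. E A g))"
        using W lab(1) lab(2)[OF q]
        by (intro member_le_sum[where f="\<lambda>k. W k * (\<Sum>g\<in>Pat k. E A g)"])
           (auto simp: E_def intro!: mult_nonneg_nonneg sum_nonneg)
      finally show "ennreal (W (lab q) * exp (offset_gap n (\<lambda>i. G q ((\<lambda>i\<in>?K. z (swap_index n A i)) i))))
          \<le> ennreal (\<Sum>k\<in>\<K>. W k * (\<Sum>g\<in>Pat k. E A g))" by (rule ennreal_leI)
    qed
    have "(\<Sum>A\<in>Pow ?I. F (\<lambda>i\<in>?K. z (swap_index n A i)))
        \<le> (\<Sum>A\<in>Pow ?I. ennreal (\<Sum>k\<in>\<K>. W k * (\<Sum>g\<in>Pat k. E A g)))"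
      by (rule sum_mono) (rule FE)
    also have "\<dots> = ennreal (\<Sum>A\<in>Pow ?I. \<Sum>k\<in>\<K>. W k * (\<Sum>g\<in>Pat k. E A g))"
      using W by (intro sum_ennreal) (auto simp: E_def intro!: sum_nonneg mult_nonneg_nonneg)
    also have "(\<Sum>A\<in>Pow ?I. \<Sum>k\<in>\<K>. W k * (\<Sum>g\<in>Pat k. E A g))
        = (\<Sum>k\<in>\<K>. W k * (\<Sum>g\<in>Pat k. \<Sum>A\<in>Pow ?I. E A g))"
      unfolding sum_distrib_left by (subst sum.swap, subst sum.swap) (rule refl)
    also have "\<dots> \<le> (\<Sum>k\<in>\<K>. W k * (\<Sum>g\<in>Pat k. 2 ^ n))"
    proof (intro sum_mono mult_left_mono W)
      fix k g assume "g \<in> Pat k"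
      then obtain q where q: "q \<in> \<Q>" "g = (\<lambda>i\<in>?K. G q (z i))" unfolding Pat_def by auto
      have "\<bar>g i\<bar> \<le> 1" if "i \<in> ?K" for i
        using bd[OF q(1) Pi_mem[OF zs that]] that by (simp add: q(2))
      then show "(\<Sum>A\<in>Pow ?I. E A g) \<le> 2 ^ n" unfolding E_def by (rule sum_exp_offset_gap_swaps_le)
    qed
    also have "\<dots> \<le> 2 ^ n * (\<Sum>k\<in>\<K>. N k * W k)"
    proof -
      have "W k * (\<Sum>g\<in>Pat k. 2 ^ n) \<le> 2 ^ n * (N k * W k)" if "k \<in> \<K>" for k
        using mult_right_mono[OF Pf(2)[OF that], of "W k * 2 ^ n"] W[of k] by (simp add: ac_simps)
      then show ?thesis unfolding sum_distrib_left[of "2 ^ n"] by (intro sum_mono)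
    qed
    finally have "(\<Sum>A\<in>Pow ?I. F (\<lambda>i\<in>?K. z (swap_index n A i)))
        \<le> ennreal (2 ^ n * (\<Sum>k\<in>\<K>. N k * W k))" by (simp only: ennreal_leI)
    moreover have "ennreal (2 ^ n) = 2 ^ n" by (subst ennreal_power[symmetric]) simp_all
    moreover have "ennreal (2 ^ n * (\<Sum>k\<in>\<K>. N k * W k)) = ennreal (2 ^ n) * ennreal (\<Sum>k\<in>\<K>. N k * W k)"
      using N0 W by (intro ennreal_mult sum_nonneg) auto
    ultimately show ?thesis by (simp only:)
  qed
  have "2 ^ n * (\<integral>\<^sup>+z. F z \<partial>Pi\<^sub>M ?K (\<lambda>_. M))
      = (\<Sum>A\<in>Pow ?I. \<integral>\<^sup>+z. F z \<partial>Pi\<^sub>M ?K (\<lambda>_. M))"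
    by (simp add: card_Pow)
  also have "\<dots> = (\<Sum>A\<in>Pow ?I. \<integral>\<^sup>+z. F (\<lambda>i\<in>?K. z (swap_index n A i)) \<partial>Pi\<^sub>M ?K (\<lambda>_. M))"
    by (intro sum.cong refl nn_integral_PiM_swap[OF M _ Fm, symmetric]) auto
  also have "\<dots> = (\<integral>\<^sup>+z. (\<Sum>A\<in>Pow ?I. F (\<lambda>i\<in>?K. z (swap_index n A i))) \<partial>Pi\<^sub>M ?K (\<lambda>_. M))"
  proof (rule nn_integral_sum[symmetric])
    fix A assume A: "A \<in> Pow ?I"
    then have "swap_index n A \<in> ?K \<rightarrow> ?K" by (fastforce simp: swap_index_def)
    then have "(\<lambda>\<omega>. \<lambda>i\<in>?K. \<omega> (swap_index n A i)) \<in> measurable (Pi\<^sub>M ?K (\<lambda>_. M)) (Pi\<^sub>M ?K (\<lambda>_. M))"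
      by (intro measurable_restrict measurable_component_singleton) auto
    then show "(\<lambda>z. F (\<lambda>i\<in>?K. z (swap_index n A i))) \<in> borel_measurable (Pi\<^sub>M ?K (\<lambda>_. M))"
      using Fm by (rule measurable_compose)
  qed
  also have "\<dots> \<le> (\<integral>\<^sup>+z. 2 ^ n * ennreal (\<Sum>k\<in>\<K>. N k * W k) \<partial>Pi\<^sub>M ?K (\<lambda>_. M))"
    by (intro nn_integral_mono point)
  also have "\<dots> = 2 ^ n * ennreal (\<Sum>k\<in>\<K>. N k * W k)"
  proof -
    interpret PK: prob_space "Pi\<^sub>M ?K (\<lambda>_. M)" using M by (intro prob_space_PiM)
    show ?thesis by (simp only: nn_integral_const PK.emeasure_space_1 mult_1_right)
  qed
  finally have F: "(\<integral>\<^sup>+z. F z \<partial>Pi\<^sub>M ?K (\<lambda>_. M)) \<le> ennreal (\<Sum>k\<in>\<K>. N k * W k)"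
    by (subst (asm) ennreal_mult_le_mult_iff) (auto simp: power_eq_top_ennreal)
  have "(\<integral>\<^sup>+x. (SUP q\<in>\<Q>. ennreal (W (lab q) *
        exp (((\<Sum>i=1..n. G q (x i)) - real n * (\<integral>y. G q y + (G q y)\<^sup>2 / 32 \<partial>M)) / 300)))
        \<partial>Pi\<^sub>M ?I (\<lambda>_. M))
      \<le> (\<integral>\<^sup>+x. \<integral>\<^sup>+y. F (merge ?I ?J (x, y)) \<partial>Pi\<^sub>M ?J (\<lambda>_. M) \<partial>Pi\<^sub>M ?I (\<lambda>_. M))"
    by (intro nn_integral_mono ghost)
  also have "\<dots> = (\<integral>\<^sup>+z. F z \<partial>Pi\<^sub>M ?K (\<lambda>_. M))"
    by (rule product_nn_integral_fold[OF IJ(2) finite_atLeastAtMost finite_atLeastAtMost,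
          unfolded IJ(1), OF Fm, symmetric])
  also note F
  finally show ?thesis .
qed

section \<open>Discretization of the test function and its drift\<close>

text \<open>This formula also covers the conventions for vanishing denominators, and makes the antisymmetry of the test
  statistic visible.\<close>

lemma psi_sqrt_ratio:
  assumes "0 \<le> a" "0 \<le> b"
  shows "psi (sqrt_ratio a b) = (sqrt a - sqrt b) / (sqrt a + sqrt b)"
proof (cases "b = 0")
  case True
  then show ?thesis by (simp add: psi_def sqrt_ratio_def one_ereal_def)
next
  case False
  then have b: "0 < sqrt b" using assms by simp
  have "psi (sqrt_ratio a b) = (sqrt a / sqrt b - 1) / (sqrt a / sqrt b + 1)"
    using False by (simp add: psi_def sqrt_ratio_def real_sqrt_divide)
  also have "sqrt a / sqrt b - 1 = (sqrt a - sqrt b) / sqrt b" using b by (simp add: diff_divide_distrib)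
  also have "sqrt a / sqrt b + 1 = (sqrt a + sqrt b) / sqrt b" using b by (simp add: add_divide_distrib)
  finally show ?thesis using b by simp
qed

lemma psi_sqrt_ratio_bounds:
  assumes "0 \<le> a" "0 \<le> b"
  shows "\<bar>psi (sqrt_ratio a b)\<bar> \<le> 1"
proof -
  have "0 \<le> sqrt a" "0 \<le> sqrt b" using assms by auto
  then show ?thesis unfolding psi_sqrt_ratio[OF assms]
    by (auto simp add: abs_divide divide_le_eq_1 abs_le_iff simp del: real_sqrt_ge_0_iff)
qed

definition psi_sqrt :: "real \<Rightarrow> real" where
  "psi_sqrt r = (sqrt r - 1) / (sqrt r + 1)"

lemma psi_sqrt_bounds:
  assumes "0 \<le> r"
  shows "\<bar>psi_sqrt r\<bar> \<le> 1"
  using assms real_sqrt_ge_zero[OF assms] unfolding psi_sqrt_def abs_le_iff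
  by (auto simp: pos_divide_le_eq minus_divide_left simp del: real_sqrt_ge_0_iff)

text \<open>The square root makes an additive error \<open>a\<close> in the ratio an error of order \<open>sqrt a\<close> near 0; this is why
  the grids below have mesh \<open>1 / t\<^sup>2\<close> for an accuracy \<open>1 / t\<close>.\<close>

lemma psi_sqrt_diff:
  assumes "0 \<le> r" "r \<le> s"
  shows "psi_sqrt r \<le> psi_sqrt s" "psi_sqrt s - psi_sqrt r \<le> 2 * sqrt (s - r)"
proof -
  define a b where "a = sqrt r" and "b = sqrt s"
  have ab: "0 \<le> a" "a \<le> b" using assms by (auto simp: a_def b_def)
  have e: "psi_sqrt s - psi_sqrt r = 2 * (b - a) / ((b + 1) * (a + 1))"
    using ab unfolding psi_sqrt_def a_def[symmetric] b_def[symmetric] by (simp add: field_simps)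
  have p: "1 * 1 \<le> (b + 1) * (a + 1)" using ab by (intro mult_mono) auto
  have "0 \<le> psi_sqrt s - psi_sqrt r" unfolding e using ab p by (intro divide_nonneg_nonneg) auto
  then show "psi_sqrt r \<le> psi_sqrt s" by simp
  have "2 * (b - a) / ((b + 1) * (a + 1)) \<le> 2 * (b - a) / 1"
    using ab p by (intro divide_left_mono) auto
  moreover have "b \<le> a + sqrt (s - r)"
    using sqrt_add_le_add_sqrt[of r "s - r"] assms by (simp add: a_def b_def)
  ultimately show "psi_sqrt s - psi_sqrt r \<le> 2 * sqrt (s - r)" unfolding e by simp
qed

text \<open>The ratio \<open>b / a\<close> rounded up to the grid of mesh \<open>1 / (2 t\<^sup>2)\<close>, for ratios up to \<open>t\<close>. It is written as a number of
  exceeded thresholds because each comparison asks whether a point lies in a subgraph, so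
  that the result depends on a density only through the trace of its subgraph.\<close>

definition level :: "nat \<Rightarrow> real \<Rightarrow> real \<Rightarrow> real" where
  "level t a b = (\<Sum>j<2*t^3. if real j * a / (2 * real t ^ 2) < b then 1 else 0) / (2 * real t ^ 2)"

lemma level_nonneg: "0 \<le> level t a b"
  unfolding level_def by (intro divide_nonneg_nonneg sum_nonneg) auto

lemma level_bounds:
  assumes a: "0 < a" and b: "0 \<le> b" and t: "1 \<le> t"
  shows "level t a b \<le> real t" "level t a b \<le> b / a + 1 / (2 * real t ^ 2)"
    "b \<le> real t * a \<Longrightarrow> b / a \<le> level t a b"
proof -
  define m where "m = 2 * t ^ 3"
  define e where "e = 1 / (2 * real t ^ 2)"
  have e: "0 < e" using t by (simp add: e_def)
  have me: "real m * e = real t" using t by (simp add: m_def e_def power2_eq_square power3_eq_cube)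
  define P where "P j \<longleftrightarrow> real j * e < b / a" for j :: nat
  have P: "(real j * a / (2 * real t ^ 2) < b) = P j" for j
    using a by (simp add: P_def e_def pos_less_divide_eq mult.commute)
  \<comment> \<open>The exceeded thresholds form an initial segment, and \<open>c\<close> is its length.\<close>
  define c where "c = (LEAST j. m \<le> j \<or> \<not> P j)"
  have c: "m \<le> c \<or> \<not> P c" unfolding c_def by (rule LeastI[of _ m]) simp
  have below: "j < m \<and> P j" if "j < c" for j
    using not_less_Least[of j "\<lambda>j. m \<le> j \<or> \<not> P j"] that unfolding c_def by auto
  have cm: "c \<le> m" unfolding c_def by (rule Least_le) simp
  have anti: "P i" if "P j" "i \<le> j" for i j
    using that e mult_right_mono[of "real i" "real j" e] unfolding P_def by linarith
  have S: "{j. j < m \<and> P j} = {..<c}"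
  proof (intro set_eqI iffI)
    fix j assume j: "j \<in> {j. j < m \<and> P j}"
    show "j \<in> {..<c}"
    proof (rule ccontr)
      assume "j \<notin> {..<c}"
      then show False using anti[of j c] j c by auto
    qed
  qed (use below in auto)
  have "(\<Sum>j<m. if P j then 1 else 0) = real (card {j. j < m \<and> P j})"
    by (simp add: sum.If_cases lessThan_def Int_def)
  then have lev: "level t a b = real c * e"
    unfolding level_def P m_def[symmetric] S by (simp add: e_def)
  show "level t a b \<le> real t" unfolding lev me[symmetric] using cm e by (intro mult_right_mono) auto
  show "level t a b \<le> b / a + 1 / (2 * real t ^ 2)"
  proof (cases "c = 0")
    case True
    then show ?thesis using a b by (simp add: lev)
  next
    case False
    then have "P (c - 1)" using below[of "c - 1"] by simp
    then have "(real c - 1) * e < b / a" using False by (simp add: P_def of_nat_diff)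
    then show ?thesis by (simp add: lev e_def[symmetric] algebra_simps)
  qed
  assume bt: "b \<le> real t * a"
  show "b / a \<le> level t a b"
  proof (cases "c = m")
    case True
    then show ?thesis using bt a me by (simp add: lev pos_divide_le_eq)
  next
    case False
    then have "\<not> P c" using c cm by auto
    then show ?thesis by (simp add: P_def lev)
  qed
qed

text \<open>A majorant of \<open>psi\<close> for the mixture of the \<open>f k\<close> relative to \<open>r\<close>, with grid weights \<open>c k / (2 K t\<^sup>3)\<close>. The
  set \<open>B\<close> collects the points at which the ratio of densities is not controlled.\<close>

definition discretized_psi ::
    "'a set \<Rightarrow> ('a \<Rightarrow> real) \<Rightarrow> nat \<Rightarrow> nat \<Rightarrow> (nat \<Rightarrow> nat) \<Rightarrow> (nat \<Rightarrow> 'a \<Rightarrow> real) \<Rightarrow> 'a \<Rightarrow> real" where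
  "discretized_psi B r t K c f x = (if x \<in> B \<or> (\<exists>k\<in>{1..K}. real t * r x < f k x) then 1
     else psi_sqrt (\<Sum>k=1..K. real (c k) / (2 * real K * real t ^ 3) * level t (r x) (f k x)))"

lemma discretized_psi_bounds: "\<bar>discretized_psi B r t K c f x\<bar> \<le> 1"
  unfolding discretized_psi_def
  by (auto intro!: psi_sqrt_bounds sum_nonneg mult_nonneg_nonneg divide_nonneg_nonneg level_nonneg)

lemma discretized_psi_measurable:
  assumes [measurable]: "B \<in> sets M" "r \<in> borel_measurable M"
    and f: "\<And>k. k \<in> {1..K} \<Longrightarrow> f k \<in> borel_measurable M"
  shows "discretized_psi B r t K c f \<in> borel_measurable M"
proof -
  have "{x\<in>space M. \<exists>k\<in>{1..K}. real t * r x < f k x} \<in> sets M"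
    using f by (intro sets.sets_Collect_finite_Ex borel_measurable_less) auto
  moreover have "{x\<in>space M. x \<in> B} \<in> sets M" by measurable
  ultimately have "{x\<in>space M. x \<in> B \<or> (\<exists>k\<in>{1..K}. real t * r x < f k x)} \<in> sets M"
    by (intro sets.sets_Collect_disj)
  moreover have "(\<lambda>x. level t (r x) (f k x)) \<in> borel_measurable M" if "k \<in> {1..K}" for k
  proof -
    have [measurable]: "f k \<in> borel_measurable M" by (rule f[OF that])
    show ?thesis unfolding level_def by measurable
  qed
  then have "(\<lambda>x. psi_sqrt (\<Sum>k=1..K. real (c k) / (2 * real K * real t ^ 3) * level t (r x) (f k x)))
      \<in> borel_measurable M"
    unfolding psi_sqrt_def
    by (intro borel_measurable_divide borel_measurable_diff borel_measurable_add borel_measurable_const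
        measurable_compose[OF _ borel_measurable_sqrt] borel_measurable_sum borel_measurable_times)
  ultimately show ?thesis
    unfolding discretized_psi_def[abs_def] by (intro measurable_If) auto
qed

definition ceil_weight :: "nat \<Rightarrow> nat \<Rightarrow> real \<Rightarrow> nat" where
  "ceil_weight K t w = nat \<lceil>w * (2 * real K * real t ^ 3)\<rceil>"

lemma ceil_weight_bounds:
  assumes "0 \<le> w" "w \<le> 1" "1 \<le> K" "1 \<le> t"
  shows "ceil_weight K t w \<le> 2 * K * t ^ 3"
    and "w \<le> real (ceil_weight K t w) / (2 * real K * real t ^ 3)"
    and "real (ceil_weight K t w) / (2 * real K * real t ^ 3) \<le> w + 1 / (2 * real K * real t ^ 3)"
proof -
  define D where "D = 2 * real K * real t ^ 3"
  have D: "0 < D" using assms by (simp add: D_def)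
  have wD: "0 \<le> w * D" "w * D \<le> D" using assms D by (auto intro: mult_left_le_one_le)
  have c: "real (ceil_weight K t w) = real_of_int \<lceil>w * D\<rceil>"
    using wD(1) unfolding ceil_weight_def D_def by simp
  have "real (ceil_weight K t w) \<le> real (2 * K * t ^ 3)"
  proof -
    have "\<lceil>w * D\<rceil> \<le> int (2 * K * t ^ 3)" using wD(2) by (simp add: ceiling_le_iff D_def)
    then show ?thesis unfolding c by linarith
  qed
  then show "ceil_weight K t w \<le> 2 * K * t ^ 3" by linarith
  have "w * D \<le> real (ceil_weight K t w)" unfolding c by simp
  then show "w \<le> real (ceil_weight K t w) / (2 * real K * real t ^ 3)"
    using D by (simp add: D_def[symmetric] pos_le_divide_eq)
  have "real (ceil_weight K t w) \<le> w * D + 1" unfolding c by linarith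
  then have "real (ceil_weight K t w) / D \<le> (w * D + 1) / D" using D by (intro divide_right_mono) auto
  then show "real (ceil_weight K t w) / (2 * real K * real t ^ 3) \<le> w + 1 / (2 * real K * real t ^ 3)"
    using D by (simp add: D_def[symmetric] add_divide_distrib)
qed

text \<open>Rounding the ratios changes the mixture ratio by at most \<open>1 / (2 t\<^sup>2)\<close> because the weights sum to 1. Rounding the weights
  adds at most \<open>K\<close> times the mesh \<open>1 / (2 K t\<^sup>3)\<close> times the largest ratio \<open>t\<close>, which is \<open>1 / (2 t\<^sup>2)\<close> again.\<close>

lemma discretized_psi_approx:
  assumes w: "w \<in> weights K" and K: "1 \<le> K" and t: "1 \<le> t"
    and r: "0 < r x" and f0: "\<And>k. k \<in> {1..K} \<Longrightarrow> 0 \<le> f k x"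
    and good: "x \<notin> B" "\<And>k. k \<in> {1..K} \<Longrightarrow> f k x \<le> real t * r x"
  defines "G \<equiv> discretized_psi B r t K (\<lambda>k. ceil_weight K t (w k)) f x"
  shows "psi_sqrt (mixture_density K w f x / r x) \<le> G"
    and "G \<le> psi_sqrt (mixture_density K w f x / r x) + 2 / real t"
proof -
  have w01: "0 \<le> w k" "w k \<le> 1" if "k \<in> {1..K}" for k using w that by (auto simp: weights_def)
  have wsum: "(\<Sum>k=1..K. w k) = 1" using w by (simp add: weights_def)
  define v where "v k = real (ceil_weight K t (w k)) / (2 * real K * real t ^ 3)" for k
  define l where "l k = level t (r x) (f k x)" for k
  define s where "s = (\<Sum>k=1..K. v k * l k)"
  define R where "R = mixture_density K w f x / r x"
  have G: "G = psi_sqrt s"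
  proof -
    have "\<not> (x \<in> B \<or> (\<exists>k\<in>{1..K}. real t * r x < f k x))" using good by (meson not_less)
    then show ?thesis unfolding G_def discretized_psi_def s_def v_def l_def by (simp only: if_False)
  qed
  have R: "R = (\<Sum>k=1..K. w k * (f k x / r x))"
    by (simp add: R_def mixture_density_def sum_divide_distrib)
  have R0: "0 \<le> R" unfolding R using w01 f0 r by (intro sum_nonneg mult_nonneg_nonneg) auto
  have Rs: "R \<le> s" unfolding R s_def v_def l_def
    using w01 f0 r K t good(2)
    by (intro sum_mono mult_mono ceil_weight_bounds level_bounds) (auto intro: order_trans[OF _ ceil_weight_bounds(2)])
  have "s \<le> (\<Sum>k=1..K. w k * (f k x / r x) + w k * (1 / (2 * real t ^ 2))
      + 1 / (2 * real K * real t ^ 3) * real t)"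
    unfolding s_def
  proof (rule sum_mono)
    fix k assume k: "k \<in> {1..K}"
    have "v k * l k \<le> (w k + 1 / (2 * real K * real t ^ 3)) * l k"
      unfolding v_def l_def using w01[OF k] K t by (intro mult_right_mono ceil_weight_bounds level_nonneg)
    also have "\<dots> = w k * l k + 1 / (2 * real K * real t ^ 3) * l k" by (simp add: distrib_right)
    also have "\<dots> \<le> w k * (f k x / r x + 1 / (2 * real t ^ 2)) + 1 / (2 * real K * real t ^ 3) * real t"
      unfolding l_def using w01[OF k] r f0[OF k] t by (intro add_mono mult_left_mono level_bounds) auto
    finally show "v k * l k \<le> w k * (f k x / r x) + w k * (1 / (2 * real t ^ 2))
        + 1 / (2 * real K * real t ^ 3) * real t" by (simp add: distrib_left)
  qed
  also have "\<dots> = R + 1 / (2 * real t ^ 2) + real K * (1 / (2 * real K * real t ^ 3) * real t)"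
    by (simp only: sum.distrib R[symmetric] sum_distrib_right[symmetric] wsum sum_constant) simp
  also have "real K * (1 / (2 * real K * real t ^ 3) * real t) = 1 / (2 * real t ^ 2)"
    using K t by (simp add: power2_eq_square power3_eq_cube)
  finally have sR: "s - R \<le> 1 / (real t)\<^sup>2" by (simp add: field_simps)
  show "psi_sqrt (mixture_density K w f x / r x) \<le> G"
    unfolding G R_def[symmetric] by (rule psi_sqrt_diff(1)[OF R0 Rs])
  have "sqrt (s - R) \<le> sqrt (1 / (real t)\<^sup>2)" using sR by (rule real_sqrt_le_mono)
  also have "\<dots> = 1 / real t" by (simp add: real_sqrt_divide)
  finally show "G \<le> psi_sqrt (mixture_density K w f x / r x) + 2 / real t"
    unfolding G R_def[symmetric] using psi_sqrt_diff(2)[OF R0 Rs] by simp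
qed

text \<open>The values on the points are a function of the \<open>K\<close> grid weights and of the traces of the \<open>K\<close> subgraphs on a set of
  at most \<open>2 n (2 t\<^sup>3 + 1) \<le> 6 t\<^sup>4 V\<close> points of the product space.\<close>

lemma discretized_psi_patterns:
  fixes r :: "'a \<Rightarrow> real" and B :: "'a set"
  assumes ns: "no_shattered \<Omega> \<F> V" and V: "1 \<le> V" and t: "1 \<le> t" "n \<le> t * V"
    and z: "z \<in> {1..n+n} \<rightarrow> \<Omega>"
    and D: "\<And>c f k. (c, f) \<in> \<D> \<Longrightarrow> k \<in> {1..K} \<Longrightarrow> c k \<le> 2 * K * t ^ 3 \<and> f k \<in> \<F>"
  defines "Pat \<equiv> (\<lambda>(c, f). \<lambda>i\<in>{1..n+n}. discretized_psi B r t K c f (z i)) ` \<D>"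
  shows "finite Pat"
    and "real (card Pat) \<le> (2 * real K * real t ^ 3 + 1) ^ K * ((6 * exp 1 * real t ^ 4) ^ V) ^ K"
proof -
  define pt where "pt i j = (z i, real j * r (z i) / (2 * real t ^ 2))" for i j :: nat
  define Pts where "Pts = (\<lambda>(i, j). pt i j) ` ({1..n+n} \<times> {0..2*t^3})"
  define Tr where "Tr = (\<lambda>S. S \<inter> Pts) ` subgraphs \<Omega> \<F>"
  \<comment> \<open>The function that recovers the values of the majorant from the rounded weights and the traces.\<close>
  define \<Phi> where "\<Phi> = (\<lambda>(c :: nat \<Rightarrow> nat, S). \<lambda>i\<in>{1..n+n}. if z i \<in> B \<or> (\<exists>k\<in>{1..K}. pt i (2*t^3) \<in> S k) then 1
     else psi_sqrt (\<Sum>k=1..K. real (c k) / (2 * real K * real t ^ 3)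
       * ((\<Sum>j<2*t^3. if pt i j \<in> S k then 1 else 0) / (2 * real t ^ 2))))"
  have finP: "finite Pts" unfolding Pts_def by simp
  have PO: "Pts \<subseteq> \<Omega> \<times> UNIV" using z by (auto simp: Pts_def pt_def)
  have "card Pts \<le> (n + n) * (2 * t ^ 3 + 1)"
    unfolding Pts_def by (rule order_trans[OF card_image_le]) (auto simp: card_cartesian_product)
  also have "\<dots> \<le> (2 * (t * V)) * (3 * t ^ 3)" using t by (intro mult_mono) auto
  also have "\<dots> = 6 * t ^ 4 * V" by (simp add: power3_eq_cube power4_eq_xxxx)
  finally have cP: "card Pts \<le> 6 * t ^ 4 * V" .
  have "1 \<le> 6 * t ^ 4" using t by simp
  then have VN: "V \<le> 6 * t ^ 4 * V" by simp
  have "real (card Tr) \<le> (exp 1 * real (6 * t ^ 4 * V) / real V) ^ V"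
    unfolding Tr_def by (rule card_subgraph_traces_le[OF ns V VN finP PO cP])
  also have "\<dots> = (6 * exp 1 * real t ^ 4) ^ V" using V by (simp add: ac_simps)
  finally have cT: "real (card Tr) \<le> (6 * exp 1 * real t ^ 4) ^ V" .
  have finT: "finite Tr" unfolding Tr_def using finP by (auto intro: finite_subset[of _ "Pow Pts"])
  define Dom where "Dom = (PiE {1..K} (\<lambda>_. {0..2*K*t^3})) \<times> (PiE {1..K} (\<lambda>_. Tr))"
  have finD: "finite Dom" unfolding Dom_def using finT by (intro finite_cartesian_product finite_PiE) auto
  have sub: "Pat \<subseteq> \<Phi> ` Dom"
  proof
    fix g assume "g \<in> Pat"
    then obtain c f where cf: "(c, f) \<in> \<D>" "g = (\<lambda>i\<in>{1..n+n}. discretized_psi B r t K c f (z i))"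
      unfolding Pat_def by auto
    define S where "S k = {(x, s). x \<in> \<Omega> \<and> s < f k x} \<inter> Pts" for k
    have pS: "pt i j \<in> S k \<longleftrightarrow> real j * r (z i) / (2 * real t ^ 2) < f k (z i)"
      if "i \<in> {1..n+n}" "j \<in> {0..2*t^3}" for i j k
      using that z by (auto simp: S_def pt_def Pts_def)
    have top: "real (2*t^3) * a / (2 * real t ^ 2) = real t * a" for a :: real
      using t by (simp add: power2_eq_square power3_eq_cube)
    have "g = \<Phi> (restrict c {1..K}, restrict S {1..K})"
    proof (rule ext)
      fix i
      show "g i = \<Phi> (restrict c {1..K}, restrict S {1..K}) i"
      proof (cases "i \<in> {1..n+n}")
        case True
        have b: "(\<exists>k\<in>{1..K}. pt i (2*t^3) \<in> restrict S {1..K} k) \<longleftrightarrow> (\<exists>k\<in>{1..K}. real t * r (z i) < f k (z i))"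
          using pS[OF True, of "2*t^3"] unfolding top by auto
        have s: "(\<Sum>j<2*t^3. if pt i j \<in> restrict S {1..K} k then 1 else 0) / (2 * real t ^ 2)
            = level t (r (z i)) (f k (z i))" if "k \<in> {1..K}" for k
          unfolding level_def using that pS[OF True]
          by (intro arg_cong2[where f="(/)"] sum.cong refl) auto
        have "(\<Sum>k=1..K. real (restrict c {1..K} k) / (2 * real K * real t ^ 3)
             * ((\<Sum>j<2*t^3. if pt i j \<in> restrict S {1..K} k then 1 else 0) / (2 * real t ^ 2)))
          = (\<Sum>k=1..K. real (c k) / (2 * real K * real t ^ 3) * level t (r (z i)) (f k (z i)))"
          using s by (intro sum.cong refl) simp
        then show ?thesis
          using True b unfolding cf(2) \<Phi>_def discretized_psi_def by (simp only: restrict_apply prod.case if_True)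
      next
        case False
        then show ?thesis unfolding cf(2) \<Phi>_def by (simp only: restrict_apply prod.case if_False)
      qed
    qed
    moreover have "(restrict c {1..K}, restrict S {1..K}) \<in> Dom"
    proof -
      have "S k \<in> Tr" if "k \<in> {1..K}" for k
        using D[OF cf(1) that] unfolding Tr_def S_def subgraphs_def by auto
      moreover have "c k \<in> {0..2*K*t^3}" if "k \<in> {1..K}" for k using D[OF cf(1) that] by simp
      ultimately show ?thesis unfolding Dom_def by auto
    qed
    ultimately show "g \<in> \<Phi> ` Dom" by blast
  qed
  show "finite Pat" using sub finD by (meson finite_imageI finite_subset)
  have "card Pat \<le> card Dom"
    using sub finD by (meson card_image_le card_mono finite_imageI order_trans)
  also have "card Dom = (2*K*t^3 + 1) ^ K * card Tr ^ K"
    unfolding Dom_def by (simp add: card_cartesian_product card_PiE)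
  finally have "real (card Pat) \<le> real ((2*K*t^3 + 1) ^ K * card Tr ^ K)" by (simp only: of_nat_le_iff)
  also have "\<dots> = (2 * real K * real t ^ 3 + 1) ^ K * real (card Tr) ^ K"
    by (simp add: add.commute)
  also have "\<dots> \<le> (2 * real K * real t ^ 3 + 1) ^ K * ((6 * exp 1 * real t ^ 4) ^ V) ^ K"
    using cT by (intro mult_left_mono power_mono) auto
  finally show "real (card Pat) \<le> (2 * real K * real t ^ 3 + 1) ^ K * ((6 * exp 1 * real t ^ 4) ^ V) ^ K" .
qed

text \<open>Here \<open>x\<close>, \<open>y\<close>, \<open>z\<close> are the square roots of the densities of \<open>q\<close>, \<open>r\<close> and \<open>P\<close>, and \<open>g\<close> is the value of the test
  function. In the well-specified case \<open>z = y\<close> one has \<open>y\<^sup>2 g \<le> (x\<^sup>2 - y\<^sup>2) / 4 - (x - y)\<^sup>2 / 4\<close>, which amounts to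
  \<open>g\<^sup>3 \<le> g\<^sup>2\<close>; the first term integrates to 0. Replacing \<open>y\<close> by \<open>z\<close> costs a small part of \<open>(x - y)\<^sup>2\<close> and a
  multiple of \<open>(z - y)\<^sup>2\<close>. Multiplying the second hypothesis out, instead of dividing, includes the case \<open>x = y = 0\<close>.\<close>

lemma drift_inequality_good:
  fixes x y z g :: real
  assumes nn: "0 \<le> x" "0 \<le> y" and g: "\<bar>g\<bar> \<le> 1" "g * (x + y) = x - y"
  shows "z\<^sup>2 * (g + g\<^sup>2 / 32) \<le> (x\<^sup>2 - y\<^sup>2) / 4 - (z - x)\<^sup>2 / 32 + 10 * (z - y)\<^sup>2"
proof -
  define h where "h = x + y"
  define d where "d = z - y"
  define e where "e = x - y"
  have eh: "e = g * h" using g(2) by (simp add: e_def h_def)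
  have y: "y = h * (1 - g) / 2" using eh by (simp add: e_def h_def algebra_simps)
  have x: "x = h * (1 + g) / 2" using eh by (simp add: e_def h_def algebra_simps)
  have g1: "g \<le> 1" using g(1) by simp
  have main: "y\<^sup>2 * g \<le> (x\<^sup>2 - y\<^sup>2) / 4 - e\<^sup>2 / 4"
  proof -
    have "0 \<le> h\<^sup>2 * (g\<^sup>2 * (1 - g)) / 4" using g1 by simp
    also have "\<dots> = (x\<^sup>2 - y\<^sup>2) / 4 - e\<^sup>2 / 4 - y\<^sup>2 * g"
      unfolding x y eh by (simp add: power2_eq_square field_simps)
    finally show ?thesis by simp
  qed
  have yg: "(y * g)\<^sup>2 \<le> e\<^sup>2"
  proof -
    have "y\<^sup>2 \<le> h\<^sup>2" using nn by (intro power_mono) (auto simp: h_def)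
    then have "y\<^sup>2 * g\<^sup>2 \<le> h\<^sup>2 * g\<^sup>2" by (rule mult_right_mono) simp
    then show ?thesis by (simp add: eh power_mult_distrib mult.commute)
  qed
  have cross: "2 * (y * g) * d \<le> (y * g)\<^sup>2 / 8 + 8 * d\<^sup>2"
  proof -
    have "0 \<le> (y * g - 8 * d)\<^sup>2" by simp
    then show ?thesis by (simp add: power2_eq_square algebra_simps)
  qed
  have gd: "d\<^sup>2 * g \<le> d\<^sup>2" using g1 mult_left_mono[of g 1 "d\<^sup>2"] by simp
  have "z\<^sup>2 * g = y\<^sup>2 * g + 2 * (y * g) * d + d\<^sup>2 * g"
    by (simp add: d_def power2_eq_square algebra_simps)
  then have one: "z\<^sup>2 * g \<le> (x\<^sup>2 - y\<^sup>2) / 4 - e\<^sup>2 / 8 + 9 * d\<^sup>2"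
    using main cross yg gd by argo
  have two: "z\<^sup>2 * g\<^sup>2 \<le> 2 * e\<^sup>2 + 2 * d\<^sup>2"
  proof -
    have "(z * g)\<^sup>2 \<le> 2 * (y * g)\<^sup>2 + 2 * (d * g)\<^sup>2"
    proof -
      have "0 \<le> (y * g - d * g)\<^sup>2" by simp
      moreover have "z = y + d" by (simp add: d_def)
      ultimately show ?thesis by (simp add: power2_eq_square algebra_simps)
    qed
    moreover have "(d * g)\<^sup>2 \<le> d\<^sup>2"
      using g(1) abs_square_le_1[of g] mult_left_mono[of "g\<^sup>2" 1 "d\<^sup>2"] by (simp add: power_mult_distrib)
    ultimately show ?thesis using yg by (simp add: power_mult_distrib)
  qed
  have three: "(z - x)\<^sup>2 \<le> 2 * d\<^sup>2 + 2 * e\<^sup>2"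
  proof -
    have zx: "z - x = d - e" by (simp add: d_def e_def)
    have "0 \<le> (d + e)\<^sup>2" by simp
    then show ?thesis unfolding zx by (simp add: power2_eq_square algebra_simps)
  qed
  have "0 \<le> d\<^sup>2" "z\<^sup>2 * (g + g\<^sup>2 / 32) = z\<^sup>2 * g + z\<^sup>2 * g\<^sup>2 / 32" by (simp_all add: algebra_simps)
  then show ?thesis unfolding d_def[symmetric] using one two three by argo
qed

text \<open>Where the majorant equals 1 there is no cancellation, and the mass of \<open>P\<close> is bounded by that of \<open>r\<close> and by the
  squared difference of the roots. The right-hand side keeps the form of the previous lemma so that both can be
  integrated together.\<close>

lemma drift_inequality_bad:
  fixes x y z :: real
  assumes "0 \<le> x" "0 \<le> z"
  shows "z\<^sup>2 * (1 + 1 / 32) \<le> (x\<^sup>2 - y\<^sup>2) / 4 - (z - x)\<^sup>2 / 32 + 10 * (z - y)\<^sup>2 + 5 * y\<^sup>2"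
proof -
  have "(z - x)\<^sup>2 \<le> z\<^sup>2 + x\<^sup>2" using assms by (simp add: power2_diff)
  moreover have "z\<^sup>2 \<le> 2 * (z - y)\<^sup>2 + 2 * y\<^sup>2"
    using square_diff_le_double[of z 0 y] by simp
  moreover have "0 \<le> x\<^sup>2" "0 \<le> y\<^sup>2" "0 \<le> (z - y)\<^sup>2" by simp_all
  ultimately show ?thesis by argo
qed

text \<open>Integrated form of the two drift inequalities. On the bad set outside \<open>B\<close> some \<open>f k\<close> exceeds \<open>t r\<close>, so that \<open>r\<close> is
  at most \<open>\<Sum> f k / t\<close>, whose integral is \<open>K / t\<close>; on \<open>B\<close> the density \<open>r\<close> vanishes almost everywhere.\<close>

lemma discretized_psi_drift:
  assumes sf: "sigma_finite_measure \<mu>" and P: "prob_space P" "sets P = sets \<mu>"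
    and q: "q \<in> prob_densities \<mu>" and r: "r \<in> prob_densities \<mu>"
    and f: "\<And>k. k \<in> {1..K} \<Longrightarrow> f k \<in> prob_densities \<mu>"
    and w: "w \<in> weights K" and K: "1 \<le> K" and t: "1 \<le> t"
    and B: "B \<in> sets \<mu>" "AE x in \<mu>. x \<in> B \<longrightarrow> r x = 0"
    and off: "\<And>x. x \<in> space \<mu> \<Longrightarrow> x \<notin> B \<Longrightarrow> 0 < r x \<and> q x = mixture_density K w f x"
  defines "G \<equiv> discretized_psi B r t K (\<lambda>k. ceil_weight K t (w k)) f"
  shows "(\<integral>x. G x + (G x)\<^sup>2 / 32 \<partial>P) \<le> - hellinger2 P (dens_measure \<mu> q) / 16
     + 20 * hellinger2 P (dens_measure \<mu> r) + (5 * real K + 4) / real t"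
    and "\<And>x. x \<in> space \<mu> \<Longrightarrow> psi (sqrt_ratio (q x) (r x)) \<le> G x"
proof -
  have nnq: "0 \<le> q x" "0 \<le> r x" if "x \<in> space \<mu>" for x using q r that by (auto simp: prob_densities_def)
  have nnf: "0 \<le> f k x" if "k \<in> {1..K}" "x \<in> space \<mu>" for k x
    using f[OF that(1)] that(2) by (auto simp: prob_densities_def)
  have mq: "q \<in> borel_measurable \<mu>" "r \<in> borel_measurable \<mu>" using q r by (auto simp: prob_densities_def)
  have mf: "f k \<in> borel_measurable \<mu>" if "k \<in> {1..K}" for k using f[OF that] by (auto simp: prob_densities_def)
  have G1: "\<bar>G x\<bar> \<le> 1" for x unfolding G_def by (rule discretized_psi_bounds)
  have mG: "G \<in> borel_measurable \<mu>"
    unfolding G_def using B mq mf by (intro discretized_psi_measurable) auto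
  define bad where "bad x \<longleftrightarrow> x \<in> B \<or> (\<exists>k\<in>{1..K}. real t * r x < f k x)" for x
  define g where "g x = psi (sqrt_ratio (q x) (r x))" for x
  have Gbad: "G x = 1" if "bad x" for x
    using that unfolding G_def discretized_psi_def bad_def by auto
  have g1: "\<bar>g x\<bar> \<le> 1" and gxy: "g x * (sqrt (q x) + sqrt (r x)) = sqrt (q x) - sqrt (r x)"
    if "x \<in> space \<mu>" for x
  proof -
    note nn = nnq[OF that]
    show "g x * (sqrt (q x) + sqrt (r x)) = sqrt (q x) - sqrt (r x)"
      unfolding g_def psi_sqrt_ratio[OF nn] by (cases "sqrt (q x) + sqrt (r x) = 0") (use nn in \<open>simp_all add: add_nonneg_eq_0_iff\<close>)
    show "\<bar>g x\<bar> \<le> 1" unfolding g_def by (rule psi_sqrt_ratio_bounds[OF nn])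
  qed
  have good: "g x \<le> G x" "G x \<le> g x + 2 / real t" if "x \<in> space \<mu>" "\<not> bad x" for x
  proof -
    have le: "f k x \<le> real t * r x" if "k \<in> {1..K}" for k
      using \<open>\<not> bad x\<close> that by (auto simp: bad_def not_less)
    have xB: "x \<notin> B" using \<open>\<not> bad x\<close> by (auto simp: bad_def)
    note o = off[OF that(1) xB]
    have "g x = psi_sqrt (mixture_density K w f x / r x)"
      using o unfolding g_def by (simp add: psi_def sqrt_ratio_def psi_sqrt_def)
    then show "g x \<le> G x" "G x \<le> g x + 2 / real t"
      using discretized_psi_approx[where B=B and r=r and x=x and f=f, OF w K t _ _ xB le] o nnf[OF _ that(1)]
      unfolding G_def by auto
  qed
  show "psi (sqrt_ratio (q x) (r x)) \<le> G x" if "x \<in> space \<mu>" for x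
    using good(1)[OF that] Gbad[of x] g1[OF that] unfolding g_def[symmetric] by (cases "bad x") auto
  obtain \<nu> s p where *: "sigma_finite_measure \<nu>" "sets \<nu> = sets \<mu>" "s \<in> borel_measurable \<nu>"
    "\<And>x. 0 \<le> s x" "\<mu> = dens_measure \<nu> s" "p \<in> prob_densities \<nu>" "\<And>x. 0 \<le> p x" "P = dens_measure \<nu> p"
    using common_dominating_measure[OF sf P] by metis
  have sp: "space \<nu> = space \<mu>" using *(2) by (rule sets_eq_imp_space_eq)
  have cd: "(\<lambda>x. s x * a x) \<in> prob_densities \<nu>" "dens_measure \<mu> a = dens_measure \<nu> (\<lambda>x. s x * a x)"
    if "a \<in> prob_densities \<mu>" for a
    using prob_densities_change_measure[OF *(3,4), of a] that unfolding *(5) by auto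
  note q' = cd[OF q] and r' = cd[OF r]
  have mG': "G \<in> borel_measurable \<nu>" using mG *(2) by (simp cong: measurable_cong_sets)
  define L where "L x = G x + (G x)\<^sup>2 / 32" for x
  have mL: "L \<in> borel_measurable \<nu>" using mG' by (simp add: L_def[abs_def])
  have L1: "\<bar>L x\<bar> \<le> 33 / 32" for x
  proof -
    have "(G x)\<^sup>2 \<le> 1" using G1[of x] by (simp add: abs_square_le_1)
    then show ?thesis using G1[of x] zero_le_power2[of "G x"] unfolding L_def abs_le_iff by linarith
  qed
  note iL = prob_densities_bounded_product[OF *(6) mL L1]
  note ip = prob_densities_integral[OF *(6)] and iq = prob_densities_integral[OF q'(1)]
    and ir = prob_densities_integral[OF r'(1)]
  have if': "integrable \<nu> (\<lambda>x. s x * f k x)" "(\<integral>x. s x * f k x \<partial>\<nu>) = 1" if "k \<in> {1..K}" for k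
    using prob_densities_integral[OF cd(1)[OF f[OF that]]] by auto
  note hq = hellinger2_le_L1(1)[OF *(1) *(6) q'(1)] and hr = hellinger2_le_L1(1)[OF *(1) *(6) r'(1)]
  define U where "U x = (s x * q x - s x * r x) / 4 - (sqrt (p x) - sqrt (s x * q x))\<^sup>2 / 32
    + 10 * (sqrt (p x) - sqrt (s x * r x))\<^sup>2 + 5 / real t * (\<Sum>k=1..K. s x * f k x) + 4 / real t * p x" for x
  have iU: "integrable \<nu> U"
    unfolding U_def using ip iq ir hq hr if'
    by (intro Bochner_Integration.integrable_add Bochner_Integration.integrable_diff
      integrable_mult_right integrable_divide Bochner_Integration.integrable_sum) auto
  \<comment> \<open>The hypothesis on \<open>B\<close> holds almost everywhere for \<open>\<mu>\<close> only; where \<open>s\<close> vanishes, so does \<open>s r\<close>.\<close>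
  have AEB: "AE x in \<nu>. 0 < s x \<longrightarrow> x \<in> B \<longrightarrow> r x = 0"
    using B(2) *(3) unfolding *(5) by (simp add: AE_density)
  have "(\<integral>x. L x \<partial>P) = (\<integral>x. p x * L x \<partial>\<nu>)" unfolding *(8) by (rule iL(2))
  also have "\<dots> \<le> (\<integral>x. U x \<partial>\<nu>)"
  proof (rule integral_mono_AE[OF iL(1) iU])
    show "AE x in \<nu>. p x * L x \<le> U x"
      using AEB AE_space
    proof eventually_elim
      case (elim x)
      then have x: "x \<in> space \<mu>" using sp by simp
      note nn = nnq[OF x]
      define X Y Z where "X = sqrt (s x * q x)" and "Y = sqrt (s x * r x)" and "Z = sqrt (p x)"
      have XYZ: "X\<^sup>2 = s x * q x" "Y\<^sup>2 = s x * r x" "Z\<^sup>2 = p x" "0 \<le> X" "0 \<le> Y" "0 \<le> Z"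
        using nn *(4)[of x] *(7)[of x] by (auto simp: X_def Y_def Z_def)
      have S0: "0 \<le> (\<Sum>k=1..K. s x * f k x)"
        using nnf x *(4) by (intro sum_nonneg mult_nonneg_nonneg) auto
      have U: "U x = (X\<^sup>2 - Y\<^sup>2) / 4 - (Z - X)\<^sup>2 / 32 + 10 * (Z - Y)\<^sup>2
          + 5 / real t * (\<Sum>k=1..K. s x * f k x) + 4 / real t * Z\<^sup>2"
        unfolding U_def X_def[symmetric] Y_def[symmetric] Z_def[symmetric] XYZ ..
      show "p x * L x \<le> U x"
      proof (cases "bad x")
        case True
        have Y: "Y\<^sup>2 \<le> 1 / real t * (\<Sum>k=1..K. s x * f k x)"
        proof (cases "x \<in> B")
          case True
          then have "s x * r x = 0" using elim(1) *(4)[of x] by (cases "s x = 0") auto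
          then have "Y\<^sup>2 = 0" using XYZ(2) by simp
          moreover have "0 \<le> 1 / real t * (\<Sum>k=1..K. s x * f k x)"
            using S0 by (intro mult_nonneg_nonneg) auto
          ultimately show ?thesis by simp
        next
          case False
          then obtain k where k: "k \<in> {1..K}" "real t * r x < f k x" using True by (auto simp: bad_def)
          have "real t * Y\<^sup>2 = s x * (real t * r x)" by (simp add: XYZ)
          also have "\<dots> \<le> s x * f k x" using k *(4) by (intro mult_left_mono) auto
          also have "\<dots> \<le> (\<Sum>k=1..K. s x * f k x)"
            using k nnf x *(4) by (intro member_le_sum) auto
          finally show ?thesis using t by (simp add: field_simps)
        qed
        have "p x * L x = Z\<^sup>2 * (1 + 1 / 32)" using Gbad[OF True] by (simp add: L_def XYZ)
        also have "\<dots> \<le> (X\<^sup>2 - Y\<^sup>2) / 4 - (Z - X)\<^sup>2 / 32 + 10 * (Z - Y)\<^sup>2 + 5 * Y\<^sup>2"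
          by (rule drift_inequality_bad[OF XYZ(4,6)])
        also have "\<dots> \<le> U x"
        proof -
          have "5 * Y\<^sup>2 \<le> 5 / real t * (\<Sum>k=1..K. s x * f k x)" using Y by simp
          moreover have "0 \<le> 4 / real t * Z\<^sup>2" by simp
          ultimately show ?thesis unfolding U by linarith
        qed
        finally show ?thesis .
      next
        case False
        note gd = good[OF x False]
        have "G x + (G x)\<^sup>2 / 32 \<le> g x + (g x)\<^sup>2 / 32 + 4 / real t"
        proof -
          have "(G x)\<^sup>2 - (g x)\<^sup>2 = (G x - g x) * (G x + g x)" by (simp add: power2_eq_square algebra_simps)
          also have "\<dots> \<le> (G x - g x) * 2" using gd(1) G1[of x] g1[OF x] by (intro mult_left_mono) auto
          finally have "(G x)\<^sup>2 \<le> (g x)\<^sup>2 + 2 * (G x - g x)" by simp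
          then have "G x + (G x)\<^sup>2 / 32 \<le> g x + (g x)\<^sup>2 / 32 + 17 / 16 * (G x - g x)" by argo
          also have "\<dots> \<le> g x + (g x)\<^sup>2 / 32 + 17 / 16 * (2 / real t)" using gd(2) by simp
          also have "\<dots> \<le> g x + (g x)\<^sup>2 / 32 + 4 / real t" using t by (simp add: field_simps)
          finally show ?thesis .
        qed
        then have "p x * L x \<le> Z\<^sup>2 * (g x + (g x)\<^sup>2 / 32 + 4 / real t)"
          unfolding XYZ(3) L_def using *(7) by (intro mult_left_mono) auto
        also have "\<dots> = Z\<^sup>2 * (g x + (g x)\<^sup>2 / 32) + 4 / real t * Z\<^sup>2" by (simp add: algebra_simps)
        also have "Z\<^sup>2 * (g x + (g x)\<^sup>2 / 32) \<le> (X\<^sup>2 - Y\<^sup>2) / 4 - (Z - X)\<^sup>2 / 32 + 10 * (Z - Y)\<^sup>2"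
        proof (rule drift_inequality_good[OF XYZ(4,5) g1[OF x]])
          have "g x * (X + Y) = sqrt (s x) * (g x * (sqrt (q x) + sqrt (r x)))"
            by (simp add: X_def Y_def real_sqrt_mult algebra_simps)
          then show "g x * (X + Y) = X - Y"
            unfolding gxy[OF x] by (simp add: X_def Y_def real_sqrt_mult algebra_simps)
        qed
        finally have "p x * L x \<le> (X\<^sup>2 - Y\<^sup>2) / 4 - (Z - X)\<^sup>2 / 32 + 10 * (Z - Y)\<^sup>2 + 4 / real t * Z\<^sup>2"
          by simp
        moreover have "0 \<le> 5 / real t * (\<Sum>k=1..K. s x * f k x)"
          using S0 by (intro mult_nonneg_nonneg) auto
        ultimately show ?thesis unfolding U by linarith
      qed
    qed
  qed
  also have "(\<integral>x. U x \<partial>\<nu>) = - (\<integral>x. (sqrt (p x) - sqrt (s x * q x))\<^sup>2 \<partial>\<nu>) / 32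
      + 10 * (\<integral>x. (sqrt (p x) - sqrt (s x * r x))\<^sup>2 \<partial>\<nu>) + 5 / real t * real K + 4 / real t"
  proof -
    have "(\<integral>x. (\<Sum>k=1..K. s x * f k x) \<partial>\<nu>) = real K"
      using if' by (subst Bochner_Integration.integral_sum) auto
    moreover have "integrable \<nu> (\<lambda>x. \<Sum>k=1..K. s x * f k x)"
      using if' by (intro Bochner_Integration.integrable_sum) auto
    ultimately show ?thesis unfolding U_def using ip iq ir hq hr by simp
  qed
  also have "\<dots> = - hellinger2 P (dens_measure \<mu> q) / 16
     + 20 * hellinger2 P (dens_measure \<mu> r) + (5 * real K + 4) / real t"
    unfolding *(8) q'(2) r'(2) hellinger2_density[OF *(1) *(6) q'(1)] hellinger2_density[OF *(1) *(6) r'(1)]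
    by (simp add: add_divide_distrib)
  finally show "(\<integral>x. G x + (G x)\<^sup>2 / 32 \<partial>P) \<le> - hellinger2 P (dens_measure \<mu> q) / 16
     + 20 * hellinger2 P (dens_measure \<mu> r) + (5 * real K + 4) / real t" unfolding L_def .
qed

section \<open>Uniform deviations of the test statistic\<close>

lemma psi_sqrt_ratio_swap:
  assumes "0 \<le> a" "0 \<le> b"
  shows "psi (sqrt_ratio a b) = - psi (sqrt_ratio b a)"
  unfolding psi_sqrt_ratio[OF assms] psi_sqrt_ratio[OF assms(2,1)]
  by (simp add: minus_divide_left add.commute)

lemma T_stat_swap:
  assumes "\<And>i. i \<in> {1..n} \<Longrightarrow> 0 \<le> q (x i)" "\<And>i. i \<in> {1..n} \<Longrightarrow> 0 \<le> r (x i)"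
  shows "T_stat n x q r = - T_stat n x r q"
  unfolding T_stat_def sum_negf[symmetric] using assms
  by (intro sum.cong refl psi_sqrt_ratio_swap) auto

lemma T_stat_le:
  assumes "\<And>i. i \<in> {1..n} \<Longrightarrow> 0 \<le> q (x i)" "\<And>i. i \<in> {1..n} \<Longrightarrow> 0 \<le> r (x i)"
  shows "T_stat n x q r \<le> real n"
proof -
  have "T_stat n x q r \<le> (\<Sum>i=1..n. 1)"
    unfolding T_stat_def using assms psi_sqrt_ratio_bounds by (intro sum_mono) (auto simp: abs_le_iff)
  then show ?thesis by simp
qed

text \<open>Purely deterministic: \<open>dev\<close> bounds the criterion of \<open>r\<close> from above by \<open>A + pen r\<close> and, through the
  antisymmetry of the statistic, that of \<open>q\<close> from below by \<open>h q - A - pen r\<close>.\<close>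

lemma near_minimizer_bound:
  assumes nn: "\<And>q i. q \<in> \<Q> \<Longrightarrow> i \<in> {1..n} \<Longrightarrow> 0 \<le> q (x i)"
    and pen: "\<And>q. q \<in> \<Q> \<Longrightarrow> 0 \<le> pen q" and h: "\<And>q. q \<in> \<Q> \<Longrightarrow> 0 \<le> h q"
    and r: "r \<in> \<Q>" and dev: "\<And>q. q \<in> \<Q> \<Longrightarrow> T_stat n x r q \<le> A - h q + pen q"
    and q: "q \<in> \<Q>" "Upsilon n \<Q> pen x q < (INF q'\<in>\<Q>. Upsilon n \<Q> pen x q') + e"
  shows "h q \<le> 2 * A + 2 * pen r + e"
proof -
  have bdd: "bdd_above ((\<lambda>q'. T_stat n x p q' - pen q') ` \<Q>)" if "p \<in> \<Q>" for p
  proof (rule bdd_aboveI2)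
    fix q' assume "q' \<in> \<Q>"
    then show "T_stat n x p q' - pen q' \<le> real n"
      using T_stat_le[of n p x q'] nn pen that by fastforce
  qed
  have low: "T_stat n x p q' - pen q' + pen p \<le> Upsilon n \<Q> pen x p" if "p \<in> \<Q>" "q' \<in> \<Q>" for p q'
    unfolding Upsilon_def using that by (intro add_right_mono cSUP_upper bdd) auto
  have "0 \<le> Upsilon n \<Q> pen x p" if "p \<in> \<Q>" for p
    using low[OF that that] T_stat_swap[of n p x p] nn that by fastforce
  then have "(INF q'\<in>\<Q>. Upsilon n \<Q> pen x q') \<le> Upsilon n \<Q> pen x r"
    using r by (intro cINF_lower bdd_belowI2) auto
  also have "Upsilon n \<Q> pen x r \<le> A + pen r"
    unfolding Upsilon_def
  proof (intro add_right_mono cSUP_least)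
    fix q' assume "q' \<in> \<Q>"
    then show "T_stat n x r q' - pen q' \<le> A" using dev[of q'] h[of q'] by linarith
  qed (use r in auto)
  finally have "Upsilon n \<Q> pen x q < A + pen r + e" using q(2) by linarith
  moreover have "T_stat n x q r = - T_stat n x r q" using nn q(1) r by (intro T_stat_swap) auto
  ultimately show ?thesis using low[OF q(1) r] dev[OF q(1)] by linarith
qed

lemma T_stat_measurable:
  assumes P: "sets P = sets \<mu>" and q: "q \<in> prob_densities \<mu>" and r: "r \<in> prob_densities \<mu>"
  shows "(\<lambda>x. T_stat n x q r) \<in> borel_measurable (Pi\<^sub>M {1..n} (\<lambda>_. P))"
proof -
  have mq: "q \<in> borel_measurable P" "r \<in> borel_measurable P"
    using q r P by (auto simp: prob_densities_def cong: measurable_cong_sets)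
  have sp: "space P = space \<mu>" using P by (rule sets_eq_imp_space_eq)
  have "(\<lambda>y. psi (sqrt_ratio (r y) (q y))) \<in> borel_measurable P"
  proof (subst measurable_cong)
    fix y assume "y \<in> space P"
    then show "psi (sqrt_ratio (r y) (q y)) = (sqrt (r y) - sqrt (q y)) / (sqrt (r y) + sqrt (q y))"
      using q r sp by (intro psi_sqrt_ratio) (auto simp: prob_densities_def)
  qed (use mq in measurable)
  then show ?thesis
    unfolding T_stat_def
    by (intro borel_measurable_sum measurable_compose[OF measurable_component_singleton])
qed

lemma mixtures_densityE:
  assumes "Q \<in> mixtures \<mu> K (dens_measure \<mu> ` \<F>bar)" and Fbar: "\<F>bar \<subseteq> prob_densities \<mu>"
  obtains w f where "w \<in> weights K" "\<forall>k\<in>{1..K}. f k \<in> \<F>bar"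
    "Q = dens_measure \<mu> (mixture_density K w f)"
proof -
  obtain w F where w: "w \<in> weights K" "\<forall>k\<in>{1..K}. F k \<in> dens_measure \<mu> ` \<F>bar"
    and e: "Q = mixture \<mu> K w F"
    using assms(1) by (auto simp: mixtures_def)
  have "\<forall>k\<in>{1..K}. \<exists>f. f \<in> \<F>bar \<and> F k = dens_measure \<mu> f" using w(2) by auto
  then obtain f where f: "\<forall>k\<in>{1..K}. f k \<in> \<F>bar \<and> F k = dens_measure \<mu> (f k)" by metis
  have "mixture \<mu> K w F = mixture \<mu> K w (\<lambda>k. dens_measure \<mu> (f k))"
    unfolding mixture_def using f
    by (intro arg_cong[where f="measure_of (space \<mu>) (sets \<mu>)"] ext sum.cong) auto
  also have "\<dots> = dens_measure \<mu> (mixture_density K w f)"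
    using w(1) f Fbar by (intro mixture_dens_measure) (auto simp: weights_def)
  finally show ?thesis using that w(1) f e by auto
qed

text \<open>The sum in the last hypothesis is the union bound over the value vectors of all models, at the
  temperature of \<open>offset_symmetrization\<close>; the summand \<open>9 k V\<close> pays for the discretization.\<close>

lemma uniform_deviation:
  fixes pen :: "nat \<Rightarrow> real" and lab :: "('a \<Rightarrow> real) \<Rightarrow> nat"
  assumes sf: "sigma_finite_measure \<mu>" and P: "prob_space P" "sets P = sets \<mu>"
    and Fbar: "\<F>bar \<subseteq> prob_densities \<mu>"
    and ns: "no_shattered (space \<mu>) \<F>bar V" and V: "1 \<le> V" and t: "1 \<le> t" "n \<le> t * V"
    and cQ: "countable \<Q>" and Q: "\<Q> \<subseteq> prob_densities \<mu>" and r: "r \<in> \<Q>"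
    and lab: "finite \<K>" "\<And>k. k \<in> \<K> \<Longrightarrow> 1 \<le> k" "\<And>q. q \<in> \<Q> \<Longrightarrow> lab q \<in> \<K>"
    and rep: "\<And>q. q \<in> \<Q> \<Longrightarrow> dens_measure \<mu> q \<in> mixtures \<mu> (lab q) (dens_measure \<mu> ` \<F>bar)"
    and pen: "(\<Sum>k\<in>\<K>. ((2 * real k * real t ^ 3 + 1) ^ k * ((6 * exp 1 * real t ^ 4) ^ V) ^ k)
        * exp ((9 * real k * real V - pen k) / 300)) \<le> 1"
  shows "1 - exp (- \<xi>) \<le> measure (Pi\<^sub>M {1..n} (\<lambda>_. P)) {x \<in> space (Pi\<^sub>M {1..n} (\<lambda>_. P)).
     \<forall>q\<in>\<Q>. T_stat n x r q \<le> (20 * real n * hellinger2 P (dens_measure \<mu> r) + 300 * \<xi>)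
        - real n * hellinger2 P (dens_measure \<mu> q) / 16 + pen (lab q)}" (is "_ \<le> measure ?M ?E")
proof -
  interpret sigma_finite_measure \<mu> by fact
  interpret PM: prob_space ?M using P by (intro prob_space_PiM)
  have sp: "space P = space \<mu>" using P(2) by (rule sets_eq_imp_space_eq)
  have rd: "r \<in> prob_densities \<mu>" using r Q by auto
  have "\<exists>w f. w \<in> weights (lab q) \<and> (\<forall>k\<in>{1..lab q}. f k \<in> \<F>bar) \<and>
      dens_measure \<mu> q = dens_measure \<mu> (mixture_density (lab q) w f)" if q: "q \<in> \<Q>" for q
    using mixtures_densityE[OF rep[OF q] Fbar] by metis
  then obtain w f where wf: "\<And>q. q \<in> \<Q> \<Longrightarrow> w q \<in> weights (lab q)"
    "\<And>q k. q \<in> \<Q> \<Longrightarrow> k \<in> {1..lab q} \<Longrightarrow> f q k \<in> \<F>bar"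
    "\<And>q. q \<in> \<Q> \<Longrightarrow> dens_measure \<mu> q = dens_measure \<mu> (mixture_density (lab q) (w q) (f q))"
    by metis
  have fd: "f q k \<in> prob_densities \<mu>" if "q \<in> \<Q>" "k \<in> {1..lab q}" for q k
    using wf(2)[OF that] Fbar by auto
  have "AE x in \<mu>. q x = mixture_density (lab q) (w q) (f q) x" if q: "q \<in> \<Q>" for q
  proof -
    have m: "mixture_density (lab q) (w q) (f q) \<in> prob_densities \<mu>"
      using wf(1)[OF q] fd[OF q] by (intro mixture_density_in_prob_densities) auto
    have qd: "q \<in> prob_densities \<mu>" using q Q by auto
    have "AE x in \<mu>. ennreal (q x) = ennreal (mixture_density (lab q) (w q) (f q) x)"
      using m qd wf(3)[OF q] by (intro density_unique) (auto simp: prob_densities_def)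
    then show ?thesis
      using AE_space
    proof eventually_elim
      case (elim x)
      then show ?case using m qd by (auto simp: prob_densities_def)
    qed
  qed
  then have "AE x in \<mu>. \<forall>q\<in>\<Q>. q x = mixture_density (lab q) (w q) (f q) x"
    using cQ by (intro AE_ball_countable[THEN iffD2]) auto
  then obtain N where N: "{x\<in>space \<mu>. \<not> (\<forall>q\<in>\<Q>. q x = mixture_density (lab q) (w q) (f q) x)} \<subseteq> N"
    "N \<in> null_sets \<mu>"
    by (auto elim!: AE_E intro: null_setsI)
  \<comment> \<open>The null set \<open>N\<close> cannot be ignored, since \<open>P\<close> may charge it.\<close>
  define B where "B = N \<union> {x\<in>space \<mu>. r x = 0}"
  have [measurable]: "r \<in> borel_measurable \<mu>" using rd by (simp add: prob_densities_def)
  have "{x\<in>space \<mu>. r x = 0} \<in> sets \<mu>" by measurable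
  then have Bs: "B \<in> sets \<mu>" unfolding B_def using N(2) by auto
  have BA: "AE x in \<mu>. x \<in> B \<longrightarrow> r x = 0"
    using AE_not_in[OF N(2)] by eventually_elim (auto simp: B_def)
  have off: "0 < r x \<and> q x = mixture_density (lab q) (w q) (f q) x"
    if "q \<in> \<Q>" "x \<in> space \<mu>" "x \<notin> B" for q x
    using that N(1) rd by (auto simp: B_def prob_densities_def less_le)
  define c where "c q k = ceil_weight (lab q) t (w q k)" for q k
  define G where "G q = discretized_psi B r t (lab q) (c q) (f q)" for q
  have drift: "(\<integral>x. G q x + (G q x)\<^sup>2 / 32 \<partial>P) \<le> - hellinger2 P (dens_measure \<mu> q) / 16
     + 20 * hellinger2 P (dens_measure \<mu> r) + (5 * real (lab q) + 4) / real t"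
    and dom: "\<And>x. x \<in> space \<mu> \<Longrightarrow> psi (sqrt_ratio (q x) (r x)) \<le> G q x" if q: "q \<in> \<Q>" for q
    unfolding G_def c_def
    using discretized_psi_drift[OF sf P _ rd fd[OF q] wf(1)[OF q] lab(2)[OF lab(3)[OF q]] t(1) Bs BA off[OF q]]
      q Q by auto
  have Gm: "G q \<in> borel_measurable P" if q: "q \<in> \<Q>" for q
  proof -
    have "G q \<in> borel_measurable \<mu>" unfolding G_def using Bs fd[OF q]
      by (intro discretized_psi_measurable) (auto simp: prob_densities_def)
    then show ?thesis using P(2) by (simp cong: measurable_cong_sets)
  qed
  define Nn where "Nn k = (2 * real k * real t ^ 3 + 1) ^ k * ((6 * exp 1 * real t ^ 4) ^ V) ^ k" for k
  define W where "W k = exp ((9 * real k * real V - pen k) / 300)" for k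
  have pat: "finite ((\<lambda>q. \<lambda>i\<in>{1..n+n}. G q (z i)) ` {q\<in>\<Q>. lab q = k})"
    "real (card ((\<lambda>q. \<lambda>i\<in>{1..n+n}. G q (z i)) ` {q\<in>\<Q>. lab q = k})) \<le> Nn k"
    if k: "k \<in> \<K>" and z: "z \<in> {1..n+n} \<rightarrow> space P" for k z
  proof -
    define \<D> where "\<D> = (\<lambda>q. (c q, f q)) ` {q\<in>\<Q>. lab q = k}"
    have eq: "(\<lambda>q. \<lambda>i\<in>{1..n+n}. G q (z i)) ` {q\<in>\<Q>. lab q = k}
        = (\<lambda>(c, f). \<lambda>i\<in>{1..n+n}. discretized_psi B r t k c f (z i)) ` \<D>"
      unfolding \<D>_def G_def by (auto simp: image_image intro!: image_cong)
    have D: "c' j \<le> 2 * k * t ^ 3 \<and> f' j \<in> \<F>bar" if cf: "(c', f') \<in> \<D>" and j: "j \<in> {1..k}" for c' f' j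
    proof -
      obtain q where q: "q \<in> \<Q>" "lab q = k" "c' = c q" "f' = f q" using cf unfolding \<D>_def by auto
      then have "0 \<le> w q j" "w q j \<le> 1" using wf(1)[OF q(1)] j by (auto simp: weights_def)
      then have "c' j \<le> 2 * k * t ^ 3"
        unfolding q(3) c_def q(2) using lab(2)[OF k] t(1) by (intro ceil_weight_bounds)
      then show ?thesis using wf(2)[OF q(1)] j q by auto
    qed
    have zs: "z \<in> {1..n+n} \<rightarrow> space \<mu>" using z by (simp only: sp)
    show "finite ((\<lambda>q. \<lambda>i\<in>{1..n+n}. G q (z i)) ` {q\<in>\<Q>. lab q = k})"
      unfolding eq by (rule discretized_psi_patterns(1)[OF ns V t zs]) (rule D)
    show "real (card ((\<lambda>q. \<lambda>i\<in>{1..n+n}. G q (z i)) ` {q\<in>\<Q>. lab q = k})) \<le> Nn k"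
      unfolding eq Nn_def by (rule discretized_psi_patterns(2)[OF ns V t zs]) (rule D)
  qed
  define H where "H x = (SUP q\<in>\<Q>. ennreal (W (lab q) *
        exp (((\<Sum>i=1..n. G q (x i)) - real n * (\<integral>y. G q y + (G q y)\<^sup>2 / 32 \<partial>P)) / 300)))" for x
  have "(\<integral>\<^sup>+x. H x \<partial>?M) \<le> ennreal (\<Sum>k\<in>\<K>. Nn k * W k)"
    unfolding H_def
    by (rule offset_symmetrization[OF P(1) cQ Gm _ lab(1,3) _ pat])
       (auto simp: G_def W_def discretized_psi_bounds)
  also have "\<dots> \<le> ennreal 1" using pen by (intro ennreal_leI) (simp add: Nn_def W_def)
  finally have H1: "(\<integral>\<^sup>+x. H x \<partial>?M) \<le> 1" by simp
  have Hm: "H \<in> borel_measurable ?M"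
    unfolding H_def[abs_def]
  proof (rule borel_measurable_SUP[OF cQ])
    fix q assume q: "q \<in> \<Q>"
    have [measurable]: "(\<lambda>x. \<Sum>i=1..n. G q (x i)) \<in> borel_measurable ?M"
    proof (rule borel_measurable_sum)
      fix i assume i: "i \<in> {1..n}"
      show "(\<lambda>x. G q (x i)) \<in> borel_measurable ?M"
        using measurable_compose[OF measurable_component_singleton[OF i] Gm[OF q]] .
    qed
    show "(\<lambda>x. ennreal (W (lab q) * exp (((\<Sum>i=1..n. G q (x i))
        - real n * (\<integral>y. G q y + (G q y)\<^sup>2 / 32 \<partial>P)) / 300))) \<in> borel_measurable ?M"
      by measurable
  qed
  have Em: "?E \<in> sets ?M"
  proof (rule sets.sets_Collect_countable_All'[OF _ cQ])
    fix q assume q: "q \<in> \<Q>"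
    have "(\<lambda>x. T_stat n x r q) \<in> borel_measurable ?M"
      using q Q rd by (intro T_stat_measurable[OF P(2)]) auto
    then show "{x \<in> space ?M. T_stat n x r q \<le> (20 * real n * hellinger2 P (dens_measure \<mu> r) + 300 * \<xi>)
        - real n * hellinger2 P (dens_measure \<mu> q) / 16 + pen (lab q)} \<in> sets ?M"
      by (intro borel_measurable_le) auto
  qed
  \<comment> \<open>Off the event, a single \<open>q\<close> already makes the supremum at least \<open>exp \<xi>\<close>; Markov's inequality applies.\<close>
  have sub: "space ?M - ?E \<subseteq> {x\<in>space ?M. 1 \<le> ennreal (exp (- \<xi>)) * H x}"
  proof
    fix x assume x: "x \<in> space ?M - ?E"
    then obtain q where q: "q \<in> \<Q>" and T: "(20 * real n * hellinger2 P (dens_measure \<mu> r) + 300 * \<xi>)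
        - real n * hellinger2 P (dens_measure \<mu> q) / 16 + pen (lab q) < T_stat n x r q"
      by (auto simp: not_le)
    define S where "S = (\<Sum>i=1..n. G q (x i))"
    define m where "m = (\<integral>y. G q y + (G q y)\<^sup>2 / 32 \<partial>P)"
    have xi: "x i \<in> space \<mu>" if "i \<in> {1..n}" for i using x that sp by (auto simp: space_PiM)
    have TS: "T_stat n x r q \<le> S"
      unfolding T_stat_def S_def using dom[OF q] xi by (intro sum_mono) auto
    have "real n * m \<le> real n * (- hellinger2 P (dens_measure \<mu> q) / 16
     + 20 * hellinger2 P (dens_measure \<mu> r) + (5 * real (lab q) + 4) / real t)"
      unfolding m_def by (intro mult_left_mono drift[OF q]) auto
    moreover have "real n * ((5 * real (lab q) + 4) / real t) \<le> 9 * real (lab q) * real V"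
    proof -
      have l1: "1 \<le> real (lab q)" using lab(2)[OF lab(3)[OF q]] by simp
      have "real n \<le> real t * real V" using t(2) by (metis of_nat_le_iff of_nat_mult)
      then have "real n / real t \<le> real V" using t(1) by (simp add: pos_divide_le_eq mult.commute)
      then have "real n / real t * (5 * real (lab q) + 4) \<le> real V * (9 * real (lab q))"
        using l1 by (intro mult_mono) auto
      then show ?thesis by (simp add: ac_simps)
    qed
    ultimately have "pen (lab q) + 300 * \<xi> - 9 * real (lab q) * real V \<le> S - real n * m"
      using T TS by (simp add: algebra_simps)
    then have "0 \<le> - \<xi> + (9 * real (lab q) * real V - pen (lab q)) / 300 + (S - real n * m) / 300"
      by (simp add: field_simps)
    then have "1 \<le> exp (- \<xi> + (9 * real (lab q) * real V - pen (lab q)) / 300 + (S - real n * m) / 300)"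
      by simp
    also have "\<dots> = exp (- \<xi>) * (W (lab q) * exp ((S - real n * m) / 300))"
      by (simp only: exp_add W_def mult.assoc)
    finally have "ennreal 1 \<le> ennreal (exp (- \<xi>) * (W (lab q) * exp ((S - real n * m) / 300)))"
      by (rule ennreal_leI)
    also have "\<dots> = ennreal (exp (- \<xi>)) * ennreal (W (lab q) * exp ((S - real n * m) / 300))"
      by (intro ennreal_mult) (auto simp: W_def)
    also have "\<dots> \<le> ennreal (exp (- \<xi>)) * H x"
      unfolding H_def S_def m_def using q by (intro mult_left_mono SUP_upper2[of q]) auto
    finally show "x \<in> {x\<in>space ?M. 1 \<le> ennreal (exp (- \<xi>)) * H x}" using x by simp
  qed
  have "emeasure ?M (space ?M - ?E) \<le> emeasure ?M {x\<in>space ?M. 1 \<le> ennreal (exp (- \<xi>)) * H x}"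
    using sub Hm by (intro emeasure_mono) auto
  also have "\<dots> \<le> ennreal (exp (- \<xi>)) * (\<integral>\<^sup>+x. H x * indicator (space ?M) x \<partial>?M)"
    by (rule nn_integral_Markov_inequality) (use Hm in auto)
  also have "(\<integral>\<^sup>+x. H x * indicator (space ?M) x \<partial>?M) = (\<integral>\<^sup>+x. H x \<partial>?M)"
    by (intro nn_integral_cong) auto
  also have "ennreal (exp (- \<xi>)) * (\<integral>\<^sup>+x. H x \<partial>?M) \<le> ennreal (exp (- \<xi>)) * 1"
    by (intro mult_left_mono H1) auto
  finally have "measure ?M (space ?M - ?E) \<le> exp (- \<xi>)"
    by (simp only: mult_1_right PM.emeasure_eq_measure ennreal_le_iff[OF less_imp_le[OF exp_gt_zero]])
  then show ?thesis using PM.prob_compl[OF Em] by simp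
qed

section \<open>The penalty and the risk bound\<close>

text \<open>The penalty without the factor \<open>kappa\<close> and the term \<open>\<Delta>\<close>.\<close>

definition model_cost :: "nat \<Rightarrow> nat \<Rightarrow> nat \<Rightarrow> real" where
  "model_cost n V K = 174.1 * real K * real V *
     (5.82 + ln ((real K + 1)\<^sup>2 / delta n V K) + log_plus (real n / (real K * real V)))"

lemma delta_bounds:
  assumes "1 \<le> n" "1 \<le> V" "1 \<le> K"
  shows "0 < delta n V K" "delta n V K \<le> 1 / real K" "(real K - 1) * delta n V K \<le> real K * real V / real n"
proof -
  show "0 < delta n V K" "delta n V K \<le> 1 / real K" using assms by (auto simp: delta_def)
  show "(real K - 1) * delta n V K \<le> real K * real V / real n"
  proof (cases "K = 1")
    case False
    have "(real K - 1) * delta n V K \<le> real K * (real V / real n)"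
      using assms False by (intro mult_mono) (auto simp: delta_def)
    then show ?thesis by simp
  qed simp
qed

text \<open>For \<open>K \<ge> 2\<close> the term \<open>ln (1 / delta)\<close> dominates \<open>log_plus (n / V)\<close>; for \<open>K = 1\<close> the
  last summand of the cost is equal to \<open>log_plus (n / V)\<close>.\<close>

lemma model_cost_lower:
  assumes n: "1 \<le> n" and V: "1 \<le> V" and K: "1 \<le> K"
  shows "174.1 * (real K * real V) * (5.82 + ln (real K) + log_plus (real n / real V)) \<le> model_cost n V K"
proof -
  note d = delta_bounds[OF n V K]
  have "ln (real K) + log_plus (real n / real V)
      \<le> ln ((real K + 1)\<^sup>2 / delta n V K) + log_plus (real n / (real K * real V))"
  proof (cases "K = 1")
    case True
    then show ?thesis by (simp add: delta_def)
  next
    case False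
    have "ln (real K) \<le> ln ((real K + 1)\<^sup>2)"
    proof (subst ln_le_cancel_iff)
      have "real K * 1 \<le> (real K + 1) * (real K + 1)" by (intro mult_mono) auto
      then show "real K \<le> (real K + 1)\<^sup>2" by (simp add: power2_eq_square)
    qed (use K in auto)
    moreover have "ln ((real K + 1)\<^sup>2 / delta n V K) = ln ((real K + 1)\<^sup>2) - ln (delta n V K)"
      using d K by (simp add: ln_divide_pos)
    moreover have "log_plus (real n / real V) \<le> - ln (delta n V K)"
    proof -
      have "delta n V K \<le> real V / real n" using False by (simp add: delta_def)
      then have "ln (delta n V K) \<le> ln (real V / real n)" using d n V by (subst ln_le_cancel_iff) auto
      also have "\<dots> = - ln (real n / real V)" using n V by (simp add: ln_div)
      finally have "ln (real n / real V) \<le> - ln (delta n V K)" by simp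
      moreover have "ln (delta n V K) \<le> 0"
      proof -
        have "delta n V K \<le> 1" using d(2) K by (simp add: order_trans[OF d(2)])
        then show ?thesis using d(1) by simp
      qed
      ultimately show ?thesis by (simp add: log_plus_def)
    qed
    moreover have "0 \<le> log_plus (real n / (real K * real V))" by (simp add: log_plus_def)
    ultimately show ?thesis by linarith
  qed
  then have "174.1 * (real K * real V) * (5.82 + ln (real K) + log_plus (real n / real V))
      \<le> 174.1 * (real K * real V) * (5.82 + ln ((real K + 1)\<^sup>2 / delta n V K) + log_plus (real n / (real K * real V)))"
    by (intro mult_left_mono) auto
  then show ?thesis by (simp add: model_cost_def mult.assoc)
qed

lemma model_cost_nonneg:
  assumes "1 \<le> n" "1 \<le> V" "1 \<le> K"
  shows "0 \<le> model_cost n V K"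
  by (rule order_trans[OF _ model_cost_lower[OF assms]]) (use assms in \<open>auto simp: log_plus_def\<close>)

lemma ln_two_ge_half: "1 / 2 \<le> ln (2::real)"
proof -
  have "exp (1 / 2 :: real) \<le> 1 + 1 / 2 + (1 / 2)\<^sup>2" by (rule exp_bound) auto
  also have "\<dots> \<le> 2" by (simp add: power2_eq_square)
  finally show ?thesis by (subst ln_ge_iff) auto
qed

lemma model_cost_upper:
  assumes n: "2 \<le> n" and V: "1 \<le> V" and K: "1 \<le> K" "K \<le> n"
  shows "model_cost n V K \<le> 3134 * (real K * real V * ln (real n))"
proof -
  define l where "l = ln (real n)"
  have l: "1 / 2 \<le> l"
    unfolding l_def using ln_two_ge_half n ln_le_cancel_iff[of 2 "real n"] by linarith
  have d: "0 < delta n V K" using delta_bounds(1)[of n V K] n V K by simp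
  have "ln ((real K + 1)\<^sup>2 / delta n V K) \<le> 5 * l"
  proof -
    have "1 \<le> real n * delta n V K"
    proof (cases "K = 1")
      case False
      have "1 \<le> real n * (real V / real n)" "1 \<le> real n * (1 / real K)" using n V K by auto
      then show ?thesis using False by (simp add: delta_def min_def)
    qed (use n in \<open>simp add: delta_def\<close>)
    then have "1 / delta n V K \<le> real n" using d by (simp add: pos_divide_le_eq)
    moreover have "(real K + 1)\<^sup>2 \<le> real n ^ 4"
    proof -
      have "real n + 1 \<le> 2 * real n" using n by simp
      also have "\<dots> \<le> real n * real n" using n by (intro mult_right_mono) auto
      finally have "real K + 1 \<le> (real n)\<^sup>2" using K by (simp add: power2_eq_square)
      then have "(real K + 1)\<^sup>2 \<le> ((real n)\<^sup>2)\<^sup>2" by (intro power_mono) auto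
      then show ?thesis by (simp add: power_mult[symmetric])
    qed
    ultimately have "(real K + 1)\<^sup>2 * (1 / delta n V K) \<le> real n ^ 4 * real n"
      using d by (intro mult_mono) auto
    then have le: "(real K + 1)\<^sup>2 / delta n V K \<le> real n ^ 5" by (simp add: eval_nat_numeral ac_simps)
    have pos: "0 < (real K + 1)\<^sup>2 / delta n V K" using d by simp
    have "ln ((real K + 1)\<^sup>2 / delta n V K) \<le> ln (real n ^ 5)" using le pos n by (subst ln_le_cancel_iff) auto
    also have "\<dots> = 5 * l" using n by (simp add: l_def ln_realpow)
    finally show ?thesis .
  qed
  moreover have "log_plus (real n / (real K * real V)) \<le> l"
  proof -
    have kv: "1 \<le> real K * real V" using K V mult_mono[of 1 "real K" 1 "real V"] by simp
    then have "real n / (real K * real V) \<le> real n" using n by (simp add: pos_divide_le_eq mult_le_cancel_left1)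
    then have "ln (real n / (real K * real V)) \<le> l"
      unfolding l_def using n kv by (subst ln_le_cancel_iff) auto
    then show ?thesis using l by (simp add: log_plus_def)
  qed
  moreover have "(5.82::real) \<le> 6" by simp
  ultimately have "5.82 + ln ((real K + 1)\<^sup>2 / delta n V K) + log_plus (real n / (real K * real V)) \<le> 18 * l"
    using l by linarith
  then have "model_cost n V K \<le> 174.1 * real K * real V * (18 * l)"
    unfolding model_cost_def by (intro mult_left_mono) auto
  also have "\<dots> = 3133.8 * (real K * real V * l)" by simp
  also have "\<dots> \<le> 3134 * (real K * real V * l)" using l by (intro mult_right_mono) auto
  finally show ?thesis by (simp add: l_def)
qed

lemma kappa_bounds: "300 \<le> kappa" "kappa \<le> 494"
proof -
  have "sqrt (2::real) \<le> sqrt ((3/2)\<^sup>2)" by (rule real_sqrt_le_mono) (simp add: power2_eq_square)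
  then have "sqrt (2::real) \<le> 3 / 2" by simp
  moreover have "1 \<le> sqrt (2::real)" by simp
  ultimately show "300 \<le> kappa" "kappa \<le> 494" unfolding kappa_def by linarith+
qed

text \<open>The logarithm of the number of value vectors and the discretization cost are together at most
  \<open>K V (24 + ln K + 7 log_plus (n / V))\<close>, which the model cost exceeds by a wide margin. As \<open>kappa \<ge> 300\<close>, the
  term \<open>D\<close> survives at the temperature 300.\<close>

lemma pattern_count_penalized:
  assumes n: "1 \<le> n" and V: "1 \<le> V" and K: "1 \<le> K" and t: "1 \<le> t" "real t \<le> real n / real V + 1"
    and D: "0 \<le> D"
  shows "((2 * real K * real t ^ 3 + 1) ^ K * ((6 * exp 1 * real t ^ 4) ^ V) ^ K)
      * exp ((9 * real K * real V - kappa * (model_cost n V K + D)) / 300) \<le> exp (- D)"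
proof -
  define m where "m = real K * real V"
  have m1: "real K \<le> m" "0 \<le> m" using V by (auto simp: m_def mult_le_cancel_left1)
  define lp where "lp = log_plus (real n / real V)"
  have lp0: "0 \<le> lp" by (simp add: lp_def log_plus_def)
  have lK: "0 \<le> ln (real K)" using K by simp
  have lt: "ln (real t) \<le> 1 + lp" "0 \<le> ln (real t)"
  proof -
    define u where "u = real n / real V"
    have "ln (real t) \<le> ln (2 * max u 1)" using t n V by (subst ln_le_cancel_iff) (auto simp: u_def)
    also have "\<dots> = ln 2 + ln (max u 1)" by (rule ln_mult_pos) auto
    also have "ln (max u 1) = lp" using n V by (auto simp: lp_def log_plus_def u_def max_def)
    also have "ln 2 \<le> (1::real)" using ln_le_minus_one[of 2] by simp
    finally show "ln (real t) \<le> 1 + lp" by simp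
    show "0 \<le> ln (real t)" using t by simp
  qed
  have one: "(2 * real K * real t ^ 3 + 1) ^ K \<le> exp (real K * (2 + ln (real K) + 3 * ln (real t)))"
  proof -
    have "1 * 1 \<le> real K * real t ^ 3" using K t by (intro mult_mono) auto
    then have "2 * real K * real t ^ 3 + 1 \<le> 3 * (real K * real t ^ 3)" by simp
    also have "\<dots> = exp (ln 3) * exp (ln (real K)) * exp (ln (real t)) ^ 3" using K t by simp
    also have "\<dots> = exp (ln 3 + ln (real K) + 3 * ln (real t))"
      by (simp only: exp_add exp_of_nat_mult[symmetric] of_nat_numeral)
    also have "\<dots> \<le> exp (2 + ln (real K) + 3 * ln (real t))" using ln_le_minus_one[of 3] by simp
    finally have "(2 * real K * real t ^ 3 + 1) ^ K \<le> exp (2 + ln (real K) + 3 * ln (real t)) ^ K"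
      by (intro power_mono) auto
    then show ?thesis by (simp only: exp_of_nat_mult[symmetric])
  qed
  have two: "((6 * exp 1 * real t ^ 4) ^ V) ^ K \<le> exp (m * (6 + 4 * ln (real t)))"
  proof -
    have "6 * exp 1 * real t ^ 4 = exp (ln 6) * exp 1 * exp (ln (real t)) ^ 4" using t by simp
    also have "\<dots> = exp (ln 6 + 1 + 4 * ln (real t))"
      by (simp only: exp_add exp_of_nat_mult[symmetric] of_nat_numeral)
    also have "\<dots> \<le> exp (6 + 4 * ln (real t))" using ln_le_minus_one[of 6] by simp
    finally have "(6 * exp 1 * real t ^ 4) ^ (V * K) \<le> exp (6 + 4 * ln (real t)) ^ (V * K)"
      by (intro power_mono) auto
    also have "\<dots> = exp (m * (6 + 4 * ln (real t)))"
      unfolding exp_of_nat_mult[symmetric] by (simp add: m_def mult.commute)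
    finally show ?thesis by (simp only: power_mult)
  qed
  have "((2 * real K * real t ^ 3 + 1) ^ K * ((6 * exp 1 * real t ^ 4) ^ V) ^ K)
      \<le> exp (real K * (2 + ln (real K) + 3 * ln (real t))) * exp (m * (6 + 4 * ln (real t)))"
    using one two by (intro mult_mono) auto
  also have "\<dots> \<le> exp (m * (15 + ln (real K) + 7 * lp))"
  proof -
    have "real K * (2 + ln (real K) + 3 * ln (real t)) \<le> m * (2 + ln (real K) + 3 * ln (real t))"
      using m1 lK lt by (intro mult_right_mono) auto
    then have "real K * (2 + ln (real K) + 3 * ln (real t)) + m * (6 + 4 * ln (real t))
        \<le> m * (8 + ln (real K) + 7 * ln (real t))" by (simp add: algebra_simps)
    also have "\<dots> \<le> m * (15 + ln (real K) + 7 * lp)" using m1 lt by (intro mult_left_mono) auto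
    finally show ?thesis by (simp add: exp_add[symmetric])
  qed
  finally have N: "((2 * real K * real t ^ 3 + 1) ^ K * ((6 * exp 1 * real t ^ 4) ^ V) ^ K)
      \<le> exp (m * (15 + ln (real K) + 7 * lp))" .
  have c0: "0 \<le> model_cost n V K" by (rule model_cost_nonneg[OF n V K])
  have cost: "m * (15 + ln (real K) + 7 * lp) + 9 * m \<le> model_cost n V K"
  proof -
    have "m * (15 + ln (real K) + 7 * lp) + 9 * m = m * (24 + ln (real K) + 7 * lp)"
      by (simp add: algebra_simps)
    also have "\<dots> \<le> m * (174.1 * (5.82 + ln (real K) + lp))"
      using m1 lK lp0 by (intro mult_left_mono) (simp_all add: algebra_simps)
    also have "\<dots> = 174.1 * (real K * real V) * (5.82 + ln (real K) + lp)" by (simp add: m_def)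
    also have "\<dots> \<le> model_cost n V K" unfolding lp_def by (rule model_cost_lower[OF n V K])
    finally show ?thesis .
  qed
  have "300 * (model_cost n V K + D) \<le> kappa * (model_cost n V K + D)"
    using kappa_bounds(1) c0 D by (intro mult_right_mono) auto
  then have "(9 * real K * real V - kappa * (model_cost n V K + D)) / 300
      \<le> 9 * m - (model_cost n V K + D)" using m1 by (simp add: m_def field_simps)
  then have "m * (15 + ln (real K) + 7 * lp)
      + (9 * real K * real V - kappa * (model_cost n V K + D)) / 300 \<le> - D"
    using cost by argo
  then have "exp (m * (15 + ln (real K) + 7 * lp))
      * exp ((9 * real K * real V - kappa * (model_cost n V K + D)) / 300) \<le> exp (- D)"
    unfolding exp_add[symmetric] by (simp only: exp_le_cancel_iff)
  then show ?thesis using N by (meson mult_right_mono exp_ge_zero order_trans)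
qed

lemma densities_delta_countable:
  assumes "countable \<F>"
  shows "countable (densities_delta \<mu> \<F> d \<S> K)"
proof -
  have "densities_delta \<mu> \<F> d \<S> K \<subseteq>
      (\<lambda>(w, f). mixture_density K w f) ` (PiE {1..K} (\<lambda>_. \<rat>) \<times> PiE {1..K} (\<lambda>_. \<F>))"
  proof
    fix q assume "q \<in> densities_delta \<mu> \<F> d \<S> K"
    then obtain w f where q: "q = mixture_density K w f" "\<forall>k\<in>{1..K}. w k \<in> \<rat> \<and> f k \<in> \<F>"
      unfolding densities_delta_def by blast
    have "q = mixture_density K (restrict w {1..K}) (restrict f {1..K})"
      unfolding q(1) mixture_density_def by (intro ext sum.cong) auto
    moreover have "(restrict w {1..K}, restrict f {1..K}) \<in> PiE {1..K} (\<lambda>_. \<rat>) \<times> PiE {1..K} (\<lambda>_. \<F>)"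
      using q(2) by auto
    ultimately show "q \<in> (\<lambda>(w, f). mixture_density K w f) ` (PiE {1..K} (\<lambda>_. \<rat>) \<times> PiE {1..K} (\<lambda>_. \<F>))"
      by (intro image_eqI[where x="(restrict w {1..K}, restrict f {1..K})"]) (simp_all only: prod.case)
  qed
  moreover have "countable (PiE {1..K} (\<lambda>_. \<rat> :: real set) \<times> PiE {1..K} (\<lambda>_. \<F>))"
    using assms countable_rat by (intro countable_SIGMA countable_PiE) auto
  ultimately show ?thesis by (meson countable_image countable_subset)
qed

lemma densities_delta_prob_densities:
  assumes "\<F> \<subseteq> prob_densities \<mu>" "q \<in> densities_delta \<mu> \<F> d \<S> K"
  shows "q \<in> prob_densities \<mu>" "dens_measure \<mu> q \<in> \<S>"
proof -
  obtain w f where q: "q = mixture_density K w f" "w \<in> weights K" "\<forall>k\<in>{1..K}. f k \<in> \<F>"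
    "mixture \<mu> K w (\<lambda>k. dens_measure \<mu> (f k)) \<in> \<S>"
    using assms(2) unfolding densities_delta_def by blast
  have f: "\<forall>k\<in>{1..K}. f k \<in> prob_densities \<mu>" using q(3) assms(1) by auto
  show "q \<in> prob_densities \<mu>" unfolding q(1) using q(2) f by (rule mixture_density_in_prob_densities)
  have "mixture \<mu> K w (\<lambda>k. dens_measure \<mu> (f k)) = dens_measure \<mu> q"
    unfolding q(1) using q(2) f by (intro mixture_dens_measure) (auto simp: weights_def)
  then show "dens_measure \<mu> q \<in> \<S>" using q(4) by simp
qed

text \<open>The infimum in the penalty runs over finitely many models, so that each density has a model from which its
  penalty comes.\<close>

lemma penalty_attained:
  assumes "finite \<K>" "K0 \<in> \<K>" "dens_measure \<mu> q \<in> \<Q> K0"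
  shows "\<exists>K\<in>\<K>. dens_measure \<mu> q \<in> \<Q> K \<and> penalty n V \<mu> \<K> \<Q> \<Delta> q = kappa * (model_cost n V K + \<Delta> K)"
    and "penalty n V \<mu> \<K> \<Q> \<Delta> q \<le> kappa * (model_cost n V K0 + \<Delta> K0)"
proof -
  define S where "S = {K\<in>\<K>. dens_measure \<mu> q \<in> \<Q> K}"
  define g where "g K = model_cost n V K + \<Delta> K" for K
  have S: "finite S" "K0 \<in> S" using assms by (auto simp: S_def)
  have p: "penalty n V \<mu> \<K> \<Q> \<Delta> q = kappa * Inf (g ` S)"
    unfolding penalty_def S_def[symmetric] g_def model_cost_def ..
  have I: "Inf (g ` S) = Min (g ` S)" using S by (intro cInf_eq_Min) auto
  then have "Inf (g ` S) \<in> g ` S" unfolding I using S by (intro Min_in) auto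
  then show "\<exists>K\<in>\<K>. dens_measure \<mu> q \<in> \<Q> K \<and> penalty n V \<mu> \<K> \<Q> \<Delta> q = kappa * (model_cost n V K + \<Delta> K)"
    unfolding p g_def S_def by auto
  have "Inf (g ` S) \<le> g K0" unfolding I using S by (intro Min_le) auto
  then show "penalty n V \<mu> \<K> \<Q> \<Delta> q \<le> kappa * (model_cost n V K0 + \<Delta> K0)"
    unfolding p g_def[symmetric] using kappa_bounds by (intro mult_left_mono) auto
qed

text \<open>The factor 2 of the quasi-triangle inequality accounts for the step from near-minimizers to their Hellinger closure:
  \<open>1280 = 2 * 16 * 40\<close>. The bound is passed on as \<open>bnd\<close> in order to state the event once.\<close>

lemma rho_estimator_risk:
  fixes \<mu> :: "'a measure"
  assumes n: "2 \<le> n" and sf: "sigma_finite_measure \<mu>" and Fbar: "\<F>bar \<subseteq> prob_densities \<mu>"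
    and ns: "no_shattered (space \<mu>) \<F>bar V" and V: "1 \<le> V"
    and F: "\<F> \<subseteq> \<F>bar" "countable \<F>" and K: "\<K> \<subseteq> {1..n}"
    and Q: "\<forall>K\<in>\<K>. \<Q> K \<subseteq> mixtures \<mu> K (dens_measure \<mu> ` \<F>bar)"
    and D: "\<forall>K\<in>\<K>. 0 \<le> \<Delta> K" "(\<Sum>K\<in>\<K>. exp (- \<Delta> K)) \<le> 1"
    and P: "Pstar \<in> space (prob_algebra \<mu>)"
    and Phat: "rho_estimator n \<mu> (Q_delta n V \<mu> \<F> \<K> \<Q>) (penalty n V \<mu> \<K> \<Q> \<Delta>) Phat"
    and K0: "K0 \<in> \<K>" and r: "r \<in> densities_delta \<mu> \<F> (delta n V K0) (\<Q> K0) K0"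
    and bound: "\<And>h. h \<le> 1280 * hellinger2 Pstar (dens_measure \<mu> r) + (19200 * \<xi>
         + 64 * (kappa * (model_cost n V K0 + \<Delta> K0)) + 264) / real n \<Longrightarrow> h \<le> bnd"
  shows "1 - exp (- \<xi>) \<le> measure (Pi\<^sub>M {1..n} (\<lambda>_. Pstar))
     {x \<in> space (Pi\<^sub>M {1..n} (\<lambda>_. Pstar)). hellinger2 Pstar (Phat x) \<le> bnd}"
proof -
  let ?M = "Pi\<^sub>M {1..n} (\<lambda>_. Pstar)" and ?Qd = "Q_delta n V \<mu> \<F> \<K> \<Q>"
  let ?pen = "penalty n V \<mu> \<K> \<Q> \<Delta>"
  have Pp: "prob_space Pstar" "sets Pstar = sets \<mu>" using P by (auto simp: space_prob_algebra)
  interpret PM: prob_space ?M using Pp by (intro prob_space_PiM)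
  have sets: "sets ?M = sets (Pi\<^sub>M {1..n} (\<lambda>_. \<mu>))" using Pp(2) by (intro sets_PiM_cong) auto
  have sp: "space ?M = space (Pi\<^sub>M {1..n} (\<lambda>_. \<mu>))" using sets by (rule sets_eq_imp_space_eq)
  have finK: "finite \<K>" using K by (rule finite_subset) simp
  have K1: "1 \<le> k" if "k \<in> \<K>" for k using K that by auto
  have Fp: "\<F> \<subseteq> prob_densities \<mu>" using F Fbar by auto
  have cQ: "countable ?Qd"
    unfolding Q_delta_def
    by (intro countable_UN[OF countable_finite[OF finK]] densities_delta_countable[OF F(2)])
  have Qp: "?Qd \<subseteq> prob_densities \<mu>"
    unfolding Q_delta_def using densities_delta_prob_densities(1)[OF Fp] by blast
  have rQ: "r \<in> ?Qd" unfolding Q_delta_def using K0 r by blast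
  have "\<exists>k\<in>\<K>. dens_measure \<mu> q \<in> \<Q> k \<and> ?pen q = kappa * (model_cost n V k + \<Delta> k)" if q: "q \<in> ?Qd" for q
  proof -
    obtain k where k: "k \<in> \<K>" "q \<in> densities_delta \<mu> \<F> (delta n V k) (\<Q> k) k"
      using q unfolding Q_delta_def by blast
    show ?thesis
      using penalty_attained(1)[OF finK k(1)] densities_delta_prob_densities(2)[OF Fp k(2)] by blast
  qed
  then obtain lab where lab: "\<And>q. q \<in> ?Qd \<Longrightarrow> lab q \<in> \<K>"
    "\<And>q. q \<in> ?Qd \<Longrightarrow> dens_measure \<mu> q \<in> \<Q> (lab q)"
    "\<And>q. q \<in> ?Qd \<Longrightarrow> ?pen q = kappa * (model_cost n V (lab q) + \<Delta> (lab q))" by metis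
  have rep: "dens_measure \<mu> q \<in> mixtures \<mu> (lab q) (dens_measure \<mu> ` \<F>bar)" if "q \<in> ?Qd" for q
    using lab(1,2)[OF that] Q by blast
  define pen where "pen k = kappa * (model_cost n V k + \<Delta> k)" for k
  \<comment> \<open>The accuracy \<open>1 / t \<le> V / n\<close> makes the total discretization error on \<open>n\<close> points of order \<open>K V\<close>.\<close>
  define t where "t = nat \<lceil>real n / real V\<rceil>"
  have nV: "0 < real n / real V" using n V by simp
  then have tr: "real t = real_of_int \<lceil>real n / real V\<rceil>" by (simp add: t_def)
  have t: "1 \<le> t" "real n / real V \<le> real t" "real t \<le> real n / real V + 1"
    using nV tr by linarith+
  have "real n \<le> real (t * V)" using t(2) V by (simp add: pos_divide_le_eq)
  then have ntV: "n \<le> t * V" by (simp only: of_nat_le_iff)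
  have "(\<Sum>k\<in>\<K>. ((2 * real k * real t ^ 3 + 1) ^ k * ((6 * exp 1 * real t ^ 4) ^ V) ^ k)
        * exp ((9 * real k * real V - pen k) / 300)) \<le> (\<Sum>k\<in>\<K>. exp (- \<Delta> k))"
    unfolding pen_def using n V K1 t D(1) by (intro sum_mono pattern_count_penalized) auto
  also note D(2)
  finally have dev: "1 - exp (- \<xi>) \<le> measure ?M {x \<in> space ?M.
     \<forall>q\<in>?Qd. T_stat n x r q \<le> (20 * real n * hellinger2 Pstar (dens_measure \<mu> r) + 300 * \<xi>)
        - real n * hellinger2 Pstar (dens_measure \<mu> q) / 16 + pen (lab q)}"
    using lab(1) rep by (intro uniform_deviation[OF sf Pp Fbar ns V t(1) ntV cQ Qp rQ finK K1])
  have Pm: "Phat \<in> measurable ?M (prob_algebra \<mu>)"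
    and Pc: "\<And>x. x \<in> space ?M \<Longrightarrow> Phat x \<in> hellinger_closure \<mu> (dens_measure \<mu> `
          {q \<in> ?Qd. Upsilon n ?Qd ?pen x q < (INF q'\<in>?Qd. Upsilon n ?Qd ?pen x q') + 8.24})"
    using Phat sp sets unfolding rho_estimator_def by (auto cong: measurable_cong_sets)
  have "(\<lambda>x. hellinger2 Pstar (Phat x)) \<in> borel_measurable ?M"
  proof (rule hellinger2_measurable_on_closure[OF sf P cQ Qp Pm])
    fix x assume "x \<in> space ?M"
    then show "Phat x \<in> hellinger_closure \<mu> (dens_measure \<mu> ` ?Qd)"
      using Pc[of x] unfolding hellinger_closure_def by blast
  qed
  then have Em: "{x \<in> space ?M. hellinger2 Pstar (Phat x) \<le> bnd} \<in> sets ?M"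
    by (intro borel_measurable_le) auto
  have pen0: "0 \<le> ?pen q" if "q \<in> ?Qd" for q
    using lab[OF that] D(1) kappa_bounds(1) model_cost_nonneg[of n V "lab q"] n V K1
    by (auto intro!: mult_nonneg_nonneg add_nonneg_nonneg)
  have penr: "?pen r \<le> kappa * (model_cost n V K0 + \<Delta> K0)"
    using penalty_attained(2)[OF finK K0] densities_delta_prob_densities(2)[OF Fp r] by blast
  have prq: "prob_space (dens_measure \<mu> q)" if "q \<in> ?Qd" for q
    using that Qp by (auto simp: prob_densities_def)
  have "{x \<in> space ?M.
     \<forall>q\<in>?Qd. T_stat n x r q \<le> (20 * real n * hellinger2 Pstar (dens_measure \<mu> r) + 300 * \<xi>)
        - real n * hellinger2 Pstar (dens_measure \<mu> q) / 16 + pen (lab q)}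
    \<subseteq> {x \<in> space ?M. hellinger2 Pstar (Phat x) \<le> bnd}"
  proof safe
    fix x assume x: "x \<in> space ?M"
      and T: "\<forall>q\<in>?Qd. T_stat n x r q \<le> (20 * real n * hellinger2 Pstar (dens_measure \<mu> r) + 300 * \<xi>)
        - real n * hellinger2 Pstar (dens_measure \<mu> q) / 16 + pen (lab q)"
    define A where "A = 20 * real n * hellinger2 Pstar (dens_measure \<mu> r) + 300 * \<xi>"
    have xi: "x i \<in> space \<mu>" if "i \<in> {1..n}" for i
      using x that unfolding sp by (auto simp: space_PiM)
    have Px: "prob_space (Phat x)" "sets (Phat x) = sets \<mu>"
      using measurable_space[OF Pm x] by (auto simp: space_prob_algebra)
    have main: "hellinger2 Pstar (dens_measure \<mu> q) \<le> 16 / real n * (2 * A + 2 * ?pen r + 8.24)"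
      if q: "q \<in> ?Qd" "Upsilon n ?Qd ?pen x q < (INF q'\<in>?Qd. Upsilon n ?Qd ?pen x q') + 8.24" for q
    proof -
      have "real n * hellinger2 Pstar (dens_measure \<mu> q) / 16 \<le> 2 * A + 2 * ?pen r + 8.24"
      proof (rule near_minimizer_bound[OF _ pen0 _ rQ _ q,
            where h="\<lambda>q. real n * hellinger2 Pstar (dens_measure \<mu> q) / 16"])
        fix q i assume "q \<in> ?Qd" "i \<in> {1..n}"
        then show "0 \<le> q (x i)" using Qp xi[of i] by (auto simp: prob_densities_def)
      next
        fix q assume q: "q \<in> ?Qd"
        show "0 \<le> real n * hellinger2 Pstar (dens_measure \<mu> q) / 16"
          using hellinger2_nonneg[OF Pp(1) prq[OF q]] Pp(2) by simp
        show "T_stat n x r q \<le> A - real n * hellinger2 Pstar (dens_measure \<mu> q) / 16 + ?pen q"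
          using T q lab(3)[OF q] unfolding A_def pen_def by auto
      qed
      then show ?thesis using n by (simp add: field_simps)
    qed
    define R where "R = 1280 * hellinger2 Pstar (dens_measure \<mu> r) + (19200 * \<xi>
         + 64 * (kappa * (model_cost n V K0 + \<Delta> K0)) + 264) / real n"
    have R: "2 * (16 / real n * (2 * A + 2 * ?pen r + 8.24)) \<le> R"
    proof -
      have "2 * (16 / real n * (2 * A + 2 * ?pen r + 8.24)) = 1280 * hellinger2 Pstar (dens_measure \<mu> r)
          + (19200 * \<xi> + 64 * ?pen r + 263.68) / real n"
        using n by (simp add: A_def field_simps)
      also have "\<dots> \<le> R" unfolding R_def
        using penr by (intro add_left_mono divide_right_mono add_mono mult_left_mono) auto
      finally show ?thesis .
    qed
    have "hellinger2 Pstar (Phat x) \<le> R + e" if e: "0 < e" for e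
    proof -
      have "0 < e / 2" using e by simp
      then obtain q where q: "q \<in> ?Qd"
        "Upsilon n ?Qd ?pen x q < (INF q'\<in>?Qd. Upsilon n ?Qd ?pen x q') + 8.24"
        "hellinger2 (Phat x) (dens_measure \<mu> q) < e / 2"
        using Pc[OF x] unfolding hellinger_closure_def by blast
      have "hellinger2 Pstar (Phat x) \<le> 2 * hellinger2 Pstar (dens_measure \<mu> q)
          + 2 * hellinger2 (dens_measure \<mu> q) (Phat x)"
        using Pp Px prq[OF q(1)] by (intro hellinger2_quasi_triangle) auto
      moreover have "hellinger2 (dens_measure \<mu> q) (Phat x) = hellinger2 (Phat x) (dens_measure \<mu> q)"
        using Px prq[OF q(1)] by (intro hellinger2_commute) auto
      ultimately show ?thesis using main[OF q(1,2)] R q(3) by linarith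
    qed
    then have "hellinger2 Pstar (Phat x) \<le> R" by (rule field_le_epsilon)
    then show "hellinger2 Pstar (Phat x) \<le> bnd" unfolding R_def by (rule bound)
  qed
  then show ?thesis using dev PM.finite_measure_mono[OF _ Em] by (meson order_trans)
qed

theorem theorem10:
  "\<exists>C>0. \<forall>(n::nat) V (\<mu>::'a measure) \<F>bar \<F> (\<K>::nat set) \<Q> \<Delta> Pstar Phat.
     2 \<le> n \<longrightarrow>
     sigma_finite_measure \<mu> \<longrightarrow>
     \<F>bar \<subseteq> prob_densities \<mu> \<longrightarrow>
     vc_subgraph (space \<mu>) \<F>bar \<longrightarrow>
     V = vc_index (space \<mu>) \<F>bar \<longrightarrow>
     \<F> \<subseteq> \<F>bar \<longrightarrow> countable \<F> \<longrightarrow>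
     hellinger_dense (dens_measure \<mu> ` \<F>) (dens_measure \<mu> ` \<F>bar) \<longrightarrow>
     \<K> \<subseteq> {1..n} \<longrightarrow>
     (\<forall>K\<in>\<K>. \<Q> K \<subseteq> mixtures \<mu> K (dens_measure \<mu> ` \<F>bar)) \<longrightarrow>
     (\<forall>K\<in>\<K>. \<forall>Q\<in>\<Q> K. hellinger2_set Q (model_delta \<mu> \<F> (delta n V K) (\<Q> K) K)
                       \<le> ereal ((real K - 1) * delta n V K)) \<longrightarrow>
     (\<forall>K\<in>\<K>. 0 \<le> \<Delta> K) \<longrightarrow> (\<Sum>K\<in>\<K>. exp (- \<Delta> K)) \<le> 1 \<longrightarrow>
     Pstar \<in> space (prob_algebra \<mu>) \<longrightarrow>
     rho_estimator n \<mu> (Q_delta n V \<mu> \<F> \<K> \<Q>) (penalty n V \<mu> \<K> \<Q> \<Delta>) Phat \<longrightarrow>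
     (\<forall>\<xi>>0. measure (Pi\<^sub>M {1..n} (\<lambda>_. Pstar))
         {x \<in> space (Pi\<^sub>M {1..n} (\<lambda>_. Pstar)).
            ereal (C * hellinger2 Pstar (Phat x)) \<le>
              (INF K\<in>\<K>. hellinger2_set Pstar (\<Q> K)
                 + ereal ((real K * real V * ln (real n) + \<xi> + \<Delta> K) / real n))}
         \<ge> 1 - exp (- \<xi>))"
proof (intro exI[of _ "1 / 10 ^ 8"] conjI allI impI)
  show "(0::real) < 1 / 10 ^ 8" by simp
next
  fix n :: nat and V :: nat and \<mu> :: "'a measure" and \<F>bar \<F> and \<K> :: "nat set" and \<Q> \<Delta> Pstar Phat and \<xi> :: real
  assume n: "2 \<le> n" and sf: "sigma_finite_measure \<mu>" and Fbar: "\<F>bar \<subseteq> prob_densities \<mu>"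
    and vc: "vc_subgraph (space \<mu>) \<F>bar" "V = vc_index (space \<mu>) \<F>bar"
    and F: "\<F> \<subseteq> \<F>bar" "countable \<F>" and K: "\<K> \<subseteq> {1..n}"
    and Q: "\<forall>K\<in>\<K>. \<Q> K \<subseteq> mixtures \<mu> K (dens_measure \<mu> ` \<F>bar)"
    and approx: "\<forall>K\<in>\<K>. \<forall>Q\<in>\<Q> K. hellinger2_set Q (model_delta \<mu> \<F> (delta n V K) (\<Q> K) K)
                       \<le> ereal ((real K - 1) * delta n V K)"
    and D: "\<forall>K\<in>\<K>. 0 \<le> \<Delta> K" "(\<Sum>K\<in>\<K>. exp (- \<Delta> K)) \<le> 1"
    and P: "Pstar \<in> space (prob_algebra \<mu>)"
    and Phat: "rho_estimator n \<mu> (Q_delta n V \<mu> \<F> \<K> \<Q>) (penalty n V \<mu> \<K> \<Q> \<Delta>) Phat"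
    and \<xi>: "0 < \<xi>"
  let ?M = "Pi\<^sub>M {1..n} (\<lambda>_. Pstar)"
  define risk where "risk K = hellinger2_set Pstar (\<Q> K)
     + ereal ((real K * real V * ln (real n) + \<xi> + \<Delta> K) / real n)" for K
  have Pp: "prob_space Pstar" "sets Pstar = sets \<mu>" using P by (auto simp: space_prob_algebra)
  interpret PM: prob_space ?M using Pp by (intro prob_space_PiM)
  have "1 \<le> V \<and> no_shattered (space \<mu>) \<F>bar V"
    unfolding vc(2) vc_index_def using vc(1) unfolding vc_subgraph_def by (rule LeastI_ex)
  then have V: "1 \<le> V" and ns: "no_shattered (space \<mu>) \<F>bar V" by auto
  have finK: "finite \<K>" using K by (rule finite_subset) simp
  show "1 - exp (- \<xi>) \<le> measure ?M {x \<in> space ?M. ereal (1 / 10 ^ 8 * hellinger2 Pstar (Phat x)) \<le>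
              (INF K\<in>\<K>. hellinger2_set Pstar (\<Q> K)
                 + ereal ((real K * real V * ln (real n) + \<xi> + \<Delta> K) / real n))}"
    unfolding risk_def[symmetric]
  proof (cases "(INF K\<in>\<K>. risk K) = \<infinity>")
    case True
    then have "{x \<in> space ?M. ereal (1 / 10 ^ 8 * hellinger2 Pstar (Phat x)) \<le> (INF K\<in>\<K>. risk K)}
        = space ?M" by simp
    then show "1 - exp (- \<xi>) \<le> measure ?M {x \<in> space ?M.
        ereal (1 / 10 ^ 8 * hellinger2 Pstar (Phat x)) \<le> (INF K\<in>\<K>. risk K)}"
      by (simp only: PM.prob_space) simp
  next
    case False
    \<comment> \<open>The infimum is over finitely many models, hence attained.\<close>
    have ne: "\<K> \<noteq> {}" using False by (auto simp: top_ereal_def)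
    have "Inf (risk ` \<K>) = Min (risk ` \<K>)" using finK ne by (intro cInf_eq_Min) auto
    moreover have "Min (risk ` \<K>) \<in> risk ` \<K>" using finK ne by (intro Min_in) auto
    ultimately have "Inf (risk ` \<K>) \<in> risk ` \<K>" by simp
    then obtain K0 where K0: "K0 \<in> \<K>" "(INF K\<in>\<K>. risk K) = risk K0" by auto
    have K01: "1 \<le> K0" "K0 \<le> n" using K K0(1) by auto
    define H where "H = real_of_ereal (hellinger2_set Pstar (\<Q> K0))"
    have pr: "prob_space Q" "sets Q = sets \<mu>" if "Q \<in> \<Q> K0" for Q
    proof -
      have "Q \<in> mixtures \<mu> K0 (dens_measure \<mu> ` \<F>bar)" using Q K0(1) that by blast
      then obtain w f where w: "w \<in> weights K0" "\<forall>k\<in>{1..K0}. f k \<in> \<F>bar"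
        and e: "Q = dens_measure \<mu> (mixture_density K0 w f)"
        using mixtures_densityE[OF _ Fbar] by metis
      have fp: "\<forall>k\<in>{1..K0}. f k \<in> prob_densities \<mu>" using w(2) Fbar by auto
      show "prob_space Q" "sets Q = sets \<mu>"
        using mixture_density_in_prob_densities[OF w(1) fp] unfolding e by (auto simp: prob_densities_def)
    qed
    have nonneg: "0 \<le> hellinger2_set Pstar (\<Q> K0)"
      unfolding hellinger2_set_def using Pp pr hellinger2_nonneg[OF Pp(1)] by (intro INF_greatest) auto
    have "hellinger2_set Pstar (\<Q> K0) \<noteq> \<infinity>" using False K0(2) unfolding risk_def by auto
    then have Hs: "hellinger2_set Pstar (\<Q> K0) = ereal H" using nonneg unfolding H_def by (cases "hellinger2_set Pstar (\<Q> K0)") auto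
    have H0: "0 \<le> H" using nonneg unfolding Hs by simp
    \<comment> \<open>The infima that define the distances need not be attained; an excess of \<open>V / n\<close> is harmless.\<close>
    define \<eta> where "\<eta> = real V / real n"
    have \<eta>: "0 < \<eta>" using n V by (simp add: \<eta>_def)
    have "hellinger2_set Pstar (\<Q> K0) < ereal (H + \<eta>)" using \<eta> unfolding Hs by simp
    then obtain Q where Qm: "Q \<in> \<Q> K0" "hellinger2 Pstar Q < H + \<eta>"
      unfolding hellinger2_set_def by (auto simp: INF_less_iff)
    have "hellinger2_set Q (model_delta \<mu> \<F> (delta n V K0) (\<Q> K0) K0) < ereal ((real K0 - 1) * delta n V K0 + \<eta>)"
      using approx K0(1) Qm(1) \<eta> by (intro le_less_trans[OF bspec[OF bspec[OF approx K0(1)] Qm(1)]]) auto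
    then obtain Q' where Q': "Q' \<in> model_delta \<mu> \<F> (delta n V K0) (\<Q> K0) K0"
      "hellinger2 Q Q' < (real K0 - 1) * delta n V K0 + \<eta>"
      unfolding hellinger2_set_def by (auto simp: INF_less_iff)
    have Fp: "\<F> \<subseteq> prob_densities \<mu>" using F Fbar by auto
    obtain r where r: "r \<in> densities_delta \<mu> \<F> (delta n V K0) (\<Q> K0) K0" "Q' = dens_measure \<mu> r"
      using Q'(1) unfolding model_delta_eq[OF Fp] by auto
    have rq: "dens_measure \<mu> r \<in> \<Q> K0" using densities_delta_prob_densities(2)[OF Fp r(1)] .
    define L where "L = real K0 * real V * ln (real n) / real n"
    define h where "h = hellinger2 Pstar (dens_measure \<mu> r)"
    have ln2: "1 / 2 \<le> ln (real n)"
      using ln_two_ge_half n ln_le_cancel_iff[of 2 "real n"] by linarith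
    have kl: "real K0 * real V / real n \<le> 2 * L"
    proof -
      have "real K0 * real V / real n * 1 \<le> real K0 * real V / real n * (2 * ln (real n))"
        using ln2 by (intro mult_left_mono) auto
      then show ?thesis by (simp add: L_def mult_ac)
    qed
    have \<eta>k: "\<eta> \<le> real K0 * real V / real n"
      unfolding \<eta>_def using K01 by (intro divide_right_mono) (auto simp: mult_le_cancel_right1)
    have h: "h \<le> 2 * H + 12 * L"
    proof -
      have "h \<le> 2 * hellinger2 Pstar Q + 2 * hellinger2 Q (dens_measure \<mu> r)"
        unfolding h_def using Pp pr[OF Qm(1)] pr[OF rq] by (intro hellinger2_quasi_triangle) auto
      moreover have "(real K0 - 1) * delta n V K0 \<le> real K0 * real V / real n"
        using delta_bounds(3)[of n V K0] n V K01 by simp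
      ultimately show ?thesis using Qm(2) Q'(2) \<eta>k kl unfolding r(2)[symmetric] by linarith
    qed
    have L0: "0 \<le> L" using kl by (smt (verit) divide_nonneg_nonneg mult_nonneg_nonneg of_nat_0_le_iff)
    have pen: "kappa * (model_cost n V K0 + \<Delta> K0) / real n \<le> 494 * (3134 * L + \<Delta> K0 / real n)"
    proof -
      have "kappa * (model_cost n V K0 + \<Delta> K0) \<le> 494 * (3134 * (real K0 * real V * ln (real n)) + \<Delta> K0)"
        using kappa_bounds model_cost_upper[OF n V K01] model_cost_nonneg[of n V K0] D(1) K0(1) n V K01
        by (intro mult_mono add_mono) auto
      then have "kappa * (model_cost n V K0 + \<Delta> K0) / real n
          \<le> 494 * (3134 * (real K0 * real V * ln (real n)) + \<Delta> K0) / real n"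
        by (rule divide_right_mono) simp
      also have "\<dots> = 494 * (3134 * L + \<Delta> K0 / real n)" by (simp add: L_def add_divide_distrib)
      finally show ?thesis .
    qed
    have one: "1 / real n \<le> 2 * L"
    proof -
      have "1 * 1 \<le> real K0 * real V" using K01 V by (intro mult_mono) auto
      then have "1 / real n \<le> real K0 * real V / real n" by (intro divide_right_mono) auto
      then show ?thesis using kl by simp
    qed
    define R where "R = H + (real K0 * real V * ln (real n) + \<xi> + \<Delta> K0) / real n"
    have IR: "(INF K\<in>\<K>. risk K) = ereal R" unfolding K0(2) by (simp add: risk_def Hs R_def)
    \<comment> \<open>The largest contribution to the constant is \<open>64 * 494 * 3134\<close>, from the penalty of the reference density.\<close>
    define bnd where "bnd = 10 ^ 8 * R"
    have bnd: "a \<le> bnd" if a: "a \<le> 1280 * hellinger2 Pstar (dens_measure \<mu> r) + (19200 * \<xi>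
         + 64 * (kappa * (model_cost n V K0 + \<Delta> K0)) + 264) / real n" for a
    proof -
      have "a \<le> 1280 * h + 19200 * (\<xi> / real n)
          + 64 * (kappa * (model_cost n V K0 + \<Delta> K0) / real n) + 264 * (1 / real n)"
        using a by (simp add: h_def add_divide_distrib)
      also have "\<dots> \<le> 1280 * (2 * H + 12 * L) + 19200 * (\<xi> / real n)
          + 64 * (494 * (3134 * L + \<Delta> K0 / real n)) + 264 * (2 * L)"
        using h pen one by (intro add_mono mult_left_mono) auto
      also have "\<dots> = 2560 * H + 99100432 * L + 19200 * (\<xi> / real n) + 31616 * (\<Delta> K0 / real n)"
        by simp
      also have "\<dots> \<le> 10 ^ 8 * H + 10 ^ 8 * L + 10 ^ 8 * (\<xi> / real n) + 10 ^ 8 * (\<Delta> K0 / real n)"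
        using H0 L0 \<xi> D(1) K0(1) by (intro add_mono mult_right_mono) auto
      also have "\<dots> = bnd" by (simp add: bnd_def R_def L_def add_divide_distrib algebra_simps)
      finally show ?thesis .
    qed
    have "1 - exp (- \<xi>) \<le> measure ?M {x \<in> space ?M. hellinger2 Pstar (Phat x) \<le> bnd}"
      by (rule rho_estimator_risk[OF n sf Fbar ns V F K Q D P Phat K0(1) r(1) bnd])
    also have "{x \<in> space ?M. hellinger2 Pstar (Phat x) \<le> bnd} =
        {x \<in> space ?M. ereal (1 / 10 ^ 8 * hellinger2 Pstar (Phat x)) \<le> (INF K\<in>\<K>. risk K)}"
      unfolding IR bnd_def by (simp add: pos_divide_le_eq mult.commute)
    finally show "1 - exp (- \<xi>) \<le> measure ?M {x \<in> space ?M.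
        ereal (1 / 10 ^ 8 * hellinger2 Pstar (Phat x)) \<le> (INF K\<in>\<K>. risk K)}" .
  qed
qed

end
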